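(* Let $B\subset\Lambda$ be a noise-type Boolean algebra. The following conditions are equivalent: (a) $B$ is classical; (b) there exists a complete noise-type Boolean algebra $\hat B\subset\Lambda$ such that $B\subset\hat B$; (c) $(\sup_n x_n)\vee(\inf_n x_n')=1_\Lambda$ for all sequences $x_1,x_2,\ldots\in B$ such that $x_1\le x_2\le\cdots$.
   Context: Let $(\Omega,\mathcal F,P)$ be a probability space with $H=L_2(\Omega,\mathcal F,P)$ (real-valued functions) separable. Every $\sigma$-field is assumed to contain all null sets. $\Lambda$ is the set of all sub-$\sigma$-fields of $\mathcal F$, partially ordered by inclusion; it is a complete lattice with $x\wedge y=x\cap y$, $x\vee y=\sigma(x,y)$ (the least $\sigma$-field containing $x$ and $y$), $\inf X=\bigcap_{x\in X}x$, $\sup X=\sigma(\bigcup_{x\in X}x)$ for $X\subset\Lambda$; its greatest element is $1_\Lambda=\mathcal F$ and its least element $0_\Lambda$ is the trivial $\sigma$-field (null sets and their complements). A noise-type Boolean algebra is a subset $B\subset\Lambda$ that is a sublattice (closed under $\wedge,\vee$), is distributive ($x\wedge(y\vee z)=(x\wedge y)\vee(x\wedge z)$ for $x,y,z\in B$), contains $0_\Lambda$ and $1_\Lambda$, is such that every $x\in B$ has a (necessarily unique) complement $x'\in B$ ($x\wedge x'=0_\Lambda$, $x\vee x'=1_\Lambda$), and such that for every $x\in B$ the $\sigma$-fields $x$ and $x'$ are independent. It is called complete if $\inf X\in B$ and $\sup X\in B$ for every $X\subset B$, where $\inf$ and $\sup$ are taken in $\Lambda$. In (c) too, $\sup$ and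 $\inf$ are taken in $\Lambda$. The first chaos space $H^{(1)}(B)$ is the closed linear subspace of $H$ consisting of all $f\in H$ such that $f=\mathbb E(f\mid x)+\mathbb E(f\mid x')$ for all $x\in B$. $B$ is called classical if the $\sigma$-field generated by all functions in $H^{(1)}(B)$ is the whole $\mathcal F$. *)

theory Defs
  imports "HOL-Probability.Probability"
begin

text \<open>
  Square-integrable functions are handled through representatives: equality in \<open>L\<^sub>2\<close> is
  \<open>M\<close>-almost everywhere equality, and all notions below are invariant under it.
\<close>

definition L2_space :: "'a measure \<Rightarrow> ('a \<Rightarrow> real) set" where
  "L2_space M = {f \<in> borel_measurable M. integrable M (\<lambda>\<omega>. (f \<omega>)\<^sup>2)}"

definition L2_dist :: "'a measure \<Rightarrow> ('a \<Rightarrow> real) \<Rightarrow> ('a \<Rightarrow> real) \<Rightarrow> real" where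
  "L2_dist M f g = sqrt (\<integral>\<omega>. (f \<omega> - g \<omega>)\<^sup>2 \<partial>M)"

definition L2_separable :: "'a measure \<Rightarrow> bool" where
  "L2_separable M \<longleftrightarrow>
     (\<exists>D. countable D \<and> D \<subseteq> L2_space M \<and> (\<forall>f\<in>L2_space M. \<forall>e>0. \<exists>d\<in>D. L2_dist M f d < e))"

text \<open>
  A \<open>\<sigma>\<close>-field is a set of events. The null sets it has to contain are the members of
  \<open>null_sets M\<close>, that is, the events of probability zero; \<open>M\<close> need not be complete, and for a
  complete \<open>M\<close> these are all the negligible sets.
\<close>

definition sub_sigma_fields :: "'a measure \<Rightarrow> 'a set set set" where
  "sub_sigma_fields M = {x. sigma_algebra (space M) x \<and> null_sets M \<subseteq> x \<and> x \<subseteq> sets M}"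

definition sf_bot :: "'a measure \<Rightarrow> 'a set set" where
  "sf_bot M = {A \<in> sets M. A \<in> null_sets M \<or> space M - A \<in> null_sets M}"

definition sf_top :: "'a measure \<Rightarrow> 'a set set" where
  "sf_top M = sets M"

definition sf_generated :: "'a measure \<Rightarrow> 'a set set \<Rightarrow> 'a set set" where
  "sf_generated M G = sigma_sets (space M) (null_sets M \<union> G)"

definition sf_join :: "'a measure \<Rightarrow> 'a set set \<Rightarrow> 'a set set \<Rightarrow> 'a set set" where
  "sf_join M x y = sf_generated M (x \<union> y)"

definition sf_Sup :: "'a measure \<Rightarrow> 'a set set set \<Rightarrow> 'a set set" where
  "sf_Sup M X = sf_generated M (\<Union>X)"

text \<open>Intersecting with the greatest element only matters for \<open>X = {}\<close>.\<close>

definition sf_Inf :: "'a measure \<Rightarrow> 'a set set set \<Rightarrow> 'a set set" where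
  "sf_Inf M X = sf_top M \<inter> \<Inter>X"

definition sf_complements :: "'a measure \<Rightarrow> 'a set set \<Rightarrow> 'a set set \<Rightarrow> bool" where
  "sf_complements M x y \<longleftrightarrow> x \<inter> y = sf_bot M \<and> sf_join M x y = sf_top M"

text \<open>
  The complement relative to \<open>B\<close>. An element of \<open>B\<close> may have further complements in the whole
  lattice, but only one in \<open>B\<close>; cf. \<open>noise_type_unique_complement\<close> below.
\<close>

definition sf_compl :: "'a measure \<Rightarrow> 'a set set set \<Rightarrow> 'a set set \<Rightarrow> 'a set set" where
  "sf_compl M B x = (THE y. y \<in> B \<and> sf_complements M x y)"

definition noise_type_boolean_algebra :: "'a measure \<Rightarrow> 'a set set set \<Rightarrow> bool" where
  "noise_type_boolean_algebra M B \<longleftrightarrow>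
     B \<subseteq> sub_sigma_fields M \<and>
     (\<forall>x\<in>B. \<forall>y\<in>B. x \<inter> y \<in> B \<and> sf_join M x y \<in> B) \<and>
     (\<forall>x\<in>B. \<forall>y\<in>B. \<forall>z\<in>B. x \<inter> sf_join M y z = sf_join M (x \<inter> y) (x \<inter> z)) \<and>
     sf_bot M \<in> B \<and> sf_top M \<in> B \<and>
     (\<forall>x\<in>B. \<exists>y\<in>B. sf_complements M x y) \<and>
     (\<forall>x\<in>B. prob_space.indep_set M x (sf_compl M B x))"

definition complete_noise_type_boolean_algebra :: "'a measure \<Rightarrow> 'a set set set \<Rightarrow> bool" where
  "complete_noise_type_boolean_algebra M B \<longleftrightarrow>
     noise_type_boolean_algebra M B \<and> (\<forall>X\<subseteq>B. sf_Inf M X \<in> B \<and> sf_Sup M X \<in> B)"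

definition sf_cond_exp :: "'a measure \<Rightarrow> 'a set set \<Rightarrow> ('a \<Rightarrow> real) \<Rightarrow> 'a \<Rightarrow> real" where
  "sf_cond_exp M x f = real_cond_exp M (sigma (space M) x) f"

definition first_chaos :: "'a measure \<Rightarrow> 'a set set set \<Rightarrow> ('a \<Rightarrow> real) set" where
  "first_chaos M B = {f \<in> L2_space M. \<forall>x\<in>B.
     AE \<omega> in M. f \<omega> = sf_cond_exp M x f \<omega> + sf_cond_exp M (sf_compl M B x) f \<omega>}"

definition classical :: "'a measure \<Rightarrow> 'a set set set \<Rightarrow> bool" where
  "classical M B \<longleftrightarrow>
     sf_generated M {f -` S \<inter> space M | f S. f \<in> first_chaos M B \<and> S \<in> sets borel} = sf_top M"

lemma sf_generated_least:
  assumes "G \<subseteq> sets M"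
  shows "sf_generated M G \<in> sub_sigma_fields M" and "G \<subseteq> sf_generated M G"
    and "\<And>z. z \<in> sub_sigma_fields M \<Longrightarrow> G \<subseteq> z \<Longrightarrow> sf_generated M G \<subseteq> z"
proof -
  have N: "null_sets M \<union> G \<subseteq> sets M"
    using assms by auto
  then have "null_sets M \<union> G \<subseteq> Pow (space M)"
    using sets.sets_into_space by blast
  then have "sigma_algebra (space M) (sigma_sets (space M) (null_sets M \<union> G))"
    by (rule sigma_algebra_sigma_sets)
  then show "sf_generated M G \<in> sub_sigma_fields M"
    using sets.sigma_sets_subset[OF N]
    by (auto simp: sub_sigma_fields_def sf_generated_def)
  show "G \<subseteq> sf_generated M G"
    by (auto simp: sf_generated_def)
  show "sf_generated M G \<subseteq> z" if "z \<in> sub_sigma_fields M" "G \<subseteq> z" for z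
    unfolding sf_generated_def
    using that by (intro sigma_algebra.sigma_sets_subset) (auto simp: sub_sigma_fields_def)
qed

lemma sf_generated_sub_sigma_field:
  assumes "x \<in> sub_sigma_fields M"
  shows "sf_generated M x = x"
  using assms sf_generated_least[of x M] by (auto simp: sub_sigma_fields_def)

lemma noise_type_unique_complement:
  assumes "noise_type_boolean_algebra M B" and "x \<in> B"
  shows "\<exists>!y. y \<in> B \<and> sf_complements M x y"
proof -
  have L: "B \<subseteq> sub_sigma_fields M"
    and I: "\<And>x y. x \<in> B \<Longrightarrow> y \<in> B \<Longrightarrow> x \<inter> y \<in> B"
    and D: "\<And>x y z. x \<in> B \<Longrightarrow> y \<in> B \<Longrightarrow> z \<in> B
              \<Longrightarrow> x \<inter> sf_join M y z = sf_join M (x \<inter> y) (x \<inter> z)"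
    and Z: "sf_bot M \<in> B"
    and C: "\<exists>y\<in>B. sf_complements M x y"
    using assms unfolding noise_type_boolean_algebra_def by auto
  have bot: "sf_bot M \<subseteq> x" if "x \<in> B" for x
  proof
    fix A assume A: "A \<in> sf_bot M"
    from that L have x: "sigma_algebra (space M) x" "null_sets M \<subseteq> x"
      by (auto simp: sub_sigma_fields_def)
    interpret x: sigma_algebra "space M" x by fact
    have "space M - (space M - A) = A"
      using A sets.sets_into_space by (auto simp: sf_bot_def)
    then show "A \<in> x"
      using A x(2) x.compl_sets[of "space M - A"] by (auto simp: sf_bot_def)
  qed
  have le: "y \<subseteq> z"
    if "y \<in> B" "z \<in> B" "sf_complements M x y" "sf_complements M x z" for y z
  proof -
    have "y = y \<inter> sf_join M x z"
      using that L by (auto simp: sf_complements_def sub_sigma_fields_def sf_top_def)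
    also have "\<dots> = sf_join M (x \<inter> y) (y \<inter> z)"
      using D that assms(2) by (simp add: Int_commute)
    also have "\<dots> = sf_generated M (y \<inter> z)"
      using that bot[OF I[OF that(1,2)]]
      by (simp add: sf_complements_def sf_join_def Un_absorb1)
    also have "\<dots> = y \<inter> z"
      using I that L by (intro sf_generated_sub_sigma_field) auto
    finally show ?thesis by auto
  qed
  show ?thesis
    using C le by (metis subset_antisym)
qed

end

theory Submission
  imports Defs
begin

text \<open>
  The implication from completeness to the sequence condition is lattice theory: in a complete
  algebra \<open>B'\<close> the element \<open>inf (c (x n))\<close> lies above the complement of \<open>sup (x n)\<close>. The other two
  implications rest on a few facts about independent \<open>\<sigma>\<close>-fields. If \<open>x\<close> and \<open>y\<close> are independent,
  conditional expectations factorize over \<open>x\<close> and \<open>y\<close> (\<open>E_join_enlarge\<close>), so those belonging to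
  \<open>B\<close>, and also those belonging to \<open>u \<squnion> b\<close> with \<open>b \<in> B\<close> for a \<open>\<sigma>\<close>-field \<open>u\<close> that splits along
  every \<open>b\<close>, multiply as the intersections do (\<open>E_splits_commute\<close>). Hence \<open>L\<^sub>2\<close> can be pictured as
  the \<open>L\<^sub>2\<close> of a space of ``spectral sets'' \<open>S\<close>: conditioning on \<open>b\<close> restricts a function to those
  \<open>S\<close> that lie inside \<open>b\<close>, the first chaos consists of the one-point spectral sets, and the
  \<open>\<sigma>\<close>-field \<open>U\<close> generated by the first chaos belongs to the finite ones. This picture guides the
  proof; the proof itself uses only the projections.

  From the sequence condition to classicality. A function in \<open>spread k z\<close> is one whose spectral
  sets meet at least \<open>k\<close> members of some finite partition of the complement of \<open>z\<close>. A function
  orthogonal to all of \<open>spread k z\<close> has spectral sets with at most \<open>k - 1\<close> points outside \<open>z\<close>, and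
  induction on \<open>k\<close> shows that it is measurable for \<open>U \<squnion> z\<close> (\<open>orthogonal_spread_mble_join\<close>).
  Consequently a function with no component measurable for \<open>U \<squnion> z\<close> is approximated by functions in
  \<open>spread k z\<close>, for every \<open>k\<close>. Now remove from a sufficiently fine partition of the complement of
  \<open>z\<close> each member independently with a small probability \<open>\<epsilon>\<close>. A spectral set meeting many members
  meets a removed one with high probability, whereas the removed part is so small that it contains
  all but finitely many points of an infinite spectral set only with probability at most \<open>\<epsilon>\<close>. Some
  choice of the removed part is good in both respects (\<open>thinning_step\<close>). If \<open>U\<close> is not everything,
  iterating this with \<open>\<epsilon>\<close> decreasing fast yields an increasing sequence \<open>z n\<close> of removed parts
  such that a fixed function \<open>f\<close> orthogonal to \<open>U\<close> keeps a definite distance from the functions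
  measurable for \<open>z n \<squnion> inf (c (z m))\<close>, uniformly in \<open>n\<close>, and so \<open>sup (z n) \<squnion> inf (c (z n))\<close> is
  not everything either (\<open>classical_if_sup_inf\<close>).

  From classicality to a complete algebra. On the first chaos the conditional expectations of \<open>B\<close>
  form a Boolean algebra of commuting projections, in which the projections of \<open>x\<close> and of its
  complement add up to the identity. The algebra \<open>completion\<close> consists of the \<open>\<sigma>\<close>-fields \<open>x\<close> whose
  conditional expectation is, on the first chaos, a strong limit of those of \<open>B\<close>, and which are
  generated by the image of the first chaos. Independence passes to the limit (\<open>star_indep\<close>), so
  finite lattice operations in \<open>completion\<close> are computed from the projections, and classicality
  makes complements join to everything. Suprema are reached by martingale approximation along
  finite joins, and infima are complements of suprema.
\<close>

section \<open>Square-integrable functions\<close>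

context prob_space
begin

abbreviation ae_eq :: "('a \<Rightarrow> real) \<Rightarrow> ('a \<Rightarrow> real) \<Rightarrow> bool" (infix "\<simeq>" 50) where
  "f \<simeq> g \<equiv> AE \<omega> in M. f \<omega> = g \<omega>"

definition ip :: "('a \<Rightarrow> real) \<Rightarrow> ('a \<Rightarrow> real) \<Rightarrow> real" where
  "ip f g = (\<integral>\<omega>. f \<omega> * g \<omega> \<partial>M)"

definition l2 :: "('a \<Rightarrow> real) \<Rightarrow> real" where
  "l2 f = sqrt (\<integral>\<omega>. (f \<omega>)\<^sup>2 \<partial>M)"

lemma L2_measurable [measurable_dest]: "f \<in> L2_space M \<Longrightarrow> f \<in> borel_measurable M"
  by (simp add: L2_space_def)

lemma L2_integrable_square: "f \<in> L2_space M \<Longrightarrow> integrable M (\<lambda>\<omega>. (f \<omega>)\<^sup>2)"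
  by (simp add: L2_space_def)

lemma L2_integrable: "f \<in> L2_space M \<Longrightarrow> integrable M f"
  by (rule square_integrable_imp_integrable[OF L2_measurable L2_integrable_square])

lemma L2_integrable_mult:
  assumes "f \<in> L2_space M" "g \<in> L2_space M"
  shows "integrable M (\<lambda>\<omega>. f \<omega> * g \<omega>)"
proof (rule Bochner_Integration.integrable_bound)
  show "integrable M (\<lambda>\<omega>. (f \<omega>)\<^sup>2 + (g \<omega>)\<^sup>2)"
    using assms by (intro Bochner_Integration.integrable_add L2_integrable_square)
  show "(\<lambda>\<omega>. f \<omega> * g \<omega>) \<in> borel_measurable M"
    using assms by measurable
  have "\<bar>a * b\<bar> \<le> \<bar>a\<^sup>2 + b\<^sup>2\<bar>" for a b :: real
    using zero_le_power2[of "a + b"] zero_le_power2[of "a - b"]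
    unfolding power2_sum power2_diff by (simp add: abs_le_iff)
  then show "AE \<omega> in M. norm (f \<omega> * g \<omega>) \<le> norm ((f \<omega>)\<^sup>2 + (g \<omega>)\<^sup>2)"
    by simp
qed

lemma L2_bounded_mult:
  assumes "f \<in> L2_space M" "h \<in> borel_measurable M" "\<And>\<omega>. \<bar>h \<omega>\<bar> \<le> c"
  shows "(\<lambda>\<omega>. h \<omega> * f \<omega>) \<in> L2_space M"
proof -
  have "integrable M (\<lambda>\<omega>. (h \<omega> * f \<omega>)\<^sup>2)"
  proof (rule Bochner_Integration.integrable_bound)
    show "integrable M (\<lambda>\<omega>. c\<^sup>2 * (f \<omega>)\<^sup>2)"
      using assms by (intro integrable_mult_right L2_integrable_square)
    show "(\<lambda>\<omega>. (h \<omega> * f \<omega>)\<^sup>2) \<in> borel_measurable M"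
      using assms by measurable
    have "(h \<omega>)\<^sup>2 \<le> c\<^sup>2" for \<omega>
      using assms(3)[of \<omega>] power_mono[of "\<bar>h \<omega>\<bar>" c 2] by simp
    then show "AE \<omega> in M. norm ((h \<omega> * f \<omega>)\<^sup>2) \<le> norm (c\<^sup>2 * (f \<omega>)\<^sup>2)"
      by (intro AE_I2) (auto simp: power_mult_distrib intro!: mult_right_mono)
  qed
  moreover have "(\<lambda>\<omega>. h \<omega> * f \<omega>) \<in> borel_measurable M"
    using assms by measurable
  ultimately show ?thesis
    by (simp add: L2_space_def)
qed

lemma L2_add:
  assumes "f \<in> L2_space M" "g \<in> L2_space M"
  shows "(\<lambda>\<omega>. f \<omega> + g \<omega>) \<in> L2_space M"
proof -
  have "integrable M (\<lambda>\<omega>. (f \<omega>)\<^sup>2 + (g \<omega>)\<^sup>2 + 2 * (f \<omega> * g \<omega>))"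
    using assms by (intro Bochner_Integration.integrable_add integrable_mult_right
        L2_integrable_square L2_integrable_mult)
  moreover have "(\<lambda>\<omega>. f \<omega> + g \<omega>) \<in> borel_measurable M"
    using assms by measurable
  ultimately show ?thesis
    by (simp add: L2_space_def power2_sum mult.assoc)
qed

lemma L2_cmult: "f \<in> L2_space M \<Longrightarrow> (\<lambda>\<omega>. c * f \<omega>) \<in> L2_space M"
  using L2_bounded_mult[of f "\<lambda>_. c" "\<bar>c\<bar>"] by simp

lemma L2_diff:
  assumes "f \<in> L2_space M" "g \<in> L2_space M"
  shows "(\<lambda>\<omega>. f \<omega> - g \<omega>) \<in> L2_space M"
  using L2_add[OF assms(1) L2_cmult[OF assms(2), of "-1"]] by simp

lemma L2_bounded:
  assumes "h \<in> borel_measurable M" "\<And>\<omega>. \<bar>h \<omega>\<bar> \<le> c"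
  shows "h \<in> L2_space M"
  using L2_bounded_mult[of "\<lambda>_. 1" h c] assms by (simp add: L2_space_def)

lemma L2_const: "(\<lambda>_. c) \<in> L2_space M"
  by (rule L2_bounded[of _ "\<bar>c\<bar>"]) auto

lemma L2_indicator: "A \<in> sets M \<Longrightarrow> indicator A \<in> L2_space M"
  by (rule L2_bounded[of _ 1]) (auto simp: indicator_def)

lemma ip_commute: "ip f g = ip g f"
  by (simp add: ip_def mult.commute)

lemma ip_diff_left:
  assumes "f \<in> L2_space M" "g \<in> L2_space M" "h \<in> L2_space M"
  shows "ip (\<lambda>\<omega>. f \<omega> - g \<omega>) h = ip f h - ip g h"
  using assms by (simp add: ip_def left_diff_distrib L2_integrable_mult)

lemma ip_cmult_left: "ip (\<lambda>\<omega>. c * f \<omega>) h = c * ip f h"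
  by (simp add: ip_def mult.assoc)

lemma ip_cong:
  assumes "f \<simeq> f'" "g \<simeq> g'" "f \<in> L2_space M" "f' \<in> L2_space M" "g \<in> L2_space M" "g' \<in> L2_space M"
  shows "ip f g = ip f' g'"
  unfolding ip_def by (rule integral_cong_AE) (use assms in \<open>measurable, auto\<close>)

lemma l2_sq: "(l2 f)\<^sup>2 = (\<integral>\<omega>. (f \<omega>)\<^sup>2 \<partial>M)"
  by (simp add: l2_def)

lemma l2_ip: "(l2 f)\<^sup>2 = ip f f"
  unfolding l2_sq ip_def by (simp add: power2_eq_square)

lemma l2_nonneg [simp]: "0 \<le> l2 f"
  by (simp add: l2_def)

lemma l2_cong:
  assumes "f \<simeq> g" "f \<in> L2_space M" "g \<in> L2_space M"
  shows "l2 f = l2 g"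
  unfolding l2_def
  by (intro arg_cong[where f = sqrt] integral_cong_AE) (use assms in \<open>measurable, auto\<close>)

lemma l2_eq_0: 
  assumes "f \<in> L2_space M"
  shows "l2 f = 0 \<longleftrightarrow> f \<simeq> (\<lambda>_. 0)"
  using assms integral_nonneg_eq_0_iff_AE[OF L2_integrable_square[OF assms]]
  by (simp add: l2_def)

lemma l2_add_sq:
  assumes "f \<in> L2_space M" "g \<in> L2_space M"
  shows "(l2 (\<lambda>\<omega>. f \<omega> + g \<omega>))\<^sup>2 = (l2 f)\<^sup>2 + 2 * ip f g + (l2 g)\<^sup>2"
  using assms
  by (simp add: l2_sq ip_def power2_sum L2_integrable_square L2_integrable_mult mult.assoc)

lemma l2_cmult: "l2 (\<lambda>\<omega>. c * f \<omega>) = \<bar>c\<bar> * l2 f"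
  by (simp add: l2_def power_mult_distrib real_sqrt_mult)

lemma l2_diff_sq:
  assumes "f \<in> L2_space M" "g \<in> L2_space M"
  shows "(l2 (\<lambda>\<omega>. f \<omega> - g \<omega>))\<^sup>2 = (l2 f)\<^sup>2 - 2 * ip f g + (l2 g)\<^sup>2"
  using l2_add_sq[OF assms(1) L2_cmult[OF assms(2), of "-1"]] l2_cmult[of "-1" g] ip_cmult_left[of "-1" g f]
  by (simp add: ip_commute[of f])

lemma Cauchy_Schwarz_L2:
  assumes f: "f \<in> L2_space M" and g: "g \<in> L2_space M"
  shows "\<bar>ip f g\<bar> \<le> l2 f * l2 g"
proof -
  have q: "0 \<le> (l2 f)\<^sup>2 + 2 * t * ip f g + t\<^sup>2 * (l2 g)\<^sup>2" for t
    using l2_add_sq[OF f L2_cmult[OF g, of t]] zero_le_power2[of "l2 (\<lambda>\<omega>. f \<omega> + t * g \<omega>)"]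
    by (simp add: l2_cmult power_mult_distrib ip_cmult_left ip_commute[of f])
  have "(ip f g)\<^sup>2 \<le> (l2 f)\<^sup>2 * (l2 g)\<^sup>2"
  proof (cases "l2 g = 0")
    case True
    have "ip f g = 0"
    proof (rule ccontr)
      assume "ip f g \<noteq> 0"
      then show False
        using q[of "- ((l2 f)\<^sup>2 + 1) / (2 * ip f g)"] True by (simp add: field_simps)
    qed
    then show ?thesis by simp
  next
    case False
    define c where "c = (l2 g)\<^sup>2"
    have "0 < c" using False by (simp add: c_def)
    moreover have "0 \<le> (l2 f)\<^sup>2 + 2 * (- ip f g / c) * ip f g + (- ip f g / c)\<^sup>2 * c"
      unfolding c_def by (rule q)
    ultimately have "(ip f g)\<^sup>2 / c \<le> (l2 f)\<^sup>2"
      by (simp add: power_divide power2_eq_square)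
    then show ?thesis
      using \<open>0 < c\<close> by (simp add: c_def pos_divide_le_eq)
  qed
  then have "(\<bar>ip f g\<bar>)\<^sup>2 \<le> (l2 f * l2 g)\<^sup>2"
    by (simp add: power_mult_distrib)
  then show ?thesis
    by (rule power2_le_imp_le) simp
qed

lemma l2_triangle:
  assumes f: "f \<in> L2_space M" and g: "g \<in> L2_space M"
  shows "l2 (\<lambda>\<omega>. f \<omega> + g \<omega>) \<le> l2 f + l2 g"
proof (rule power2_le_imp_le)
  show "(l2 (\<lambda>\<omega>. f \<omega> + g \<omega>))\<^sup>2 \<le> (l2 f + l2 g)\<^sup>2"
    using Cauchy_Schwarz_L2[OF f g] by (simp add: l2_add_sq[OF f g] power2_sum)
qed simp

lemma l2_minus_commute: "l2 (\<lambda>\<omega>. f \<omega> - g \<omega>) = l2 (\<lambda>\<omega>. g \<omega> - f \<omega>)"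
  by (simp add: l2_def power2_commute)

lemma l2_triangle_diff:
  assumes "f \<in> L2_space M" "g \<in> L2_space M" "h \<in> L2_space M"
  shows "l2 (\<lambda>\<omega>. f \<omega> - h \<omega>) \<le> l2 (\<lambda>\<omega>. f \<omega> - g \<omega>) + l2 (\<lambda>\<omega>. g \<omega> - h \<omega>)"
  using l2_triangle[OF L2_diff[OF assms(1,2)] L2_diff[OF assms(2,3)]] by simp

lemma l2_triangle_sub:
  assumes "f \<in> L2_space M" "g \<in> L2_space M"
  shows "l2 f \<le> l2 g + l2 (\<lambda>\<omega>. f \<omega> - g \<omega>)"
  using l2_triangle[OF assms(2) L2_diff[OF assms]] by simp

lemma integral_abs_le_l2:
  assumes "f \<in> L2_space M"
  shows "(\<integral>\<omega>. \<bar>f \<omega>\<bar> \<partial>M) \<le> l2 f"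
proof -
  have f': "(\<lambda>\<omega>. \<bar>f \<omega>\<bar>) \<in> L2_space M"
    using L2_measurable[OF assms] L2_integrable_square[OF assms] by (simp add: L2_space_def)
  have "ip (\<lambda>\<omega>. \<bar>f \<omega>\<bar>) (\<lambda>_. 1) \<le> l2 (\<lambda>\<omega>. \<bar>f \<omega>\<bar>) * l2 (\<lambda>_. 1)"
    using Cauchy_Schwarz_L2[OF f' L2_const[of 1]] by simp
  then show ?thesis
    by (simp add: ip_def l2_def prob_space)
qed

text \<open>
  The increments are summable in \<open>L\<^sub>1\<close>, so the sequence converges almost everywhere; Fatou's lemma
  then controls the distance to the limit.
\<close>

lemma L2_complete:
  fixes f :: "nat \<Rightarrow> 'a \<Rightarrow> real"
  assumes f: "\<And>n. f n \<in> L2_space M"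
    and fast: "\<And>n. l2 (\<lambda>\<omega>. f (Suc n) \<omega> - f n \<omega>) \<le> (1/2)^n"
  obtains g where "g \<in> L2_space M" "(\<lambda>n. l2 (\<lambda>\<omega>. f n \<omega> - g \<omega>)) \<longlonglongrightarrow> 0"
proof -
  have [measurable]: "f n \<in> borel_measurable M" for n
    using f by (rule L2_measurable)
  define d where "d n \<omega> = \<bar>f (Suc n) \<omega> - f n \<omega>\<bar>" for n \<omega>
  have [measurable]: "d n \<in> borel_measurable M" for n
    unfolding d_def by measurable
  have d_int: "(\<integral>\<^sup>+\<omega>. ennreal (d n \<omega>) \<partial>M) \<le> ennreal ((1/2)^n)" for n
  proof -
    have L: "(\<lambda>\<omega>. f (Suc n) \<omega> - f n \<omega>) \<in> L2_space M"
      using f by (intro L2_diff)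
    have "(\<integral>\<^sup>+\<omega>. ennreal (d n \<omega>) \<partial>M) = ennreal (\<integral>\<omega>. d n \<omega> \<partial>M)"
      unfolding d_def using L2_integrable[OF L] by (intro nn_integral_eq_integral) auto
    also have "\<dots> \<le> ennreal ((1/2)^n)"
      using integral_abs_le_l2[OF L] fast[of n] by (auto simp: d_def intro!: ennreal_leI)
    finally show ?thesis .
  qed
  have "(\<integral>\<^sup>+\<omega>. (\<Sum>n. ennreal (d n \<omega>)) \<partial>M) = (\<Sum>n. \<integral>\<^sup>+\<omega>. ennreal (d n \<omega>) \<partial>M)"
    by (rule nn_integral_suminf) measurable
  also have "\<dots> \<le> (\<Sum>n. ennreal ((1/2)^n))"
    by (intro suminf_le d_int) auto
  also have "\<dots> = ennreal (\<Sum>n. (1/2)^n)"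
    by (rule suminf_ennreal2) (auto intro!: summable_geometric)
  also have "\<dots> < \<infinity>"
    by simp
  finally have "AE \<omega> in M. (\<Sum>n. ennreal (d n \<omega>)) \<noteq> \<infinity>"
    by (intro nn_integral_noteq_infinite) auto
  then have conv: "AE \<omega> in M. convergent (\<lambda>n. f n \<omega>)"
  proof eventually_elim
    case (elim \<omega>)
    then have "summable (\<lambda>n. d n \<omega>)"
      by (intro summable_suminf_not_top) (auto simp: d_def)
    then have "summable (\<lambda>n. f (Suc n) \<omega> - f n \<omega>)"
      unfolding d_def by (rule summable_rabs_cancel)
    then have "convergent (\<lambda>n. \<Sum>k<n. f (Suc k) \<omega> - f k \<omega>)"
      by (simp add: summable_iff_convergent)
    then have "convergent (\<lambda>n. f n \<omega> - f 0 \<omega>)"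
      by (simp only: sum_lessThan_telescope[where f = "\<lambda>n. f n \<omega>"])
    then show ?case
      by (simp add: convergent_diff_const_right_iff)
  qed
  define g where "g \<omega> = lim (\<lambda>n. f n \<omega>)" for \<omega>
  have [measurable]: "g \<in> borel_measurable M"
    unfolding g_def by measurable
  have tail: "l2 (\<lambda>\<omega>. f m \<omega> - f n \<omega>) \<le> 2 * (1/2)^n" if "n \<le> m" for m n
  proof -
    have "l2 (\<lambda>\<omega>. f m \<omega> - f n \<omega>) \<le> 2 * (1/2)^n - 2 * (1/2)^m"
      using that
    proof (induction m rule: dec_induct)
      case base
      then show ?case by (simp add: l2_def)
    next
      case (step m)
      have "l2 (\<lambda>\<omega>. f (Suc m) \<omega> - f n \<omega>)
          \<le> l2 (\<lambda>\<omega>. f (Suc m) \<omega> - f m \<omega>) + l2 (\<lambda>\<omega>. f m \<omega> - f n \<omega>)"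
        using f by (intro l2_triangle_diff)
      then show ?case
        using step.IH fast[of m] by simp
    qed
    then show ?thesis
      using zero_le_power[of "1/2::real" m] by linarith
  qed
  have lim_bound: "(\<integral>\<^sup>+\<omega>. ennreal ((f n \<omega> - g \<omega>)\<^sup>2) \<partial>M) \<le> ennreal ((2 * (1/2)^n)\<^sup>2)" for n
  proof -
    have "(\<integral>\<^sup>+\<omega>. ennreal ((f n \<omega> - g \<omega>)\<^sup>2) \<partial>M)
        = (\<integral>\<^sup>+\<omega>. liminf (\<lambda>m. ennreal ((f m \<omega> - f n \<omega>)\<^sup>2)) \<partial>M)"
    proof (rule nn_integral_cong_AE, use conv in eventually_elim)
      case (elim \<omega>)
      then have "(\<lambda>m. f m \<omega>) \<longlonglongrightarrow> g \<omega>"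
        by (simp add: g_def convergent_LIMSEQ_iff)
      then have "(\<lambda>m. ennreal ((f m \<omega> - f n \<omega>)\<^sup>2)) \<longlonglongrightarrow> ennreal ((g \<omega> - f n \<omega>)\<^sup>2)"
        by (intro tendsto_ennrealI tendsto_intros)
      then show ?case
        using lim_imp_Liminf[OF sequentially_bot] power2_commute[of "g \<omega>" "f n \<omega>"] by metis
    qed
    also have "\<dots> \<le> liminf (\<lambda>m. \<integral>\<^sup>+\<omega>. ennreal ((f m \<omega> - f n \<omega>)\<^sup>2) \<partial>M)"
      by (rule nn_integral_liminf) measurable
    also have "\<dots> \<le> ennreal ((2 * (1/2)^n)\<^sup>2)"
    proof (rule Liminf_le)
      show "\<forall>\<^sub>F m in sequentially. (\<integral>\<^sup>+\<omega>. ennreal ((f m \<omega> - f n \<omega>)\<^sup>2) \<partial>M)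
          \<le> ennreal ((2 * (1/2)^n)\<^sup>2)"
        using eventually_ge_at_top[of n]
      proof eventually_elim
        case (elim m)
        have L: "(\<lambda>\<omega>. f m \<omega> - f n \<omega>) \<in> L2_space M"
          using f by (intro L2_diff)
        have "(\<integral>\<^sup>+\<omega>. ennreal ((f m \<omega> - f n \<omega>)\<^sup>2) \<partial>M) = ennreal ((l2 (\<lambda>\<omega>. f m \<omega> - f n \<omega>))\<^sup>2)"
          unfolding l2_sq using L2_integrable_square[OF L] by (intro nn_integral_eq_integral) auto
        also have "\<dots> \<le> ennreal ((2 * (1/2)^n)\<^sup>2)"
          using tail[OF elim] by (intro ennreal_leI power_mono) auto
        finally show ?case .
      qed
    qed simp
    finally show ?thesis .
  qed
  have fg: "(\<lambda>\<omega>. f n \<omega> - g \<omega>) \<in> L2_space M" for n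
  proof -
    have "integrable M (\<lambda>\<omega>. (f n \<omega> - g \<omega>)\<^sup>2)"
      using lim_bound[of n] by (intro integrableI_bounded) (auto simp: less_top[symmetric] top_unique)
    then show ?thesis by (simp add: L2_space_def)
  qed
  have g: "g \<in> L2_space M"
    using L2_diff[OF f[of 0] fg[of 0]] by simp
  have bound: "l2 (\<lambda>\<omega>. f n \<omega> - g \<omega>) \<le> 2 * (1/2)^n" for n
  proof (rule power2_le_imp_le)
    have "ennreal ((l2 (\<lambda>\<omega>. f n \<omega> - g \<omega>))\<^sup>2) = (\<integral>\<^sup>+\<omega>. ennreal ((f n \<omega> - g \<omega>)\<^sup>2) \<partial>M)"
      unfolding l2_sq using L2_integrable_square[OF fg[of n]]
      by (intro nn_integral_eq_integral[symmetric]) auto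
    then have "ennreal ((l2 (\<lambda>\<omega>. f n \<omega> - g \<omega>))\<^sup>2) \<le> ennreal ((2 * (1/2)^n)\<^sup>2)"
      using lim_bound[of n] by (simp only:)
    then show "(l2 (\<lambda>\<omega>. f n \<omega> - g \<omega>))\<^sup>2 \<le> (2 * (1/2)^n)\<^sup>2"
      by (subst (asm) ennreal_le_iff) auto
  qed simp
  have "(\<lambda>n. l2 (\<lambda>\<omega>. f n \<omega> - g \<omega>)) \<longlonglongrightarrow> 0"
  proof (rule tendsto_sandwich[where f = "\<lambda>_. 0" and h = "\<lambda>n. 2 * (1/2)^n"])
    show "(\<lambda>n. 2 * (1/2)^n :: real) \<longlonglongrightarrow> 0"
      by (intro tendsto_mult_right_zero LIMSEQ_realpow_zero) auto
  qed (use bound in auto)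
  then show ?thesis
    using g that by blast
qed

text \<open>
  A sequence in \<open>W\<close> that minimises the distance to \<open>f\<close> is a Cauchy sequence by the parallelogram
  law, and the residue \<open>g\<close> of its limit is orthogonal to \<open>W\<close>, hence also to \<open>f\<close>; so \<open>g\<close> vanishes.
  In applications this reduces an approximation to a description of the orthogonal complement of
  \<open>W\<close>.
\<close>

lemma L2_approximation:
  assumes W: "W \<subseteq> L2_space M" "(\<lambda>_. 0) \<in> W"
    and add: "\<And>v w. v \<in> W \<Longrightarrow> w \<in> W \<Longrightarrow> (\<lambda>\<omega>. v \<omega> + w \<omega>) \<in> W"
    and scale: "\<And>c w. w \<in> W \<Longrightarrow> (\<lambda>\<omega>. c * w \<omega>) \<in> W"
    and f: "f \<in> L2_space M"
    and orth: "\<And>g. g \<in> L2_space M \<Longrightarrow> (\<And>w. w \<in> W \<Longrightarrow> ip g w = 0) \<Longrightarrow> ip g f = 0"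
    and e: "0 < e"
  obtains w where "w \<in> W" "l2 (\<lambda>\<omega>. f \<omega> - w \<omega>) < e"
proof -
  define D where "D = (\<lambda>w. (l2 (\<lambda>\<omega>. f \<omega> - w \<omega>))\<^sup>2) ` W"
  define d where "d = Inf D"
  have D: "D \<noteq> {}" "bdd_below D"
    using W by (auto simp: D_def intro!: bdd_belowI[of _ 0])
  have lower: "d \<le> (l2 (\<lambda>\<omega>. f \<omega> - w \<omega>))\<^sup>2" if "w \<in> W" for w
    unfolding d_def by (rule cInf_lower) (use that D in \<open>auto simp: D_def\<close>)
  have "\<exists>w\<in>W. (l2 (\<lambda>\<omega>. f \<omega> - w \<omega>))\<^sup>2 < d + ((1/2)^n)\<^sup>2 / 8" for n
  proof -
    have "Inf D < d + ((1/2)^n)\<^sup>2 / 8"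
      by (simp add: d_def)
    then show ?thesis
      using cInf_lessD[OF D(1)] by (auto simp: D_def)
  qed
  then obtain w where w: "\<And>n. w n \<in> W"
    and wd: "\<And>n. (l2 (\<lambda>\<omega>. f \<omega> - w n \<omega>))\<^sup>2 < d + ((1/2)^n)\<^sup>2 / 8"
    by metis
  have wL: "w n \<in> L2_space M" for n
    using w W by auto
  have fast: "l2 (\<lambda>\<omega>. w (Suc n) \<omega> - w n \<omega>) \<le> (1/2)^n" for n
  proof (rule power2_le_imp_le)
    let ?a = "\<lambda>\<omega>. f \<omega> - w n \<omega>" and ?b = "\<lambda>\<omega>. f \<omega> - w (Suc n) \<omega>"
    have L: "?a \<in> L2_space M" "?b \<in> L2_space M"
      using f wL by (auto intro: L2_diff)
    have mid: "(\<lambda>\<omega>. (1/2) * (w n \<omega> + w (Suc n) \<omega>)) \<in> W"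
      using w by (intro scale add)
    have "(\<lambda>\<omega>. ?a \<omega> + ?b \<omega>) = (\<lambda>\<omega>. 2 * (f \<omega> - (1/2) * (w n \<omega> + w (Suc n) \<omega>)))"
      by (simp add: algebra_simps)
    then have "4 * d \<le> (l2 (\<lambda>\<omega>. ?a \<omega> + ?b \<omega>))\<^sup>2"
      using lower[OF mid] l2_cmult[of 2 "\<lambda>\<omega>. f \<omega> - (1/2) * (w n \<omega> + w (Suc n) \<omega>)"]
      by (simp only: power_mult_distrib) simp
    moreover have "(l2 (\<lambda>\<omega>. ?a \<omega> + ?b \<omega>))\<^sup>2 + (l2 (\<lambda>\<omega>. ?a \<omega> - ?b \<omega>))\<^sup>2 = 2 * (l2 ?a)\<^sup>2 + 2 * (l2 ?b)\<^sup>2"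
      by (simp only: l2_add_sq[OF L] l2_diff_sq[OF L])
    moreover have eq: "l2 (\<lambda>\<omega>. w (Suc n) \<omega> - w n \<omega>) = l2 (\<lambda>\<omega>. ?a \<omega> - ?b \<omega>)"
      by simp
    moreover have "((1/2)^Suc n)\<^sup>2 \<le> ((1/2)^n :: real)\<^sup>2"
      by (intro power_mono) auto
    ultimately show "(l2 (\<lambda>\<omega>. w (Suc n) \<omega> - w n \<omega>))\<^sup>2 \<le> ((1/2)^n)\<^sup>2"
      unfolding eq using wd[of n] wd[of "Suc n"] zero_le_power2[of "(1/2)^n :: real"] by linarith
  qed simp
  obtain p where p: "p \<in> L2_space M" and lim: "(\<lambda>n. l2 (\<lambda>\<omega>. w n \<omega> - p \<omega>)) \<longlonglongrightarrow> 0"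
    using L2_complete[OF wL fast] by blast
  define g where "g \<omega> = f \<omega> - p \<omega>" for \<omega>
  have g: "g \<in> L2_space M"
    unfolding g_def using f p by (rule L2_diff)
  have gw: "ip g v = 0" if v: "v \<in> W" for v
  proof -
    have vL: "v \<in> L2_space M" using v W by auto
    have q: "2 * t * ip g v \<le> t\<^sup>2 * (l2 v)\<^sup>2" for t
    proof -
      have low: "d \<le> (l2 (\<lambda>\<omega>. f \<omega> - (w n \<omega> + t * v \<omega>)))\<^sup>2" for n
        using w v by (intro lower add scale)
      have expand: "(l2 (\<lambda>\<omega>. f \<omega> - (w n \<omega> + t * v \<omega>)))\<^sup>2
          = (l2 (\<lambda>\<omega>. f \<omega> - w n \<omega>))\<^sup>2 - 2 * t * ip (\<lambda>\<omega>. f \<omega> - w n \<omega>) v + t\<^sup>2 * (l2 v)\<^sup>2" for n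
        using l2_diff_sq[OF L2_diff[OF f wL[of n]] L2_cmult[OF vL, of t]]
        by (simp add: algebra_simps l2_cmult power_mult_distrib ip_commute[of _ "\<lambda>\<omega>. t * v \<omega>"]
            ip_cmult_left ip_commute[of v])
      have "2 * t * ip (\<lambda>\<omega>. f \<omega> - w n \<omega>) v \<le> t\<^sup>2 * (l2 v)\<^sup>2 + ((1/2)^n)\<^sup>2 / 8" for n
        using wd[of n] low[of n] expand[of n] by linarith
      moreover have "(\<lambda>n. 2 * t * ip (\<lambda>\<omega>. f \<omega> - w n \<omega>) v) \<longlonglongrightarrow> 2 * t * ip g v"
      proof (intro tendsto_intros)
        have "(\<lambda>n. ip (\<lambda>\<omega>. f \<omega> - w n \<omega>) v - ip g v) \<longlonglongrightarrow> 0"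
        proof (rule Lim_null_comparison)
          show "(\<lambda>n. l2 (\<lambda>\<omega>. w n \<omega> - p \<omega>) * l2 v) \<longlonglongrightarrow> 0"
            using lim by (rule tendsto_mult_left_zero)
          show "\<forall>\<^sub>F n in sequentially. norm (ip (\<lambda>\<omega>. f \<omega> - w n \<omega>) v - ip g v) \<le> l2 (\<lambda>\<omega>. w n \<omega> - p \<omega>) * l2 v"
          proof (rule always_eventually, rule allI)
            fix n
            have "ip g v - ip (\<lambda>\<omega>. f \<omega> - w n \<omega>) v = ip (\<lambda>\<omega>. w n \<omega> - p \<omega>) v"
              unfolding g_def using f p wL vL by (simp add: ip_diff_left)
            then show "norm (ip (\<lambda>\<omega>. f \<omega> - w n \<omega>) v - ip g v) \<le> l2 (\<lambda>\<omega>. w n \<omega> - p \<omega>) * l2 v"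
              using Cauchy_Schwarz_L2[OF L2_diff[OF wL[of n] p] vL] by simp
          qed
        qed
        then show "(\<lambda>n. ip (\<lambda>\<omega>. f \<omega> - w n \<omega>) v) \<longlonglongrightarrow> ip g v"
          by (rule LIM_zero_cancel)
      qed
      moreover have "(\<lambda>n. t\<^sup>2 * (l2 v)\<^sup>2 + ((1/2)^n)\<^sup>2 / 8) \<longlonglongrightarrow> t\<^sup>2 * (l2 v)\<^sup>2 + 0\<^sup>2 / 8"
        by (intro tendsto_intros LIMSEQ_realpow_zero) auto
      ultimately show ?thesis
        by (intro tendsto_le[OF _ _ \<open>_ \<longlonglongrightarrow> 2 * t * ip g v\<close>]) auto
    qed
    show ?thesis
    proof (rule ccontr)
      assume ne: "ip g v \<noteq> 0"
      show False
      proof (cases "l2 v = 0")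
        case True
        then show False
          using Cauchy_Schwarz_L2[OF g vL] ne by simp
      next
        case False
        define c where "c = (l2 v)\<^sup>2"
        have "0 < c" using False by (simp add: c_def)
        moreover have "2 * (ip g v / c) * ip g v \<le> (ip g v / c)\<^sup>2 * c"
          unfolding c_def by (rule q)
        ultimately have "2 * (ip g v)\<^sup>2 / c \<le> (ip g v)\<^sup>2 / c"
          by (simp add: power_divide power2_eq_square)
        then have "(ip g v)\<^sup>2 \<le> 0"
          using \<open>0 < c\<close> by (simp add: divide_le_cancel)
        then show False
          using ne by simp
      qed
    qed
  qed
  have "ip g p = 0"
  proof -
    have eq: "ip g p = - ip (\<lambda>\<omega>. w n \<omega> - p \<omega>) g" for n
      using g p wL gw[OF w[of n]] by (simp add: ip_diff_left ip_commute[of g])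
    then have "\<bar>ip g p\<bar> \<le> l2 (\<lambda>\<omega>. w n \<omega> - p \<omega>) * l2 g" for n
      using Cauchy_Schwarz_L2[OF L2_diff[OF wL[of n] p] g] eq[of n] by linarith
    moreover have "(\<lambda>n. l2 (\<lambda>\<omega>. w n \<omega> - p \<omega>) * l2 g) \<longlonglongrightarrow> 0"
      using lim by (rule tendsto_mult_left_zero)
    ultimately have "\<bar>ip g p\<bar> \<le> 0"
      by (intro LIMSEQ_le_const) auto
    then show ?thesis by simp
  qed
  moreover have "ip g f = 0"
    using g gw by (rule orth)
  moreover have "ip g g = ip (\<lambda>\<omega>. f \<omega> - p \<omega>) g"
    by (simp add: ip_def g_def)
  ultimately have "ip g g = 0"
    using ip_diff_left[OF f p g] by (simp add: ip_commute[of f] ip_commute[of p])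
  then have "l2 g = 0"
    by (metis l2_ip power_eq_0_iff)
  obtain n where "l2 (\<lambda>\<omega>. w n \<omega> - p \<omega>) < e"
    using order_tendstoD(2)[OF lim e] by (auto simp: eventually_sequentially)
  moreover have "l2 (\<lambda>\<omega>. f \<omega> - w n \<omega>) \<le> l2 g + l2 (\<lambda>\<omega>. p \<omega> - w n \<omega>)"
    unfolding g_def using f p wL by (intro l2_triangle_diff)
  ultimately show ?thesis
    using that[OF w[of n]] \<open>l2 g = 0\<close> by (simp add: l2_minus_commute)
qed

end

section \<open>Conditional expectations\<close>

context prob_space
begin

abbreviation Lam :: "'a set set set" ("\<Lambda>") where "\<Lambda> \<equiv> sub_sigma_fields M"

abbreviation mble :: "'a set set \<Rightarrow> ('a \<Rightarrow> real) set" where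
  "mble x \<equiv> borel_measurable (sigma (space M) x)"

abbreviation L2_of :: "'a set set \<Rightarrow> ('a \<Rightarrow> real) set" where
  "L2_of x \<equiv> L2_space M \<inter> mble x"

abbreviation E :: "'a set set \<Rightarrow> ('a \<Rightarrow> real) \<Rightarrow> 'a \<Rightarrow> real" where
  "E \<equiv> sf_cond_exp M"

lemma sigma_field_space [simp]: "space (sigma (space M) x) = space M"
  by (simp add: space_measure_of_conv)

lemma sigma_field_sets: "x \<in> \<Lambda> \<Longrightarrow> sets (sigma (space M) x) = x"
  by (auto simp: sub_sigma_fields_def sigma_algebra.sets_measure_of_eq)

lemma sigma_field_le_events: "x \<in> \<Lambda> \<Longrightarrow> x \<subseteq> sets M"
  by (simp add: sub_sigma_fields_def)

lemma sigma_field_subalgebra: "x \<in> \<Lambda> \<Longrightarrow> subalgebra M (sigma (space M) x)"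
  by (simp add: subalgebra_def sigma_field_sets sigma_field_le_events)

lemma sigma_field_sigma_finite: "x \<in> \<Lambda> \<Longrightarrow> sigma_finite_subalgebra M (sigma (space M) x)"
  by (intro finite_measure_subalgebra_is_sigma_finite finite_measure_subalgebra.intro
      finite_measure_subalgebra_axioms.intro sigma_field_subalgebra) unfold_locales

lemma mble_borel: "x \<in> \<Lambda> \<Longrightarrow> f \<in> mble x \<Longrightarrow> f \<in> borel_measurable M"
  by (rule measurable_from_subalg[OF sigma_field_subalgebra])

lemma mble_mono:
  assumes "x \<in> \<Lambda>" "y \<in> \<Lambda>" "x \<subseteq> y" "f \<in> mble x"
  shows "f \<in> mble y"
  using assms(4) by (rule measurable_from_subalg[rotated])
    (simp add: subalgebra_def sigma_field_sets assms)

lemma L2_of_mono: "x \<in> \<Lambda> \<Longrightarrow> y \<in> \<Lambda> \<Longrightarrow> x \<subseteq> y \<Longrightarrow> f \<in> L2_of x \<Longrightarrow> f \<in> L2_of y"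
  using mble_mono by blast

lemma mble_indicator: "x \<in> \<Lambda> \<Longrightarrow> A \<in> x \<Longrightarrow> (indicator A :: 'a \<Rightarrow> real) \<in> mble x"
  by (intro borel_measurable_indicator) (simp add: sigma_field_sets)

lemma mble_indicatorD:
  assumes "x \<in> \<Lambda>" "A \<in> sets M" "(indicator A :: 'a \<Rightarrow> real) \<in> mble x"
  shows "A \<in> x"
  using assms sets.sets_into_space[OF assms(2)]
  by (simp add: borel_measurable_indicator_iff sigma_field_sets Int_absorb2)

lemma mbleI:
  assumes "x \<in> \<Lambda>" "\<And>c. {\<omega> \<in> space M. c < f \<omega>} \<in> x"
  shows "f \<in> mble x"
  by (rule borel_measurableI_greater) (simp add: assms sigma_field_sets)

lemma mbleD:
  assumes "x \<in> \<Lambda>" "f \<in> mble x" "S \<in> sets borel"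
  shows "f -` S \<inter> space M \<in> x"
  using measurable_sets[OF assms(2,3)] by (simp add: sigma_field_sets assms(1))

lemma mble_greater:
  assumes "x \<in> \<Lambda>" "f \<in> mble x"
  shows "{\<omega> \<in> space M. c < f \<omega>} \<in> x"
  using mbleD[OF assms, of "{c<..}"] by (simp add: vimage_def Collect_conj_eq Int_commute)

text \<open>This is where it matters that every \<open>\<sigma>\<close>-field contains the null sets.\<close>

lemma mble_cong:
  assumes x: "x \<in> \<Lambda>" and f: "f \<in> mble x" and g: "g \<in> borel_measurable M" and eq: "f \<simeq> g"
  shows "g \<in> mble x"
proof (rule mbleI[OF x])
  fix c
  interpret x: sigma_algebra "space M" x
    using x by (simp add: sub_sigma_fields_def)
  let ?F = "{\<omega> \<in> space M. c < f \<omega>}" and ?G = "{\<omega> \<in> space M. c < g \<omega>}"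
  have F: "?F \<in> x" using x f by (rule mble_greater)
  have G: "?G \<in> sets M" using g by measurable
  have FM: "?F \<in> sets M" using F sigma_field_le_events[OF x] by auto
  have "AE \<omega> in M. \<omega> \<notin> ?F - ?G" "AE \<omega> in M. \<omega> \<notin> ?G - ?F"
    by (rule eventually_mono[OF eq], simp)+
  then have "?F - ?G \<in> null_sets M" "?G - ?F \<in> null_sets M"
    using AE_iff_null_sets[OF sets.Diff[OF FM G]] AE_iff_null_sets[OF sets.Diff[OF G FM]] by blast+
  then have "?F - ?G \<in> x" "?G - ?F \<in> x"
    using x by (auto simp: sub_sigma_fields_def)
  then have "(?F - (?F - ?G)) \<union> (?G - ?F) \<in> x"
    using F by blast
  also have "(?F - (?F - ?G)) \<union> (?G - ?F) = ?G" by auto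
  finally show "?G \<in> x" .
qed

lemma sf_Int: "x \<in> \<Lambda> \<Longrightarrow> y \<in> \<Lambda> \<Longrightarrow> x \<inter> y \<in> \<Lambda>"
  by (auto simp: sub_sigma_fields_def sigma_algebra_iff2)

lemma mble_Int:
  assumes "x \<in> \<Lambda>" "y \<in> \<Lambda>" "f \<in> mble x" "f \<in> mble y"
  shows "f \<in> mble (x \<inter> y)"
  by (rule mbleI[OF sf_Int[OF assms(1,2)]])
    (rule IntI[OF mble_greater[OF assms(1,3)] mble_greater[OF assms(2,4)]])

lemma E_mble: "E x f \<in> mble x"
  unfolding sf_cond_exp_def by measurable

lemma E_borel: "E x f \<in> borel_measurable M"
  unfolding sf_cond_exp_def by measurable

text \<open>
  Conditional expectations are contractions because, by Jensen's inequality, the square of a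
  conditional expectation is at most the conditional expectation of the square.
\<close>

lemma E_square:
  assumes x: "x \<in> \<Lambda>" and f: "f \<in> L2_space M"
  shows "E x f \<in> L2_space M" "l2 (E x f) \<le> l2 f"
proof -
  interpret sigma_finite_subalgebra M "sigma (space M) x"
    using x by (rule sigma_field_sigma_finite)
  have convex: "convex_on UNIV (\<lambda>t::real. t\<^sup>2)"
    by (rule convex_power2)
  note square = L2_integrable_square[OF f] L2_integrable[OF f]
  have int: "integrable M (\<lambda>\<omega>. (E x f \<omega>)\<^sup>2)"
    unfolding sf_cond_exp_def using square convex
    by (intro integrable_convex_cond_exp[where q = "\<lambda>t. t\<^sup>2" and I = UNIV]) (auto simp: emeasure_space_1)
  then show "E x f \<in> L2_space M"
    by (simp add: L2_space_def E_borel)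
  have "AE \<omega> in M. (E x f \<omega>)\<^sup>2 \<le> E x (\<lambda>\<omega>. (f \<omega>)\<^sup>2) \<omega>"
    unfolding sf_cond_exp_def using square convex
    by (intro real_cond_exp_jensens_inequality(2)[where q = "\<lambda>t. t\<^sup>2" and I = UNIV]) auto
  then have "(\<integral>\<omega>. (E x f \<omega>)\<^sup>2 \<partial>M) \<le> (\<integral>\<omega>. E x (\<lambda>\<omega>. (f \<omega>)\<^sup>2) \<omega> \<partial>M)"
    using int square by (intro integral_mono_AE) (auto simp: sf_cond_exp_def intro: real_cond_exp_int)
  also have "\<dots> = (\<integral>\<omega>. (f \<omega>)\<^sup>2 \<partial>M)"
    unfolding sf_cond_exp_def using square by (intro real_cond_exp_int)
  finally show "l2 (E x f) \<le> l2 f"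
    by (simp add: l2_def)
qed

lemmas E_L2 = E_square(1)
lemmas E_contraction = E_square(2)

lemma E_L2_of: "x \<in> \<Lambda> \<Longrightarrow> f \<in> L2_space M \<Longrightarrow> E x f \<in> L2_of x"
  by (simp add: E_L2 E_mble)

lemma E_add:
  assumes "x \<in> \<Lambda>" "f \<in> L2_space M" "g \<in> L2_space M"
  shows "E x (\<lambda>\<omega>. f \<omega> + g \<omega>) \<simeq> (\<lambda>\<omega>. E x f \<omega> + E x g \<omega>)"
  unfolding sf_cond_exp_def using assms
  by (intro sigma_finite_subalgebra.real_cond_exp_add sigma_field_sigma_finite L2_integrable)

lemma E_diff:
  assumes "x \<in> \<Lambda>" "f \<in> L2_space M" "g \<in> L2_space M"
  shows "E x (\<lambda>\<omega>. f \<omega> - g \<omega>) \<simeq> (\<lambda>\<omega>. E x f \<omega> - E x g \<omega>)"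
  unfolding sf_cond_exp_def using assms
  by (intro sigma_finite_subalgebra.real_cond_exp_diff sigma_field_sigma_finite L2_integrable)

lemma E_cmult:
  assumes "x \<in> \<Lambda>" "f \<in> L2_space M"
  shows "E x (\<lambda>\<omega>. c * f \<omega>) \<simeq> (\<lambda>\<omega>. c * E x f \<omega>)"
  unfolding sf_cond_exp_def using assms
  by (intro sigma_finite_subalgebra.real_cond_exp_cmult sigma_field_sigma_finite L2_integrable)

lemma E_cong:
  assumes "x \<in> \<Lambda>" "f \<simeq> g" "f \<in> L2_space M" "g \<in> L2_space M"
  shows "E x f \<simeq> E x g"
  unfolding sf_cond_exp_def using assms
  by (intro sigma_finite_subalgebra.real_cond_exp_cong sigma_field_sigma_finite L2_measurable)

lemma E_id: "x \<in> \<Lambda> \<Longrightarrow> f \<in> L2_of x \<Longrightarrow> E x f \<simeq> f"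
  unfolding sf_cond_exp_def
  by (intro sigma_finite_subalgebra.real_cond_exp_F_meas sigma_field_sigma_finite) (auto intro: L2_integrable)

lemma E_idD:
  assumes "x \<in> \<Lambda>" "f \<in> L2_space M" "E x f \<simeq> f"
  shows "f \<in> mble x"
  using assms by (intro mble_cong[OF _ E_mble _ assms(3)] L2_measurable)

lemma E_mult:
  assumes "x \<in> \<Lambda>" "f \<in> L2_space M" "h \<in> L2_of x"
  shows "E x (\<lambda>\<omega>. h \<omega> * f \<omega>) \<simeq> (\<lambda>\<omega>. h \<omega> * E x f \<omega>)"
  unfolding sf_cond_exp_def using assms
  by (intro sigma_finite_subalgebra.real_cond_exp_mult sigma_field_sigma_finite L2_integrable_mult)
    (auto intro: L2_measurable)

lemma E_self_adjoint_of:
  assumes "x \<in> \<Lambda>" "f \<in> L2_space M" "g \<in> L2_of x"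
  shows "ip (E x f) g = ip f g"
  unfolding ip_def sf_cond_exp_def using assms
    sigma_finite_subalgebra.real_cond_exp_intg(2)[OF sigma_field_sigma_finite, of x g f]
  by (simp add: L2_integrable_mult L2_measurable mult.commute)

lemma E_self_adjoint:
  assumes "x \<in> \<Lambda>" "f \<in> L2_space M" "g \<in> L2_space M"
  shows "ip (E x f) g = ip f (E x g)"
proof -
  have "ip (E x f) g = ip (E x g) (E x f)"
    using assms by (subst E_self_adjoint_of) (auto simp: E_L2 E_mble ip_commute)
  also have "\<dots> = ip f (E x g)"
    using assms E_self_adjoint_of[of x f "E x g"] by (simp add: E_L2 E_mble ip_commute)
  finally show ?thesis .
qed

lemma E_tower:
  assumes "x \<in> \<Lambda>" "y \<in> \<Lambda>" "x \<subseteq> y" "f \<in> L2_space M"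
  shows "E x (E y f) \<simeq> E x f"
  unfolding sf_cond_exp_def using assms
  by (intro sigma_finite_subalgebra.real_cond_exp_nested_subalg sigma_field_sigma_finite
      sigma_field_subalgebra L2_integrable)
    (simp_all add: subalgebra_def sigma_field_sets)

lemma E_tower':
  assumes "x \<in> \<Lambda>" "y \<in> \<Lambda>" "x \<subseteq> y" "f \<in> L2_space M"
  shows "E y (E x f) \<simeq> E x f"
  using assms by (intro E_id L2_of_mono[OF _ _ _ E_L2_of])

lemma Pythagoras:
  assumes "x \<in> \<Lambda>" "f \<in> L2_space M"
  shows "(l2 f)\<^sup>2 = (l2 (E x f))\<^sup>2 + (l2 (\<lambda>\<omega>. f \<omega> - E x f \<omega>))\<^sup>2"
proof -
  have "ip f (E x f) = (l2 (E x f))\<^sup>2"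
    unfolding l2_ip using assms by (subst E_self_adjoint_of) (auto simp: E_L2 E_mble)
  then show ?thesis
    using assms by (simp add: l2_diff_sq E_L2)
qed

lemma l2_residue_le:
  assumes "x \<in> \<Lambda>" "f \<in> L2_space M"
  shows "l2 (\<lambda>\<omega>. f \<omega> - E x f \<omega>) \<le> l2 f"
  by (rule power2_le_imp_le) (use Pythagoras[OF assms] in auto)

lemma E_best_approximation:
  assumes x: "x \<in> \<Lambda>" and f: "f \<in> L2_space M" and w: "w \<in> L2_of x"
  shows "l2 (\<lambda>\<omega>. f \<omega> - E x f \<omega>) \<le> l2 (\<lambda>\<omega>. f \<omega> - w \<omega>)"
proof -
  have d: "(\<lambda>\<omega>. f \<omega> - w \<omega>) \<in> L2_space M"
    using f w by (auto intro: L2_diff)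
  have "l2 (\<lambda>\<omega>. f \<omega> - E x f \<omega>) = l2 (\<lambda>\<omega>. (f \<omega> - w \<omega>) - E x (\<lambda>\<omega>. f \<omega> - w \<omega>) \<omega>)"
  proof (rule l2_cong)
    show "(\<lambda>\<omega>. f \<omega> - E x f \<omega>) \<simeq> (\<lambda>\<omega>. (f \<omega> - w \<omega>) - E x (\<lambda>\<omega>. f \<omega> - w \<omega>) \<omega>)"
      using E_diff[OF x f, of w] E_id[OF x w] w by (auto elim!: eventually_elim2)
  qed (use f x d in \<open>auto intro!: L2_diff E_L2\<close>)
  also have "\<dots> \<le> l2 (\<lambda>\<omega>. f \<omega> - w \<omega>)"
    using x d by (rule l2_residue_le)
  finally show ?thesis .
qed

lemma integral_indicator_ip: "ip f (indicator A) = (\<integral>\<omega>\<in>A. f \<omega> \<partial>M)"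
  by (simp add: ip_def set_lebesgue_integral_def mult.commute)

lemma E_characterization:
  assumes "x \<in> \<Lambda>" "f \<in> L2_space M" "g \<in> L2_of x"
    and "\<And>A. A \<in> x \<Longrightarrow> ip f (indicator A) = ip g (indicator A)"
  shows "E x f \<simeq> g"
  unfolding sf_cond_exp_def using assms
  by (intro sigma_finite_subalgebra.real_cond_exp_charact sigma_field_sigma_finite)
    (auto simp: integral_indicator_ip sigma_field_sets intro: L2_integrable)

text \<open>
  The events orthogonal to a fixed \<open>f\<close> form a Dynkin system as soon as the whole space is one of
  them.
\<close>

lemma pi_system_test:
  assumes G: "Int_stable G" "G \<subseteq> sets M" "space M \<in> G"
    and f: "f \<in> L2_space M"
    and test: "\<And>A. A \<in> G \<Longrightarrow> ip f (indicator A) = 0"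
    and D: "D \<in> sigma_sets (space M) G"
  shows "ip f (indicator D) = 0"
proof -
  have "G \<subseteq> Pow (space M)"
    using G(2) sets.sets_into_space by blast
  have sub: "sigma_sets (space M) G \<subseteq> sets M"
    using G(2) by (rule sets.sigma_sets_subset)
  have int: "set_integrable M A f" if "A \<in> sets M" for A
    unfolding set_integrable_def using integrable_mult_indicator[OF that L2_integrable[OF f]] by simp
  from \<open>Int_stable G\<close> \<open>G \<subseteq> Pow (space M)\<close> D show ?thesis
  proof (induction rule: sigma_sets_induct_disjoint)
    case (basic A)
    then show ?case by (rule test)
  next
    case empty
    then show ?case by (simp add: ip_def)
  next
    case (compl A)
    have A: "A \<in> sets M" using compl sub by auto
    have "(indicator (space M - A) :: 'a \<Rightarrow> real) = (\<lambda>\<omega>. indicator (space M) \<omega> - indicator A \<omega>)"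
      using sets.sets_into_space[OF A] by (auto simp: fun_eq_iff indicator_def)
    then have "ip f (indicator (space M - A)) = ip f (indicator (space M)) - ip f (indicator A)"
      using ip_diff_left[OF L2_indicator L2_indicator f, of "space M" A] A by (simp add: ip_commute[of f])
    then show ?case using compl test[OF G(3)] by simp
  next
    case (union A)
    have A: "A i \<in> sets M" for i using union sub by auto
    have "ip f (indicator (\<Union>i. A i)) = (\<Sum>i. ip f (indicator (A i)))"
      unfolding integral_indicator_ip using union A
      by (intro lebesgue_integral_countable_add int) (auto simp: disjoint_family_on_def)
    then show ?case using union by simp
  qed
qed

end

section \<open>Joins and independence of \<open>\<sigma>\<close>-fields\<close>

context prob_space
begin

lemma sf_join_mem: "x \<in> \<Lambda> \<Longrightarrow> y \<in> \<Lambda> \<Longrightarrow> sf_join M x y \<in> \<Lambda>"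
  unfolding sf_join_def by (intro sf_generated_least(1)) (auto dest: sigma_field_le_events)

lemma sf_join_upper:
  assumes "x \<in> \<Lambda>" "y \<in> \<Lambda>"
  shows "x \<subseteq> sf_join M x y" "y \<subseteq> sf_join M x y"
  using sf_generated_least(2)[of "x \<union> y" M] assms unfolding sf_join_def
  by (auto dest: sigma_field_le_events)

lemma sf_join_least: "z \<in> \<Lambda> \<Longrightarrow> x \<subseteq> z \<Longrightarrow> y \<subseteq> z \<Longrightarrow> sf_join M x y \<subseteq> z"
  unfolding sf_join_def by (intro sf_generated_least(3)) (auto dest: sigma_field_le_events)

lemma sf_join_mono:
  "x \<subseteq> x' \<Longrightarrow> y \<subseteq> y' \<Longrightarrow> x' \<in> \<Lambda> \<Longrightarrow> y' \<in> \<Lambda> \<Longrightarrow> sf_join M x y \<subseteq> sf_join M x' y'"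
  by (meson order_trans sf_join_least sf_join_mem sf_join_upper)

lemma sf_join_commute: "sf_join M x y = sf_join M y x"
  by (simp add: sf_join_def Un_commute)

lemma sf_join_absorb: "x \<in> \<Lambda> \<Longrightarrow> y \<subseteq> x \<Longrightarrow> sf_join M x y = x"
  unfolding sf_join_def by (simp add: Un_absorb2 sf_generated_sub_sigma_field)

lemma sf_Sup_mem: "X \<subseteq> \<Lambda> \<Longrightarrow> sf_Sup M X \<in> \<Lambda>"
  unfolding sf_Sup_def by (intro sf_generated_least(1)) (auto dest: sigma_field_le_events)

lemma sf_Sup_upper: "X \<subseteq> \<Lambda> \<Longrightarrow> x \<in> X \<Longrightarrow> x \<subseteq> sf_Sup M X"
  using sf_generated_least(2)[of "\<Union>X" M] unfolding sf_Sup_def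
  by (auto dest: sigma_field_le_events)

lemma sf_Sup_least: "z \<in> \<Lambda> \<Longrightarrow> (\<And>x. x \<in> X \<Longrightarrow> x \<subseteq> z) \<Longrightarrow> sf_Sup M X \<subseteq> z"
  unfolding sf_Sup_def by (intro sf_generated_least(3)) (auto dest: sigma_field_le_events)

lemma sf_Inf_mem:
  assumes "X \<subseteq> \<Lambda>"
  shows "sf_Inf M X \<in> \<Lambda>"
proof -
  have alg: "sigma_algebra (space M) x" if "x \<in> X" for x
    using that assms by (auto simp: sub_sigma_fields_def)
  have "sigma_algebra (space M) (sf_Inf M X)"
    unfolding sigma_algebra_iff2
  proof (intro conjI ballI allI impI)
    show "sf_Inf M X \<subseteq> Pow (space M)"
      using sets.space_closed by (auto simp: sf_Inf_def sf_top_def)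
    show "{} \<in> sf_Inf M X"
      using alg by (auto simp: sf_Inf_def sf_top_def sigma_algebra_iff2)
    show "space M - A \<in> sf_Inf M X" if "A \<in> sf_Inf M X" for A
      using that alg by (auto simp: sf_Inf_def sf_top_def sigma_algebra_iff2)
    show "(\<Union>i. A i) \<in> sf_Inf M X" if "range A \<subseteq> sf_Inf M X" for A :: "nat \<Rightarrow> 'a set"
    proof -
      have "(\<Union>i. A i) \<in> x" if "x \<in> X" for x
        using alg[OF that] \<open>range A \<subseteq> sf_Inf M X\<close> that
        by (intro sigma_algebra.countable_nat_UN) (auto simp: sf_Inf_def)
      moreover have "(\<Union>i. A i) \<in> sets M"
        using \<open>range A \<subseteq> sf_Inf M X\<close> by (intro sets.countable_nat_UN) (auto simp: sf_Inf_def sf_top_def)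
      ultimately show ?thesis
        unfolding sf_Inf_def sf_top_def by blast
    qed
  qed
  then show ?thesis
    using assms by (auto simp: sf_Inf_def sf_top_def sub_sigma_fields_def)
qed

lemma sf_top_mem: "sf_top M \<in> \<Lambda>"
  by (auto simp: sf_top_def sub_sigma_fields_def sets.sigma_algebra_axioms)

lemma sf_le_top: "x \<in> \<Lambda> \<Longrightarrow> x \<subseteq> sf_top M"
  by (simp add: sf_top_def sigma_field_le_events)

lemma sf_bot_eq_generated: "sf_bot M = sf_generated M {}"
proof
  interpret g: sigma_algebra "space M" "sf_generated M {}"
    using sf_generated_least(1)[of "{}" M] by (simp add: sub_sigma_fields_def)
  have null: "null_sets M \<subseteq> sf_generated M {}"
    by (auto simp: sf_generated_def)
  show "sf_bot M \<subseteq> sf_generated M {}"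
  proof
    fix A assume A: "A \<in> sf_bot M"
    then have "space M - (space M - A) = A"
      using sets.sets_into_space by (auto simp: sf_bot_def)
    then show "A \<in> sf_generated M {}"
      using A null g.compl_sets[of "space M - A"] by (auto simp: sf_bot_def)
  qed
next
  have "A \<in> sf_bot M" if "A \<in> sigma_sets (space M) (null_sets M)" for A
    using that
  proof induction
    case (Compl A)
    then have "space M - (space M - A) = A"
      using sets.sets_into_space by (auto simp: sf_bot_def)
    with Compl show ?case by (auto simp: sf_bot_def)
  next
    case (Union A)
    show ?case
    proof (cases "\<forall>i. A i \<in> null_sets M")
      case True
      then have "(\<Union>i. A i) \<in> null_sets M" by (intro null_sets_UN) auto
      then show ?thesis by (auto simp: sf_bot_def)
    next
      case False
      then obtain i where "space M - A i \<in> null_sets M"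
        using Union by (auto simp: sf_bot_def)
      then have "space M - (\<Union>i. A i) \<in> null_sets M"
        using Union by (elim null_sets_subset) (auto simp: sf_bot_def)
      then show ?thesis
        using Union by (auto simp: sf_bot_def)
    qed
  qed (auto simp: sf_bot_def)
  then show "sf_generated M {} \<subseteq> sf_bot M"
    by (auto simp: sf_generated_def)
qed

lemma sf_bot_mem: "sf_bot M \<in> \<Lambda>"
  unfolding sf_bot_eq_generated by (rule sf_generated_least(1)) simp

lemma sf_bot_le: "x \<in> \<Lambda> \<Longrightarrow> sf_bot M \<subseteq> x"
  unfolding sf_bot_eq_generated by (rule sf_generated_least(3)) auto

lemma sf_botI:
  assumes "A \<in> sets M" "prob A = 0 \<or> prob A = 1"
  shows "A \<in> sf_bot M"
proof -
  have null: "S \<in> null_sets M" if "S \<in> sets M" "prob S = 0" for S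
    using that by (simp add: null_sets_def emeasure_eq_measure)
  show ?thesis
    using assms null[of A] null[of "space M - A"] prob_compl[of A] by (auto simp: sf_bot_def)
qed

lemma E_bot:
  assumes f: "f \<in> L2_space M"
  shows "E (sf_bot M) f \<simeq> (\<lambda>_. \<integral>\<omega>. f \<omega> \<partial>M)"
proof (rule E_characterization[OF sf_bot_mem f])
  fix A assume A: "A \<in> sf_bot M"
  show "ip f (indicator A) = ip (\<lambda>_. \<integral>\<omega>. f \<omega> \<partial>M) (indicator A)"
  proof (cases "A \<in> null_sets M")
    case True
    have "(indicator A :: 'a \<Rightarrow> real) \<simeq> (\<lambda>_. 0)"
      using AE_not_in[OF True] by eventually_elim (auto simp: indicator_def)
    then have "ip g (indicator A) = 0" if "g \<in> L2_space M" for g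
      using ip_cong[of g g "indicator A" "\<lambda>_. 0"] that True L2_const L2_indicator[of A]
      by (auto simp: ip_def)
    then show ?thesis using f L2_const by metis
  next
    case False
    then have co: "space M - A \<in> null_sets M" and AM: "A \<in> sets M"
      using A by (auto simp: sf_bot_def)
    have "(indicator A :: 'a \<Rightarrow> real) \<simeq> (\<lambda>_. 1)"
      using AE_not_in[OF co] AE_space by eventually_elim (auto simp: indicator_def)
    then have "ip g (indicator A) = ip g (\<lambda>_. 1)" if "g \<in> L2_space M" for g
      using that AM by (intro ip_cong) (auto simp: L2_const L2_indicator)
    from this[OF f] this[OF L2_const] show ?thesis
      by (simp add: ip_def prob_space)
  qed
qed (simp add: L2_const)

lemma indicator_Int_times: "(indicator (A \<inter> C) :: 'a \<Rightarrow> real) = (\<lambda>\<omega>. indicator C \<omega> * indicator A \<omega>)"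
  by (auto simp: fun_eq_iff indicator_def)

lemma L2_indicator_mult:
  assumes "A \<in> sets M" "f \<in> L2_space M"
  shows "(\<lambda>\<omega>. indicator A \<omega> * f \<omega>) \<in> L2_space M"
  using assms by (intro L2_bounded_mult[where c = 1]) (auto simp: indicator_def)

lemma L2_of_indicator: "x \<in> \<Lambda> \<Longrightarrow> A \<in> x \<Longrightarrow> indicator A \<in> L2_of x"
  using sigma_field_le_events by (auto intro: L2_indicator mble_indicator)

lemma L2_of_indicator_mult:
  assumes "x \<in> \<Lambda>" "A \<in> x" "f \<in> L2_of x"
  shows "(\<lambda>\<omega>. indicator A \<omega> * f \<omega>) \<in> L2_of x"
  using assms L2_indicator_mult[of A f] sigma_field_le_events[of x] mble_indicator[of x A]
  by (auto intro: borel_measurable_times)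

lemma ip_indicator_Int: "ip f (indicator (A \<inter> C)) = ip (\<lambda>\<omega>. indicator A \<omega> * f \<omega>) (indicator C)"
  unfolding ip_def by (intro Bochner_Integration.integral_cong) (auto simp: indicator_def)

lemma ip_mult_shift: "ip (\<lambda>\<omega>. h \<omega> * f \<omega>) g = ip f (\<lambda>\<omega>. h \<omega> * g \<omega>)"
  unfolding ip_def by (simp add: ac_simps)

lemma join_test:
  assumes x: "x \<in> \<Lambda>" and y: "y \<in> \<Lambda>" and f: "f \<in> L2_space M"
    and test: "\<And>A C. A \<in> x \<Longrightarrow> C \<in> y \<Longrightarrow> ip f (indicator (A \<inter> C)) = 0"
    and D: "D \<in> sf_join M x y"
  shows "ip f (indicator D) = 0"
proof -
  let ?G = "{A \<inter> C | A C. A \<in> x \<and> C \<in> y}"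
  interpret x: sigma_algebra "space M" x using x by (simp add: sub_sigma_fields_def)
  interpret y: sigma_algebra "space M" y using y by (simp add: sub_sigma_fields_def)
  have ev: "x \<subseteq> sets M" "y \<subseteq> sets M"
    using x y by (simp_all add: sigma_field_le_events)
  have G: "Int_stable ?G"
  proof (rule Int_stableI)
    fix P Q assume "P \<in> ?G" "Q \<in> ?G"
    then obtain A C A' C' where "P = A \<inter> C" "Q = A' \<inter> C'" "A \<in> x" "A' \<in> x" "C \<in> y" "C' \<in> y"
      by auto
    then have "P \<inter> Q = (A \<inter> A') \<inter> (C \<inter> C')" "A \<inter> A' \<in> x" "C \<inter> C' \<in> y"
      by auto
    then show "P \<inter> Q \<in> ?G" by blast
  qed
  have Gx: "A \<in> ?G" if "A \<in> x" for A
  proof -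
    have "A = A \<inter> space M" using that x.sets_into_space by auto
    then show ?thesis using that y.top by blast
  qed
  have Gy: "C \<in> ?G" if "C \<in> y" for C
  proof -
    have "C = space M \<inter> C" using that y.sets_into_space by auto
    then show ?thesis using that x.top by blast
  qed
  have "null_sets M \<subseteq> x"
    using x by (simp add: sub_sigma_fields_def)
  moreover have "x \<subseteq> ?G" "y \<subseteq> ?G"
    by (rule subsetI, erule Gx, rule subsetI, erule Gy)
  ultimately have "null_sets M \<union> (x \<union> y) \<subseteq> ?G"
    by (meson Un_least order_trans)
  then have "sigma_sets (space M) (null_sets M \<union> (x \<union> y)) \<subseteq> sigma_sets (space M) ?G"
    by (rule sigma_sets_mono')
  then have "D \<in> sigma_sets (space M) ?G"
    using D unfolding sf_join_def sf_generated_def by (rule subsetD)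
  moreover have "?G \<subseteq> sets M"
  proof
    fix P assume "P \<in> ?G"
    then obtain A C where "P = A \<inter> C" "A \<in> x" "C \<in> y" by blast
    with ev show "P \<in> sets M" by (simp add: sets.Int subsetD)
  qed
  moreover have "ip f (indicator P) = 0" if "P \<in> ?G" for P
    using that test by blast
  ultimately show ?thesis
    using pi_system_test[OF G _ Gx[OF x.top] f] by blast
qed

lemma join_characterization:
  assumes x: "x \<in> \<Lambda>" and y: "y \<in> \<Lambda>" and f: "f \<in> L2_space M" and g: "g \<in> L2_of (sf_join M x y)"
    and test: "\<And>A C. A \<in> x \<Longrightarrow> C \<in> y \<Longrightarrow> ip f (indicator (A \<inter> C)) = ip g (indicator (A \<inter> C))"
  shows "E (sf_join M x y) f \<simeq> g"
proof (rule E_characterization[OF sf_join_mem[OF x y] f g])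
  have g2: "g \<in> L2_space M" using g by simp
  fix D assume D: "D \<in> sf_join M x y"
  have ind: "indicator A \<in> L2_space M" if "A \<in> sf_join M x y" for A
    using that sigma_field_le_events[OF sf_join_mem[OF x y]] by (auto intro: L2_indicator)
  have "ip (\<lambda>\<omega>. f \<omega> - g \<omega>) (indicator D) = 0"
  proof (rule join_test[OF x y L2_diff[OF f g2] _ D])
    fix A C assume "A \<in> x" "C \<in> y"
    moreover from this have "A \<inter> C \<in> sets M"
      using x y sigma_field_le_events by blast
    ultimately show "ip (\<lambda>\<omega>. f \<omega> - g \<omega>) (indicator (A \<inter> C)) = 0"
      using test[of A C] f g2 by (simp add: ip_diff_left L2_indicator)
  qed
  then show "ip f (indicator D) = ip g (indicator D)"
    using f g2 ind[OF D] by (simp add: ip_diff_left)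
qed

lemma indep_set_mono: "indep_set x y \<Longrightarrow> x' \<subseteq> x \<Longrightarrow> y' \<subseteq> y \<Longrightarrow> indep_set x' y'"
  unfolding indep_set_def by (rule indep_sets_mono_sets) (auto split: bool.split)

lemma ip_indep:
  assumes x: "x \<in> \<Lambda>" and y: "y \<in> \<Lambda>" and ind: "indep_set x y"
    and f: "f \<in> L2_of x" and g: "g \<in> L2_of y"
  shows "ip f g = (\<integral>\<omega>. f \<omega> \<partial>M) * (\<integral>\<omega>. g \<omega> \<partial>M)"
proof -
  have "indep_var borel f borel g"
    unfolding indep_var_eq
  proof (intro conjI)
    show "f \<in> borel_measurable M" "g \<in> borel_measurable M"
      using f g by (auto intro: L2_measurable)
    interpret x: sigma_algebra "space M" x using x by (simp add: sub_sigma_fields_def)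
    interpret y: sigma_algebra "space M" y using y by (simp add: sub_sigma_fields_def)
    have "sigma_sets (space M) {f -` A \<inter> space M |A. A \<in> sets borel} \<subseteq> x"
      using f mbleD[OF x] by (intro x.sigma_sets_subset) auto
    moreover have "sigma_sets (space M) {g -` A \<inter> space M |A. A \<in> sets borel} \<subseteq> y"
      using g mbleD[OF y] by (intro y.sigma_sets_subset) auto
    ultimately show "indep_set (sigma_sets (space M) {f -` A \<inter> space M |A. A \<in> sets borel})
        (sigma_sets (space M) {g -` A \<inter> space M |A. A \<in> sets borel})"
      by (rule indep_set_mono[OF ind])
  qed
  then show ?thesis
    unfolding ip_def using f g by (intro indep_var_lebesgue_integral) (auto intro: L2_integrable)
qed

lemma indep_set_commute: "indep_set x y \<Longrightarrow> indep_set y x"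
  by (rule indep_setI)
    (auto dest: indep_setD indep_setD_ev1 indep_setD_ev2 simp: Int_commute mult.commute)

text \<open>
  In the integral over a product event \<open>A \<inter> C\<close> the event \<open>C\<close> contributes the factor \<open>prob C\<close> for
  \<open>f\<close> as well as for its conditional expectation, because \<open>x\<close> and \<open>y\<close> are independent.
\<close>

lemma E_join_indep:
  assumes x: "x \<in> \<Lambda>" "x1 \<in> \<Lambda>" "x1 \<subseteq> x" and y: "y \<in> \<Lambda>" and ind: "indep_set x y"
    and f: "f \<in> L2_of x"
  shows "E (sf_join M x1 y) f \<simeq> E x1 f"
proof (rule join_characterization[OF x(2) y])
  have f2: "f \<in> L2_space M" using f by simp
  then show "f \<in> L2_space M" .
  show "E x1 f \<in> L2_of (sf_join M x1 y)"
    using L2_of_mono[OF x(2) sf_join_mem[OF x(2) y] sf_join_upper(1)[OF x(2) y] E_L2_of[OF x(2) f2]] .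
  fix A C assume A: "A \<in> x1" and C: "C \<in> y"
  have Ax: "A \<in> x" using A x by auto
  have AM: "A \<in> sets M" using A x(2) sigma_field_le_events by auto
  have *: "ip h (indicator (A \<inter> C)) = ip h (indicator A) * prob C" if h: "h \<in> L2_of x" for h
  proof -
    have CM: "C \<in> sets M" using C y sigma_field_le_events by auto
    have "ip h (indicator (A \<inter> C)) = (\<integral>\<omega>. indicator A \<omega> * h \<omega> \<partial>M) * (\<integral>\<omega>. indicator C \<omega> \<partial>M)"
      unfolding ip_indicator_Int using h Ax C x y
      by (intro ip_indep[OF x(1) y ind] L2_of_indicator_mult L2_of_indicator)
    then show ?thesis
      using CM by (simp add: ip_def mult.commute)
  qed
  have "ip (E x1 f) (indicator A) = ip f (indicator A)"
    using A f2 x by (intro E_self_adjoint_of L2_of_indicator)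
  then show "ip f (indicator (A \<inter> C)) = ip (E x1 f) (indicator (A \<inter> C))"
    using *[OF f] *[OF L2_of_mono[OF x(2,1,3) E_L2_of[OF x(2) f2]]] by simp
qed

lemma E_join_indep_mult:
  assumes x: "x \<in> \<Lambda>" "x1 \<in> \<Lambda>" "x1 \<subseteq> x" and y: "y \<in> \<Lambda>" "y1 \<in> \<Lambda>" "y1 \<subseteq> y"
    and ind: "indep_set x y" and f: "f \<in> L2_of x" and C: "C \<in> y1"
  shows "E (sf_join M x1 y1) (\<lambda>\<omega>. indicator C \<omega> * f \<omega>) \<simeq> (\<lambda>\<omega>. indicator C \<omega> * E x1 f \<omega>)"
proof -
  have ind1: "indep_set x y1" using ind y(3) by (intro indep_set_mono[OF ind]) auto
  have "E (sf_join M x1 y1) (\<lambda>\<omega>. indicator C \<omega> * f \<omega>) \<simeq> (\<lambda>\<omega>. indicator C \<omega> * E (sf_join M x1 y1) f \<omega>)"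
    using x y f C sf_join_upper(2)[OF x(2) y(2)]
    by (intro E_mult sf_join_mem L2_of_indicator) auto
  with E_join_indep[OF x y(2) ind1 f] show ?thesis
    by (auto elim!: eventually_elim2)
qed

text \<open>
  The product rule for conditional expectations comes from here. A function of the form ``product
  of an \<open>x1\<close>-measurable and a \<open>y1\<close>-measurable factor'' has the same conditional expectation on
  both sides, since only the second factor is affected. The proof tests against products of events
  and moves the conditional expectation to the other side of the inner product, where it acts on
  such a product.
\<close>

lemma E_join_enlarge:
  assumes x: "x \<in> \<Lambda>" "x1 \<in> \<Lambda>" "x1 \<subseteq> x"
    and y: "y \<in> \<Lambda>" "y1 \<in> \<Lambda>" "y2 \<in> \<Lambda>" "y1 \<subseteq> y" "y2 \<subseteq> y1"
    and ind: "indep_set x y" and f: "f \<in> L2_of (sf_join M x1 y1)"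
  shows "E (sf_join M x y2) f \<simeq> E (sf_join M x1 y2) f"
proof (rule join_characterization[OF x(1) y(3)])
  have f2: "f \<in> L2_space M" using f by simp
  then show "f \<in> L2_space M" .
  have J1: "sf_join M x1 y1 \<in> \<Lambda>" and J2: "sf_join M x1 y2 \<in> \<Lambda>" and J3: "sf_join M x y2 \<in> \<Lambda>"
    using x y by (auto intro: sf_join_mem)
  have "sf_join M x1 y2 \<subseteq> sf_join M x y2"
    using x y by (intro sf_join_mono) auto
  then show "E (sf_join M x1 y2) f \<in> L2_of (sf_join M x y2)"
    using L2_of_mono[OF J2 J3 _ E_L2_of[OF J2 f2]] by simp
  fix A C assume A: "A \<in> x" and C: "C \<in> y2"
  have y2: "y2 \<subseteq> y" using y by auto
  have C1: "C \<in> y1" using C y by auto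
  have M: "A \<in> sets M" "C \<in> sets M" using A C x y sigma_field_le_events by auto
  let ?a = "indicator A :: 'a \<Rightarrow> real" and ?p = "\<lambda>\<omega>. indicator C \<omega> * indicator A \<omega> :: real"
  let ?q = "\<lambda>\<omega>. indicator C \<omega> * E x1 ?a \<omega>"
  have a: "?a \<in> L2_of x" using A x by (intro L2_of_indicator)
  have p: "?p \<in> L2_space M" using M by (intro L2_indicator_mult L2_indicator)
  have q: "?q \<in> L2_space M" using M x by (intro L2_indicator_mult E_L2 L2_indicator)
  have "ip f ?p = ip (E (sf_join M x1 y1) f) ?p"
    using E_id[OF J1 f] by (intro ip_cong) (auto simp: f2 p E_L2 J1)
  also have "\<dots> = ip f (E (sf_join M x1 y1) ?p)"
    using J1 f2 p by (rule E_self_adjoint)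
  also have "\<dots> = ip f ?q"
    using E_join_indep_mult[OF x y(1,2,4) ind a C1] by (intro ip_cong) (auto simp: f2 p q E_L2 J1)
  also have "\<dots> = ip f (E (sf_join M x1 y2) ?p)"
    using E_join_indep_mult[OF x y(1,3) y2 ind a C] by (intro ip_cong) (auto simp: f2 p q E_L2 J2)
  also have "\<dots> = ip (E (sf_join M x1 y2) f) ?p"
    using J2 f2 p by (rule E_self_adjoint[symmetric])
  finally show "ip f (indicator (A \<inter> C)) = ip (E (sf_join M x1 y2) f) (indicator (A \<inter> C))"
    by (simp only: indicator_Int_times)
qed

text \<open>
  The lattice of all \<open>\<sigma>\<close>-fields is not distributive, but this much survives inside an independent
  pair: an indicator measurable for both joins is fixed by the conditional expectation on the
  smaller join.
\<close>

lemma join_Int_join: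
  assumes x: "x \<in> \<Lambda>" "u \<in> \<Lambda>" "u \<subseteq> x" and y: "y \<in> \<Lambda>" "v \<in> \<Lambda>" "v \<subseteq> y" and ind: "indep_set x y"
  shows "sf_join M x v \<inter> sf_join M u y = sf_join M u v"
proof
  have J: "sf_join M x v \<in> \<Lambda>" "sf_join M u y \<in> \<Lambda>" "sf_join M u v \<in> \<Lambda>"
    using x y by (auto intro: sf_join_mem)
  show "sf_join M u v \<subseteq> sf_join M x v \<inter> sf_join M u y"
    using x y sf_join_mono[of u x v v] sf_join_mono[of u u v y] by auto
  show "sf_join M x v \<inter> sf_join M u y \<subseteq> sf_join M u v"
  proof
    fix A assume A: "A \<in> sf_join M x v \<inter> sf_join M u y"
    let ?a = "indicator A :: 'a \<Rightarrow> real"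
    have a: "?a \<in> L2_of (sf_join M x v)" "?a \<in> L2_of (sf_join M u y)"
      by (intro L2_of_indicator J IntD1[OF A] IntD2[OF A])+
    have "E (sf_join M x v) ?a \<simeq> E (sf_join M u v) ?a"
      by (rule E_join_enlarge[OF x y(1,1,2) _ y(3) ind a(2)]) simp
    with E_id[OF J(1) a(1)] have "E (sf_join M u v) ?a \<simeq> ?a"
      by (auto elim!: eventually_elim2)
    then have "?a \<in> mble (sf_join M u v)"
      by (rule E_idD[OF J(3) IntD1[OF a(1)]])
    moreover have "A \<in> sets M"
      using A sigma_field_le_events[OF J(1)] by blast
    ultimately show "A \<in> sf_join M u v"
      by (intro mble_indicatorD[OF J(3)])
  qed
qed

text \<open>
  A function on the independent product of \<open>x\<close> and \<open>y\<close> is a kernel; the conditional expectation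
  given \<open>x\<close> of its product with an event of \<open>y\<close> is a section of it. The sections determine the
  kernel, since it is tested against products of events, and if all of them are \<open>u\<close>-measurable,
  the test event from \<open>x\<close> may be replaced by its conditional expectation given \<open>u\<close>.
\<close>

lemma kernel_mble:
  assumes x: "x \<in> \<Lambda>" "u \<in> \<Lambda>" "u \<subseteq> x" and y: "y \<in> \<Lambda>" and ind: "indep_set x y"
    and xy: "sf_join M x y = sf_top M" and f: "f \<in> L2_space M"
    and kernel: "\<And>C. C \<in> y \<Longrightarrow> E x (\<lambda>\<omega>. indicator C \<omega> * f \<omega>) \<in> mble u"
  shows "f \<in> mble (sf_join M u y)"
proof -
  have J: "sf_join M u y \<in> \<Lambda>" using x y by (auto intro: sf_join_mem)
  have Ef: "E (sf_join M u y) f \<in> L2_space M" using J f by (rule E_L2)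
  have top: "g \<in> mble (sf_join M x y)" if "g \<in> L2_space M" for g
    using L2_measurable[OF that] sigma_field_sets[OF sf_top_mem]
    by (simp add: xy measurable_def sf_top_def)
  have "E (sf_join M x y) f \<simeq> E (sf_join M u y) f"
  proof (rule join_characterization[OF x(1) y f])
    show "E (sf_join M u y) f \<in> L2_of (sf_join M x y)"
      using Ef top by blast
    fix A C assume A: "A \<in> x" and C: "C \<in> y"
    have M: "A \<in> sets M" "C \<in> sets M" using A C x y sigma_field_le_events by auto
    let ?a = "indicator A :: 'a \<Rightarrow> real" and ?p = "\<lambda>\<omega>. indicator C \<omega> * indicator A \<omega> :: real"
    let ?q = "\<lambda>\<omega>. indicator C \<omega> * E u ?a \<omega>" and ?f = "\<lambda>\<omega>. indicator C \<omega> * f \<omega>"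
    have a: "?a \<in> L2_of x" using A x by (intro L2_of_indicator)
    have p: "?p \<in> L2_space M" using M by (intro L2_indicator_mult L2_indicator)
    have q: "?q \<in> L2_space M" using M x by (intro L2_indicator_mult E_L2 L2_indicator)
    have cf: "?f \<in> L2_space M" using M f by (intro L2_indicator_mult)
    have a2: "?a \<in> L2_space M" using a by simp
    have Ea: "E u ?a \<in> L2_of x" using L2_of_mono[OF x(2,1,3) E_L2_of[OF x(2) a2]] .
    have "ip f ?p = ip ?f ?a"
      by (rule ip_mult_shift[symmetric])
    also have "\<dots> = ip (E x ?f) ?a"
      using E_self_adjoint_of[OF x(1) cf a] by simp
    also have "\<dots> = ip (E u (E x ?f)) ?a"
      using E_id[OF x(2), of "E x ?f"] kernel[OF C] a2
      by (intro ip_cong) (auto simp: E_L2 x cf)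
    also have "\<dots> = ip (E x ?f) (E u ?a)"
      using x cf a2 by (intro E_self_adjoint E_L2)
    also have "\<dots> = ip ?f (E u ?a)"
      by (rule E_self_adjoint_of[OF x(1) cf Ea])
    also have "\<dots> = ip f ?q"
      by (rule ip_mult_shift)
    also have "\<dots> = ip f (E (sf_join M u y) ?p)"
      using E_join_indep_mult[OF x y y subset_refl ind a C] by (intro ip_cong) (auto simp: f p q E_L2 J)
    also have "\<dots> = ip (E (sf_join M u y) f) ?p"
      using J f p by (rule E_self_adjoint[symmetric])
    finally show "ip f (indicator (A \<inter> C)) = ip (E (sf_join M u y) f) (indicator (A \<inter> C))"
      by (simp only: indicator_Int_times)
  qed
  moreover have "E (sf_join M x y) f \<simeq> f"
    using E_id[OF sf_join_mem[OF x(1) y]] f top[OF f] by blast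
  ultimately have "E (sf_join M u y) f \<simeq> f"
    by (auto elim!: eventually_elim2)
  then show ?thesis
    using J f by (intro E_idD)
qed

text \<open>
  A function orthogonal to the square-integrable functions of every member of the directed family
  is orthogonal to the events of its union, and this union is a \<open>\<pi>\<close>-system generating the
  supremum.
\<close>

lemma directed_Sup_approximation:
  assumes X: "X \<subseteq> \<Lambda>" "X \<noteq> {}" and dir: "\<And>x y. x \<in> X \<Longrightarrow> y \<in> X \<Longrightarrow> \<exists>z\<in>X. x \<subseteq> z \<and> y \<subseteq> z"
    and f: "f \<in> L2_of (sf_Sup M X)" and e: "0 < e"
  obtains x where "x \<in> X" "l2 (\<lambda>\<omega>. f \<omega> - E x f \<omega>) < e"
proof -
  define W where "W = (\<Union>x\<in>X. L2_of x)"
  let ?s = "sf_Sup M X"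
  have s: "?s \<in> \<Lambda>" using X by (intro sf_Sup_mem)
  have f2: "f \<in> L2_space M" using f by simp
  have xM: "x \<subseteq> sets M" if "x \<in> X" for x using that X sigma_field_le_events by blast
  have alg: "sigma_algebra (space M) x" if "x \<in> X" for x
    using that X by (auto simp: sub_sigma_fields_def)
  obtain w where "w \<in> W" "l2 (\<lambda>\<omega>. f \<omega> - w \<omega>) < e"
  proof (rule L2_approximation[of W f e])
    show "W \<subseteq> L2_space M" by (auto simp: W_def)
    show "(\<lambda>_. 0) \<in> W" using X L2_const[of 0] by (auto simp: W_def)
    show "(\<lambda>\<omega>. c * w \<omega>) \<in> W" if "w \<in> W" for c w
      using that L2_cmult[of w c] by (auto simp: W_def intro!: borel_measurable_times)
    show "(\<lambda>\<omega>. v \<omega> + w \<omega>) \<in> W" if vw: "v \<in> W" "w \<in> W" for v w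
    proof -
      from vw obtain x y where xy: "x \<in> X" "y \<in> X" "v \<in> L2_of x" "w \<in> L2_of y"
        by (auto simp: W_def)
      then obtain z where z: "z \<in> X" "x \<subseteq> z" "y \<subseteq> z" using dir by blast
      then have "v \<in> L2_of z" "w \<in> L2_of z"
        using xy X L2_of_mono[of x z v] L2_of_mono[of y z w] by blast+
      then have "(\<lambda>\<omega>. v \<omega> + w \<omega>) \<in> L2_of z"
        by (auto intro: L2_add borel_measurable_add)
      then show ?thesis using z by (auto simp: W_def)
    qed
    show "ip g f = 0" if g: "g \<in> L2_space M" and orth: "\<And>w. w \<in> W \<Longrightarrow> ip g w = 0" for g
    proof -
      have G: "Int_stable (\<Union>X)"
      proof (rule Int_stableI)
        fix A C assume "A \<in> \<Union>X" "C \<in> \<Union>X"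
        then obtain x y where "x \<in> X" "y \<in> X" "A \<in> x" "C \<in> y" by blast
        moreover then obtain z where z: "z \<in> X" "x \<subseteq> z" "y \<subseteq> z" using dir by blast
        ultimately have "A \<in> z" "C \<in> z" by auto
        interpret z: sigma_algebra "space M" z using z(1) by (rule alg)
        have "A \<inter> C \<in> z"
          using \<open>A \<in> z\<close> \<open>C \<in> z\<close> by (rule z.Int)
        then show "A \<inter> C \<in> \<Union>X" using z by auto
      qed
      have GM: "\<Union>X \<subseteq> sets M" using xM by auto
      obtain x0 where x0: "x0 \<in> X" using X by auto
      then have sp: "space M \<in> \<Union>X"
        using sigma_algebra.axioms(1)[OF alg[OF x0]] algebra.top by blast
      have test: "ip g (indicator A) = 0" if "A \<in> \<Union>X" for A
        using that X L2_of_indicator by (intro orth) (auto simp: W_def)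
      have null: "null_sets M \<subseteq> \<Union>X"
        using x0 X by (auto simp: sub_sigma_fields_def)
      have "E ?s g \<simeq> (\<lambda>_. 0)"
      proof (rule E_characterization[OF s g])
        fix D assume "D \<in> ?s"
        then have "D \<in> sigma_sets (space M) (\<Union>X)"
          using null unfolding sf_Sup_def sf_generated_def by (simp add: Un_absorb1)
        then show "ip g (indicator D) = ip (\<lambda>_. 0) (indicator D)"
          using pi_system_test[OF G GM sp g test] by (simp add: ip_def)
      qed (simp add: L2_const)
      then have "ip (E ?s g) f = ip (\<lambda>_. 0) f"
        by (intro ip_cong) (auto simp: f2 g s E_L2 L2_const)
      then show ?thesis
        using E_self_adjoint_of[OF s g f] by (simp add: ip_def)
    qed
  qed (use f2 e in auto)
  then obtain x where x: "x \<in> X" "w \<in> L2_of x" by (auto simp: W_def)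
  with \<open>l2 (\<lambda>\<omega>. f \<omega> - w \<omega>) < e\<close> show ?thesis
    using that[OF x(1)] X(1) E_best_approximation[OF _ f2 x(2)] by fastforce
qed

end

section \<open>The noise-type Boolean algebra\<close>

context prob_space
begin

definition gen :: "('a \<Rightarrow> real) set \<Rightarrow> 'a set set" where
  "gen G = sf_generated M {f -` S \<inter> space M | f S. f \<in> G \<and> S \<in> sets borel}"

lemma gen_events: "G \<subseteq> L2_space M \<Longrightarrow> {f -` S \<inter> space M | f S. f \<in> G \<and> S \<in> sets borel} \<subseteq> sets M"
  using measurable_sets[OF L2_measurable] by blast

lemma gen_mem: "G \<subseteq> L2_space M \<Longrightarrow> gen G \<in> \<Lambda>"
  unfolding gen_def by (rule sf_generated_least(1)[OF gen_events])

lemma gen_mble: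
  assumes G: "G \<subseteq> L2_space M" and f: "f \<in> G"
  shows "f \<in> mble (gen G)"
proof (rule mbleI[OF gen_mem[OF G]])
  fix c
  have "f -` {c<..} \<inter> space M \<in> {f -` S \<inter> space M | f S. f \<in> G \<and> S \<in> sets borel}"
    by (intro CollectI exI[of _ f] exI[of _ "{c<..}"] conjI refl f) simp
  then have "f -` {c<..} \<inter> space M \<in> gen G"
    unfolding gen_def by (rule subsetD[OF sf_generated_least(2)[OF gen_events[OF G]]])
  moreover have "f -` {c<..} \<inter> space M = {\<omega> \<in> space M. c < f \<omega>}"
    by auto
  ultimately show "{\<omega> \<in> space M. c < f \<omega>} \<in> gen G"
    by simp
qed

lemma gen_least:
  assumes G: "G \<subseteq> L2_space M" and z: "z \<in> \<Lambda>" and f: "\<And>f. f \<in> G \<Longrightarrow> f \<in> mble z"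
  shows "gen G \<subseteq> z"
  unfolding gen_def
proof (rule sf_generated_least(3)[OF gen_events[OF G] z])
  show "{f -` S \<inter> space M | f S. f \<in> G \<and> S \<in> sets borel} \<subseteq> z"
    using mbleD[OF z f] by blast
qed

end

locale noise = prob_space M for M :: "'a measure" +
  fixes B :: "'a set set set"
  assumes noise: "noise_type_boolean_algebra M B"
begin

abbreviation J :: "'a set set \<Rightarrow> 'a set set \<Rightarrow> 'a set set" where "J \<equiv> sf_join M"
abbreviation c :: "'a set set \<Rightarrow> 'a set set" where "c \<equiv> sf_compl M B"
abbreviation H1 :: "('a \<Rightarrow> real) set" where "H1 \<equiv> first_chaos M B"

lemma B_sub: "B \<subseteq> \<Lambda>"
  and B_Int: "\<And>x y. x \<in> B \<Longrightarrow> y \<in> B \<Longrightarrow> x \<inter> y \<in> B"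
  and B_join: "\<And>x y. x \<in> B \<Longrightarrow> y \<in> B \<Longrightarrow> J x y \<in> B"
  and B_distrib: "\<And>x y z. x \<in> B \<Longrightarrow> y \<in> B \<Longrightarrow> z \<in> B \<Longrightarrow> x \<inter> J y z = J (x \<inter> y) (x \<inter> z)"
  and B_bot: "sf_bot M \<in> B" and B_top: "sf_top M \<in> B"
  and B_indep: "\<And>x. x \<in> B \<Longrightarrow> indep_set x (c x)"
  using noise unfolding noise_type_boolean_algebra_def by auto

lemma B_mem: "x \<in> B \<Longrightarrow> x \<in> \<Lambda>"
  using B_sub by auto

lemma c_spec: 
  assumes "x \<in> B"
  shows "c x \<in> B \<and> sf_complements M x (c x)"
  unfolding sf_compl_def by (rule theI'[OF noise_type_unique_complement[OF noise assms]])

lemma c_mem: "x \<in> B \<Longrightarrow> c x \<in> B"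
  and c_Int: "x \<in> B \<Longrightarrow> x \<inter> c x = sf_bot M"
  and c_join: "x \<in> B \<Longrightarrow> J x (c x) = sf_top M"
  using c_spec by (auto simp: sf_complements_def)

lemma c_mem': "x \<in> B \<Longrightarrow> c x \<in> \<Lambda>"
  by (simp add: c_mem B_mem)

lemma c_unique: "x \<in> B \<Longrightarrow> y \<in> B \<Longrightarrow> x \<inter> y = sf_bot M \<Longrightarrow> J x y = sf_top M \<Longrightarrow> y = c x"
  using noise_type_unique_complement[OF noise, of x] c_spec[of x] by (auto simp: sf_complements_def)

lemma c_c: "x \<in> B \<Longrightarrow> c (c x) = x"
  by (rule c_unique[symmetric]) (auto simp: c_mem c_Int c_join Int_commute sf_join_commute[of "c x"])

lemma B_split: "a \<in> B \<Longrightarrow> b \<in> B \<Longrightarrow> b = J (b \<inter> a) (b \<inter> c a)"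
  by (metis B_distrib B_mem Int_absorb2 c_join c_mem sf_le_top)

lemma le_c_iff: 
  assumes "a \<in> B" "b \<in> B"
  shows "a \<subseteq> c b \<longleftrightarrow> a \<inter> b = sf_bot M"
proof
  assume "a \<subseteq> c b"
  then have "a \<inter> b \<subseteq> sf_bot M" using c_Int[OF assms(2)] by blast
  then show "a \<inter> b = sf_bot M"
    using sf_bot_le[OF B_mem[OF B_Int[OF assms]]] by auto
next
  assume *: "a \<inter> b = sf_bot M"
  have "a = J (a \<inter> b) (a \<inter> c b)" using assms by (intro B_split)
  also have "\<dots> = a \<inter> c b"
    unfolding * sf_join_commute[of "sf_bot M"] using assms
    by (intro sf_join_absorb sf_bot_le B_mem B_Int c_mem)
  finally show "a \<subseteq> c b" by auto
qed

lemma c_antimono: "a \<in> B \<Longrightarrow> b \<in> B \<Longrightarrow> a \<subseteq> b \<Longrightarrow> c b \<subseteq> c a"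
  by (metis Int_commute c_c c_mem le_c_iff)

text \<open>
  The order dual of \<open>le_c_iff\<close>.
\<close>

lemma c_le_iff_join: 
  assumes "a \<in> B" "b \<in> B"
  shows "c a \<subseteq> b \<longleftrightarrow> J a b = sf_top M"
proof
  assume "c a \<subseteq> b"
  then have "sf_top M \<subseteq> J a b"
    using sf_join_mono[of a a "c a" b] assms by (simp add: c_join B_mem)
  then show "J a b = sf_top M"
    using sf_le_top[OF sf_join_mem] assms B_mem by (simp add: subset_antisym)
next
  assume *: "J a b = sf_top M"
  have "c a = c a \<inter> J a b"
    using sf_le_top[OF B_mem[OF c_mem[OF assms(1)]]] * by auto
  also have "\<dots> = J (c a \<inter> a) (c a \<inter> b)"
    using assms by (intro B_distrib c_mem)
  also have "\<dots> = J (c a \<inter> b) (sf_bot M)"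
    using c_Int[OF assms(1)] by (simp add: Int_commute sf_join_commute)
  also have "\<dots> = c a \<inter> b"
    using assms by (intro sf_join_absorb sf_bot_le B_mem B_Int c_mem)
  finally show "c a \<subseteq> b" by auto
qed

lemma B_distrib': 
  assumes "x \<in> B" "y \<in> B" "z \<in> B"
  shows "J x (y \<inter> z) = J x y \<inter> J x z"
proof -
  have "J x y \<inter> J x z = J (J x y \<inter> x) (J x y \<inter> z)"
    using assms by (intro B_distrib B_join)
  also have "J x y \<inter> x = x"
    using sf_join_upper(1)[of x y] assms B_mem by blast
  also have "J x y \<inter> z = J (z \<inter> x) (z \<inter> y)"
    using B_distrib[of z x y] assms by (simp add: Int_commute)
  also have "J x (J (z \<inter> x) (z \<inter> y)) = J x (y \<inter> z)"
  proof
    have m: "x \<in> \<Lambda>" "y \<inter> z \<in> \<Lambda>" "z \<inter> x \<in> \<Lambda>" "z \<inter> y \<in> \<Lambda>"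
      using assms B_mem B_Int by auto
    show "J x (J (z \<inter> x) (z \<inter> y)) \<subseteq> J x (y \<inter> z)"
      using m sf_join_upper[of x "y \<inter> z"]
      by (intro sf_join_least sf_join_mem) (auto simp: Int_commute)
    show "J x (y \<inter> z) \<subseteq> J x (J (z \<inter> x) (z \<inter> y))"
      using m sf_join_upper(2)[of "z \<inter> x" "z \<inter> y"]
      by (intro sf_join_mono sf_join_mem) (auto simp: Int_commute)
  qed
  finally show ?thesis by simp
qed

lemma c_top: "c (sf_top M) = sf_bot M"
  using B_top B_bot sf_bot_le[OF sf_top_mem]
  by (intro c_unique[symmetric]) (auto simp: sf_join_absorb sf_top_mem Int_absorb1)

lemma c_bot: "c (sf_bot M) = sf_top M"
  using c_c[OF B_top] by (simp add: c_top)

subsection \<open>Finite suprema\<close>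

lemma sf_Sup_insert:
  assumes "a \<in> \<Lambda>" "X \<subseteq> \<Lambda>"
  shows "sf_Sup M (insert a X) = J a (sf_Sup M X)"
proof
  have X: "insert a X \<subseteq> \<Lambda>" using assms by auto
  note up = sf_join_upper[OF assms(1) sf_Sup_mem[OF assms(2)]]
  have "b \<subseteq> J a (sf_Sup M X)" if "b \<in> insert a X" for b
    using that up sf_Sup_upper[OF assms(2), of b] by blast
  then show "sf_Sup M (insert a X) \<subseteq> J a (sf_Sup M X)"
    using assms by (intro sf_Sup_least sf_join_mem sf_Sup_mem)
  show "J a (sf_Sup M X) \<subseteq> sf_Sup M (insert a X)"
    using sf_Sup_upper[OF X] by (intro sf_join_least sf_Sup_mem[OF X] sf_Sup_least) auto
qed

lemma sf_Sup_empty: "sf_Sup M {} = sf_bot M"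
  by (simp add: sf_Sup_def sf_bot_eq_generated)

lemma sf_Sup_mono: "X \<subseteq> Y \<Longrightarrow> Y \<subseteq> \<Lambda> \<Longrightarrow> sf_Sup M X \<subseteq> sf_Sup M Y"
  by (intro sf_Sup_least sf_Sup_mem sf_Sup_upper) auto

lemma B_finite_Sup: "finite X \<Longrightarrow> X \<subseteq> B \<Longrightarrow> sf_Sup M X \<in> B"
proof (induction rule: finite_induct)
  case (insert a X)
  then show ?case
    using B_sub by (subst sf_Sup_insert) (auto intro: B_join B_mem)
qed (simp add: sf_Sup_empty B_bot)

lemma B_distrib_Sup:
  assumes "finite X" "X \<subseteq> B" "a \<in> B"
  shows "a \<inter> sf_Sup M X = sf_Sup M ((\<inter>) a ` X)"
  using assms
proof (induction rule: finite_induct)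
  case empty
  then show ?case using sf_bot_le[OF B_mem] by (auto simp: sf_Sup_empty)
next
  case (insert b X)
  have "(\<inter>) a ` X \<subseteq> B" using insert.prems B_Int by auto
  then have "sf_Sup M (insert (a \<inter> b) ((\<inter>) a ` X)) = J (a \<inter> b) (sf_Sup M ((\<inter>) a ` X))"
    using insert.prems by (intro sf_Sup_insert B_mem B_Int order_trans[OF _ B_sub]) auto
  then have "sf_Sup M ((\<inter>) a ` insert b X) = J (a \<inter> b) (sf_Sup M ((\<inter>) a ` X))"
    by simp
  also have "\<dots> = J (a \<inter> b) (a \<inter> sf_Sup M X)"
    using insert by simp
  also have "\<dots> = a \<inter> J b (sf_Sup M X)"
    using insert by (intro B_distrib[symmetric] B_finite_Sup) auto
  also have "\<dots> = a \<inter> sf_Sup M (insert b X)"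
    using insert B_sub by (subst sf_Sup_insert) (auto intro: B_mem)
  finally show ?case by simp
qed

subsection \<open>\<open>\<sigma>\<close>-fields that split over the algebra\<close>

text \<open>
  The \<open>\<sigma>\<close>-fields \<open>u\<close> that may be adjoined to every member of the algebra without spoiling the
  product rule for conditional expectations. The two instances of interest are the trivial
  \<open>\<sigma>\<close>-field, which gives the algebra itself, and the \<open>\<sigma>\<close>-field generated by the first chaos.
\<close>

definition splits :: "'a set set \<Rightarrow> bool" where
  "splits u \<longleftrightarrow> u \<in> \<Lambda> \<and> (\<forall>b\<in>B. u = J (u \<inter> b) (u \<inter> c b))"

lemma splits_mem: "splits u \<Longrightarrow> u \<in> \<Lambda>"
  by (simp add: splits_def)

lemma splits_bot: "splits (sf_bot M)"
  using B_split[OF _ B_bot] by (simp add: splits_def sf_bot_mem)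

text \<open>
  Cut everything along \<open>a\<close> and its complement. Inside \<open>a\<close> the first \<open>\<sigma>\<close>-field is all of \<open>a\<close>,
  outside \<open>a\<close> it is the part of \<open>u\<close> there and hence contained in the second one; this is the
  situation of \<open>E_join_enlarge\<close>.
\<close>

lemma E_splits_commute:
  assumes u: "splits u" and a: "a \<in> B" and b: "b \<in> B" and f: "f \<in> L2_space M"
  shows "E (J u a) (E (J u b) f) \<simeq> E (J u (a \<inter> b)) f"
proof -
  have mem: "u \<in> \<Lambda>" "a \<in> \<Lambda>" "b \<in> \<Lambda>" "c a \<in> \<Lambda>" "a \<inter> b \<in> \<Lambda>" "c a \<inter> b \<in> \<Lambda>" "u \<inter> a \<in> \<Lambda>" "u \<inter> c a \<in> \<Lambda>"
    using splits_mem[OF u] a b by (auto intro: B_mem c_mem sf_Int)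
  let ?x1 = "J (a \<inter> b) (u \<inter> a)" and ?y1 = "J (c a \<inter> b) (u \<inter> c a)" and ?y2 = "u \<inter> c a"
  have x1: "?x1 \<in> \<Lambda>" "?x1 \<subseteq> a" and y1: "?y1 \<in> \<Lambda>" "?y1 \<subseteq> c a" "?y2 \<subseteq> ?y1"
    by (intro sf_join_mem sf_join_least sf_join_upper mem Int_lower1 Int_lower2)+
  have usplit: "u = J (u \<inter> a) (u \<inter> c a)" and bsplit: "b = J (b \<inter> a) (b \<inter> c a)"
    using u a B_split[OF a b] by (auto simp: splits_def)
  have up: "p \<subseteq> J p q" "q \<subseteq> J p q" if "p \<in> \<Lambda>" "q \<in> \<Lambda>" for p q
    using sf_join_upper that by auto
  have eq1: "J u b = J ?x1 ?y1"
  proof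
    have sub: "u \<inter> a \<subseteq> J ?x1 ?y1" "u \<inter> c a \<subseteq> J ?x1 ?y1" "b \<inter> a \<subseteq> J ?x1 ?y1" "b \<inter> c a \<subseteq> J ?x1 ?y1"
      using up[OF x1(1) y1(1)] up[OF mem(5,7)] up[OF mem(6,8)] by blast+
    note least = sf_join_least[OF sf_join_mem[OF x1(1) y1(1)]]
    from least[OF sub(1,2)] least[OF sub(3,4)] have "u \<subseteq> J ?x1 ?y1" "b \<subseteq> J ?x1 ?y1"
      by (simp_all only: usplit[symmetric] bsplit[symmetric])
    then show "J u b \<subseteq> J ?x1 ?y1"
      by (intro sf_join_least sf_join_mem x1 y1)
    show "J ?x1 ?y1 \<subseteq> J u b"
      using up[OF mem(1,3)] by (intro sf_join_least sf_join_mem mem) auto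
  qed
  have eq2: "J u a = J a ?y2"
  proof
    have "u \<subseteq> J a ?y2"
      using up[OF mem(2,8)] by (subst usplit, intro sf_join_least sf_join_mem mem) auto
    then show "J u a \<subseteq> J a ?y2"
      using up[OF mem(2,8)] by (intro sf_join_least sf_join_mem mem)
    show "J a ?y2 \<subseteq> J u a"
      using up[OF mem(1,2)] by (intro sf_join_least sf_join_mem mem) auto
  qed
  have eq3: "J u (a \<inter> b) = J ?x1 ?y2"
  proof
    have "u \<subseteq> J ?x1 ?y2"
      using up[OF x1(1) mem(8)] up[OF mem(5,7)]
      by (subst usplit, intro sf_join_least sf_join_mem mem) auto
    then show "J u (a \<inter> b) \<subseteq> J ?x1 ?y2"
      using up[OF x1(1) mem(8)] up[OF mem(5,7)] by (intro sf_join_least sf_join_mem mem) auto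
    show "J ?x1 ?y2 \<subseteq> J u (a \<inter> b)"
      using up[OF mem(1,5)] by (intro sf_join_least sf_join_mem mem) auto
  qed
  let ?g = "E (J u b) f"
  have Jm: "J u b \<in> \<Lambda>" "J u (a \<inter> b) \<in> \<Lambda>"
    using mem by (auto intro: sf_join_mem)
  have g: "?g \<in> L2_of (J ?x1 ?y1)"
    unfolding eq1[symmetric] by (rule E_L2_of[OF Jm(1) f])
  have "E (J a ?y2) ?g \<simeq> E (J ?x1 ?y2) ?g"
    by (rule E_join_enlarge[OF mem(2) x1 mem(4) y1(1) mem(8) y1(2,3) B_indep[OF a] g])
  moreover have "E (J u (a \<inter> b)) ?g \<simeq> E (J u (a \<inter> b)) f"
    using sf_join_mono[of u u "a \<inter> b" b] mem by (intro E_tower Jm f) auto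
  ultimately show ?thesis
    unfolding eq2 eq3 by (auto elim!: eventually_elim2)
qed

lemma E_commute:
  assumes "a \<in> B" "b \<in> B" "f \<in> L2_space M"
  shows "E a (E b f) \<simeq> E (a \<inter> b) f"
proof -
  have "J (sf_bot M) x = x" if "x \<in> B" for x
    using sf_join_absorb[OF B_mem sf_bot_le[OF B_mem], of x] that by (simp add: sf_join_commute)
  then show ?thesis
    using E_splits_commute[OF splits_bot assms] assms by (simp add: B_Int)
qed

lemma E_splits_Int:
  assumes u: "splits u" and a: "a \<in> B" and f: "f \<in> L2_space M"
  shows "E a (E u f) \<simeq> E (u \<inter> a) f" "E u (E a f) \<simeq> E (u \<inter> a) f"
proof -
  have mem: "u \<in> \<Lambda>" "a \<in> \<Lambda>" "c a \<in> \<Lambda>" "u \<inter> a \<in> \<Lambda>" "u \<inter> c a \<in> \<Lambda>"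
    using splits_mem[OF u] a by (auto intro: B_mem c_mem sf_Int)
  have usplit: "u = J (u \<inter> a) (u \<inter> c a)"
    using u a by (auto simp: splits_def)
  have J_bot: "J x (sf_bot M) = x" if "x \<in> \<Lambda>" for x
    using that by (intro sf_join_absorb sf_bot_le)
  have "E u f \<in> L2_of (J (u \<inter> a) (u \<inter> c a))"
    using E_L2_of[OF mem(1) f] usplit by simp
  then have "E (J a (sf_bot M)) (E u f) \<simeq> E (J (u \<inter> a) (sf_bot M)) (E u f)"
    by (intro E_join_enlarge[OF mem(2,4) _ mem(3,5) sf_bot_mem _ sf_bot_le[OF mem(5)] B_indep[OF a]]) auto
  moreover have "E (u \<inter> a) (E u f) \<simeq> E (u \<inter> a) f"
    by (intro E_tower mem f) auto
  ultimately show "E a (E u f) \<simeq> E (u \<inter> a) f"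
    unfolding J_bot[OF mem(2)] J_bot[OF mem(4)] by (auto elim!: eventually_elim2)
  let ?g = "E a f"
  have g: "?g \<in> L2_of a" by (rule E_L2_of[OF mem(2) f])
  have "E (J (u \<inter> a) (u \<inter> c a)) ?g \<simeq> E (u \<inter> a) ?g"
    by (rule E_join_indep[OF mem(2,4) _ mem(5) indep_set_mono[OF B_indep[OF a]] g]) auto
  moreover have "E (u \<inter> a) ?g \<simeq> E (u \<inter> a) f"
    by (intro E_tower mem f) auto
  ultimately show "E u (E a f) \<simeq> E (u \<inter> a) f"
    unfolding usplit[symmetric] by (auto elim!: eventually_elim2)
qed

subsection \<open>The first chaos\<close>

lemma H1_L2: "f \<in> H1 \<Longrightarrow> f \<in> L2_space M"
  by (simp add: first_chaos_def)

lemma H1_split: "f \<in> H1 \<Longrightarrow> x \<in> B \<Longrightarrow> f \<simeq> (\<lambda>\<omega>. E x f \<omega> + E (c x) f \<omega>)"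
  by (simp add: first_chaos_def)

lemma H1I:
  "f \<in> L2_space M \<Longrightarrow> (\<And>x. x \<in> B \<Longrightarrow> f \<simeq> (\<lambda>\<omega>. E x f \<omega> + E (c x) f \<omega>)) \<Longrightarrow> f \<in> H1"
  by (simp add: first_chaos_def)

lemma E_commute_swap:
  assumes "a \<in> B" "b \<in> B" "f \<in> L2_space M"
  shows "E a (E b f) \<simeq> E b (E a f)"
  using E_commute[OF assms] E_commute[OF assms(2,1,3)] by (auto simp: Int_commute elim!: eventually_elim2)

lemma H1_E:
  assumes f: "f \<in> H1" and x: "x \<in> B"
  shows "E x f \<in> H1"
proof (rule H1I)
  have f2: "f \<in> L2_space M" using f by (rule H1_L2)
  have xm: "x \<in> \<Lambda>" using x by (rule B_mem)
  show "E x f \<in> L2_space M" by (rule E_L2[OF xm f2])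
  fix y assume y: "y \<in> B"
  have ym: "y \<in> \<Lambda>" "c y \<in> \<Lambda>" using y by (auto intro: B_mem c_mem)
  have s: "(\<lambda>\<omega>. E y f \<omega> + E (c y) f \<omega>) \<in> L2_space M"
    by (intro L2_add E_L2 ym f2)
  have "E x f \<simeq> E x (\<lambda>\<omega>. E y f \<omega> + E (c y) f \<omega>)"
    by (rule E_cong[OF xm H1_split[OF f y] f2 s])
  moreover have "E x (\<lambda>\<omega>. E y f \<omega> + E (c y) f \<omega>) \<simeq> (\<lambda>\<omega>. E x (E y f) \<omega> + E x (E (c y) f) \<omega>)"
    by (intro E_add xm E_L2 ym f2)
  moreover note E_commute_swap[OF x y f2] E_commute_swap[OF x c_mem[OF y] f2]
  ultimately show "E x f \<simeq> (\<lambda>\<omega>. E y (E x f) \<omega> + E (c y) (E x f) \<omega>)"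
    by eventually_elim simp
qed

abbreviation U :: "'a set set" where "U \<equiv> gen H1"

lemma H1_sub: "H1 \<subseteq> L2_space M"
  using H1_L2 by auto

lemma U_mem: "U \<in> \<Lambda>"
  by (rule gen_mem[OF H1_sub])

lemma classical_iff: "classical M B \<longleftrightarrow> U = sf_top M"
  by (simp add: classical_def gen_def)

text \<open>
  A function \<open>f\<close> in the first chaos is the sum of \<open>E b f\<close> and \<open>E (c b) f\<close>, and both summands are
  in the first chaos again.
\<close>

lemma splits_U: "splits U"
  unfolding splits_def
proof (intro conjI ballI U_mem)
  fix b assume b: "b \<in> B"
  have m: "b \<in> \<Lambda>" "c b \<in> \<Lambda>" "U \<inter> b \<in> \<Lambda>" "U \<inter> c b \<in> \<Lambda>"
    using b U_mem by (auto intro: B_mem c_mem sf_Int)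
  have J: "J (U \<inter> b) (U \<inter> c b) \<in> \<Lambda>" using m by (intro sf_join_mem)
  show "U = J (U \<inter> b) (U \<inter> c b)"
  proof
    show "J (U \<inter> b) (U \<inter> c b) \<subseteq> U"
      by (intro sf_join_least U_mem) auto
    show "U \<subseteq> J (U \<inter> b) (U \<inter> c b)"
    proof (rule gen_least[OF H1_sub J])
      fix f assume f: "f \<in> H1"
      have f2: "f \<in> L2_space M" using f by (rule H1_L2)
      have "E b f \<in> mble (U \<inter> b)" "E (c b) f \<in> mble (U \<inter> c b)"
        using b by (auto intro!: mble_Int U_mem m E_mble gen_mble H1_sub H1_E f c_mem)
      then have "E b f \<in> mble (J (U \<inter> b) (U \<inter> c b))" "E (c b) f \<in> mble (J (U \<inter> b) (U \<inter> c b))"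
        using mble_mono[OF m(3) J sf_join_upper(1)[OF m(3,4)]]
          mble_mono[OF m(4) J sf_join_upper(2)[OF m(3,4)]] by blast+
      then have "(\<lambda>\<omega>. E b f \<omega> + E (c b) f \<omega>) \<in> mble (J (U \<inter> b) (U \<inter> c b))"
        by (rule borel_measurable_add)
      moreover have "(\<lambda>\<omega>. E b f \<omega> + E (c b) f \<omega>) \<simeq> f"
        using H1_split[OF f b] by eventually_elim simp
      ultimately show "f \<in> mble (J (U \<inter> b) (U \<inter> c b))"
        by (intro mble_cong[OF J _ L2_measurable[OF f2]])
    qed
  qed
qed

end

section \<open>Functions spread over many pieces\<close>

context noise
begin

text \<open>
  In terms of spectral sets: no spectral set of \<open>h\<close> is contained in the join of \<open>z\<close> with fewer
  than \<open>k\<close> members of a suitable finite cover \<open>b\<close> of the complement of \<open>z\<close>. For a disjoint cover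
  this says that each of them meets at least \<open>k\<close> members; the formulation with joins is inherited
  by refinements of \<open>b\<close> even without disjointness.
\<close>

definition spread :: "nat \<Rightarrow> 'a set set \<Rightarrow> ('a \<Rightarrow> real) set" where
  "spread k z = {h \<in> L2_space M. \<exists>b. finite b \<and> b \<subseteq> B \<and> (\<forall>a\<in>b. a \<subseteq> c z) \<and>
     sf_Sup M (insert z b) = sf_top M \<and>
     (\<forall>F\<subseteq>b. card F < k \<longrightarrow> E (sf_Sup M (insert z F)) h \<simeq> (\<lambda>_. 0))}"

lemma spreadI:
  assumes "h \<in> L2_space M" "finite b" "b \<subseteq> B" "\<And>a. a \<in> b \<Longrightarrow> a \<subseteq> c z"
    "sf_Sup M (insert z b) = sf_top M"
    "\<And>F. F \<subseteq> b \<Longrightarrow> card F < k \<Longrightarrow> E (sf_Sup M (insert z F)) h \<simeq> (\<lambda>_. 0)"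
  shows "h \<in> spread k z"
  unfolding spread_def using assms by blast

lemma spreadE:
  assumes "h \<in> spread k z"
  obtains b where "finite b" "b \<subseteq> B" "\<And>a. a \<in> b \<Longrightarrow> a \<subseteq> c z"
    "sf_Sup M (insert z b) = sf_top M"
    "\<And>F. F \<subseteq> b \<Longrightarrow> card F < k \<Longrightarrow> E (sf_Sup M (insert z F)) h \<simeq> (\<lambda>_. 0)"
proof -
  obtain b where b: "finite b" "b \<subseteq> B" "\<forall>a\<in>b. a \<subseteq> c z" "sf_Sup M (insert z b) = sf_top M"
    "\<forall>F\<subseteq>b. card F < k \<longrightarrow> E (sf_Sup M (insert z F)) h \<simeq> (\<lambda>_. 0)"
    using assms unfolding spread_def mem_Collect_eq by (elim conjE exE)
  show ?thesis
  proof (rule that[OF b(1,2) _ b(4)])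
    show "a \<subseteq> c z" if "a \<in> b" for a
      using b(3) that by (rule bspec)
    show "E (sf_Sup M (insert z F)) h \<simeq> (\<lambda>_. 0)" if "F \<subseteq> b" "card F < k" for F
      by (rule b(5)[rule_format, OF that])
  qed
qed

lemma spread_L2: "h \<in> spread k z \<Longrightarrow> h \<in> L2_space M"
  by (simp add: spread_def)

lemma E_zero: "x \<in> \<Lambda> \<Longrightarrow> E x (\<lambda>_. 0) \<simeq> (\<lambda>_. 0)"
  by (rule E_id[OF _ IntI[OF L2_const borel_measurable_const]])

lemma E_zero_mono:
  assumes "x \<in> \<Lambda>" "y \<in> \<Lambda>" "x \<subseteq> y" "h \<in> L2_space M" "E y h \<simeq> (\<lambda>_. 0)"
  shows "E x h \<simeq> (\<lambda>_. 0)"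
  using E_tower[OF assms(1-4)] E_cong[OF assms(1,5) E_L2[OF assms(2,4)] L2_const] E_zero[OF assms(1)]
  by eventually_elim simp

lemma insert_sub_Lam: "z \<in> B \<Longrightarrow> F \<subseteq> B \<Longrightarrow> insert z F \<subseteq> \<Lambda>"
  using B_sub by auto

lemma top_le_eq: "x \<in> \<Lambda> \<Longrightarrow> sf_top M \<subseteq> x \<Longrightarrow> x = sf_top M"
  by (simp add: sf_le_top subset_antisym)

text \<open>
  Two covers have the common refinement of all pairwise intersections, and a small subfamily of
  the refinement lies below an equally small subfamily of either cover.
\<close>

lemma spread_add:
  assumes z: "z \<in> B" and h1: "h1 \<in> spread k z" and h2: "h2 \<in> spread k z"
  shows "(\<lambda>\<omega>. h1 \<omega> + h2 \<omega>) \<in> spread k z"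
proof -
  obtain b1 where b1: "finite b1" "b1 \<subseteq> B" "\<And>a. a \<in> b1 \<Longrightarrow> a \<subseteq> c z"
      "sf_Sup M (insert z b1) = sf_top M"
    and z1: "\<And>F. F \<subseteq> b1 \<Longrightarrow> card F < k \<Longrightarrow> E (sf_Sup M (insert z F)) h1 \<simeq> (\<lambda>_. 0)"
    using h1 by (rule spreadE) blast
  obtain b2 where b2: "finite b2" "b2 \<subseteq> B" "\<And>a. a \<in> b2 \<Longrightarrow> a \<subseteq> c z"
      "sf_Sup M (insert z b2) = sf_top M"
    and z2: "\<And>F. F \<subseteq> b2 \<Longrightarrow> card F < k \<Longrightarrow> E (sf_Sup M (insert z F)) h2 \<simeq> (\<lambda>_. 0)"
    using h2 by (rule spreadE) blast
  have h: "h1 \<in> L2_space M" "h2 \<in> L2_space M" using h1 h2 by (auto dest: spread_L2)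
  define b where "b = (\<lambda>(p, q). p \<inter> q) ` (b1 \<times> b2)"
  have bB: "p \<inter> q \<in> B" if "p \<in> b1" "q \<in> b2" for p q
    using that b1(2) b2(2) by (intro B_Int) auto
  have b: "finite b" "b \<subseteq> B" unfolding b_def using b1(1) b2(1) bB by auto
  let ?T = "sf_Sup M (insert z b)"
  have T: "?T \<in> \<Lambda>" using z b by (intro sf_Sup_mem insert_sub_Lam)
  have zT: "z \<subseteq> ?T" and bT: "\<And>a. a \<in> b \<Longrightarrow> a \<subseteq> ?T"
    using sf_Sup_upper[OF insert_sub_Lam[OF z b(2)]] by auto
  show ?thesis
  proof (rule spreadI[OF L2_add[OF h] b])
    show "a \<subseteq> c z" if "a \<in> b" for a
      using that b1(3) unfolding b_def by fastforce
    have "a \<subseteq> ?T" if a: "a \<in> b1" for a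
    proof -
      have aB: "a \<in> B" using a b1 by auto
      have "a = a \<inter> sf_Sup M (insert z b2)"
        using sf_le_top[OF B_mem[OF aB]] b2(4) by auto
      also have "\<dots> = sf_Sup M ((\<inter>) a ` insert z b2)"
        using z b2 aB by (intro B_distrib_Sup) auto
      also have "\<dots> \<subseteq> ?T"
      proof (rule sf_Sup_least[OF T])
        fix p assume "p \<in> (\<inter>) a ` insert z b2"
        then consider "p = a \<inter> z" | q where "q \<in> b2" "p = a \<inter> q" by auto
        then show "p \<subseteq> ?T"
        proof cases
          case 1
          then show ?thesis using zT by auto
        next
          case 2
          then have "p \<in> b" unfolding b_def using a by force
          then show ?thesis by (rule bT)
        qed
      qed
      finally show ?thesis .
    qed
    then have "sf_Sup M (insert z b1) \<subseteq> ?T"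
      using zT by (intro sf_Sup_least[OF T]) auto
    then show "?T = sf_top M"
      using b1(4) by (intro top_le_eq T) simp
    fix F assume F: "F \<subseteq> b" "card F < k"
    then have fF: "finite F" using b by (auto intro: finite_subset)
    have "\<exists>p q. p \<in> b1 \<and> q \<in> b2 \<and> a = p \<inter> q" if "a \<in> F" for a
    proof -
      from that F(1) have "a \<in> (\<lambda>(p, q). p \<inter> q) ` (b1 \<times> b2)" unfolding b_def by blast
      then show ?thesis by force
    qed
    then obtain p q where pq: "\<And>a. a \<in> F \<Longrightarrow> p a \<in> b1 \<and> q a \<in> b2 \<and> a = p a \<inter> q a"
      by metis
    let ?S = "sf_Sup M (insert z F)"
    have FB: "F \<subseteq> B" using F b by auto
    have S: "?S \<in> \<Lambda>" using z FB by (intro sf_Sup_mem insert_sub_Lam)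
    have zero: "E ?S h \<simeq> (\<lambda>_. 0)"
      if h: "h \<in> L2_space M" and r: "\<And>a. a \<in> F \<Longrightarrow> r a \<in> b' \<and> a \<subseteq> r a" and b': "b' \<subseteq> B"
        and zb: "\<And>F. F \<subseteq> b' \<Longrightarrow> card F < k \<Longrightarrow> E (sf_Sup M (insert z F)) h \<simeq> (\<lambda>_. 0)" for h r b'
    proof -
      have rF: "r ` F \<subseteq> b'" using r by auto
      have "card (r ` F) < k" using card_image_le[OF fF, of r] F(2) by simp
      then have z0: "E (sf_Sup M (insert z (r ` F))) h \<simeq> (\<lambda>_. 0)"
        using rF by (intro zb)
      have sub: "insert z (r ` F) \<subseteq> \<Lambda>"
        using rF b' z by (intro insert_sub_Lam) auto
      have "?S \<subseteq> sf_Sup M (insert z (r ` F))"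
      proof (rule sf_Sup_least[OF sf_Sup_mem[OF sub]])
        fix a assume "a \<in> insert z F"
        then consider "a = z" | "a \<in> F" by auto
        then show "a \<subseteq> sf_Sup M (insert z (r ` F))"
        proof cases
          case 1
          then show ?thesis using sf_Sup_upper[OF sub] by auto
        next
          case 2
          then have "r a \<subseteq> sf_Sup M (insert z (r ` F))" using sf_Sup_upper[OF sub] by auto
          then show ?thesis using r[OF 2] by blast
        qed
      qed
      then show ?thesis
        by (rule E_zero_mono[OF S sf_Sup_mem[OF sub] _ h z0])
    qed
    have "E ?S h1 \<simeq> (\<lambda>_. 0)"
      using pq by (intro zero[of h1 p b1] h b1 z1) auto
    moreover have "E ?S h2 \<simeq> (\<lambda>_. 0)"
      using pq by (intro zero[of h2 q b2] h b2 z2) auto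
    moreover note E_add[OF S h]
    ultimately show "E ?S (\<lambda>\<omega>. h1 \<omega> + h2 \<omega>) \<simeq> (\<lambda>_. 0)"
      by eventually_elim simp
  qed
qed

lemma spread_cmult:
  assumes z: "z \<in> B" and h: "h \<in> spread k z"
  shows "(\<lambda>\<omega>. t * h \<omega>) \<in> spread k z"
proof -
  obtain b where b: "finite b" "b \<subseteq> B" "\<And>a. a \<in> b \<Longrightarrow> a \<subseteq> c z"
      "sf_Sup M (insert z b) = sf_top M"
    and z1: "\<And>F. F \<subseteq> b \<Longrightarrow> card F < k \<Longrightarrow> E (sf_Sup M (insert z F)) h \<simeq> (\<lambda>_. 0)"
    using h by (rule spreadE) blast
  show ?thesis
  proof (rule spreadI[OF L2_cmult[OF spread_L2[OF h]] b])
    fix F assume F: "F \<subseteq> b" "card F < k"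
    then have "sf_Sup M (insert z F) \<in> \<Lambda>"
      using z b by (intro sf_Sup_mem insert_sub_Lam) auto
    from E_cmult[OF this spread_L2[OF h], of t] z1[OF F]
    show "E (sf_Sup M (insert z F)) (\<lambda>\<omega>. t * h \<omega>) \<simeq> (\<lambda>_. 0)"
      by eventually_elim simp
  qed
qed

text \<open>
  Multiplying by a function of \<open>z\<close> adds points inside \<open>z\<close> only and leaves the number of pieces met
  outside \<open>z\<close> unchanged.
\<close>

lemma spread_mult:
  assumes z: "z \<in> B" and h: "h \<in> mble z" "\<And>\<omega>. \<bar>h \<omega>\<bar> \<le> K" and w: "w \<in> spread k (sf_bot M)"
  shows "(\<lambda>\<omega>. h \<omega> * E (c z) w \<omega>) \<in> spread k z"
proof -
  obtain b where b: "finite b" "b \<subseteq> B" "sf_Sup M (insert (sf_bot M) b) = sf_top M"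
    and z0: "\<And>F. F \<subseteq> b \<Longrightarrow> card F < k \<Longrightarrow> E (sf_Sup M (insert (sf_bot M) F)) w \<simeq> (\<lambda>_. 0)"
    using w by (rule spreadE) blast
  have cz: "c z \<in> B" using z by (rule c_mem)
  have w2: "w \<in> L2_space M" using w by (rule spread_L2)
  have h2: "h \<in> L2_space M"
    using h(2) by (intro L2_bounded mble_borel[OF B_mem[OF z] h(1)])
  let ?\<phi> = "E (c z) w"
  have \<phi>: "?\<phi> \<in> L2_space M" using cz w2 by (intro E_L2 B_mem)
  let ?b = "(\<inter>) (c z) ` b"
  have b': "finite ?b" "?b \<subseteq> B" using b cz B_Int by auto
  let ?T = "sf_Sup M (insert z ?b)"
  have sub: "insert z ?b \<subseteq> \<Lambda>" using z b' by (intro insert_sub_Lam)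
  have T: "?T \<in> \<Lambda>" by (rule sf_Sup_mem[OF sub])
  show ?thesis
  proof (rule spreadI[OF _ b'])
    show "(\<lambda>\<omega>. h \<omega> * ?\<phi> \<omega>) \<in> L2_space M"
      by (rule L2_bounded_mult[OF \<phi> L2_measurable[OF h2] h(2)])
    show "a \<subseteq> c z" if "a \<in> ?b" for a using that by auto
    have "a \<subseteq> ?T" if a: "a \<in> b" for a
    proof -
      have aB: "a \<in> B" using a b by auto
      have "J (a \<inter> z) (a \<inter> c z) \<subseteq> ?T"
      proof (rule sf_join_least[OF T])
        show "a \<inter> z \<subseteq> ?T" using sf_Sup_upper[OF sub, of z] by auto
        have "c z \<inter> a \<in> ?b" using a by blast
        then show "a \<inter> c z \<subseteq> ?T" using sf_Sup_upper[OF sub, of "c z \<inter> a"] by (simp add: Int_commute)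
      qed
      then show ?thesis using B_split[OF z aB] by simp
    qed
    then have "sf_Sup M (insert (sf_bot M) b) \<subseteq> ?T"
      using sf_bot_le[OF T] by (intro sf_Sup_least[OF T]) auto
    then show "?T = sf_top M"
      using b(3) by (intro top_le_eq T) simp
    fix F assume F: "F \<subseteq> ?b" "card F < k"
    then obtain F0 where F0: "F0 \<subseteq> b" "inj_on ((\<inter>) (c z)) F0" "F = (\<inter>) (c z) ` F0"
      using subset_image_inj[of F "(\<inter>) (c z)" b] by blast
    have fF: "finite F" "F \<subseteq> B" using F b' by (auto intro: finite_subset)
    have F0B: "F0 \<subseteq> B" using F0(1) b(2) by (rule order_trans)
    let ?y = "sf_Sup M F"
    have y: "?y \<in> B" using fF by (intro B_finite_Sup)
    have ycz: "?y \<subseteq> c z"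
      using F0(3) by (intro sf_Sup_least[OF B_mem[OF cz]]) auto
    have sub0: "insert (sf_bot M) F0 \<subseteq> \<Lambda>" using B_bot F0B by (intro insert_sub_Lam)
    have "card F0 < k" using F0(2,3) F(2) by (simp add: card_image)
    then have w0: "E (sf_Sup M (insert (sf_bot M) F0)) w \<simeq> (\<lambda>_. 0)"
      by (intro z0 F0)
    have "?y \<subseteq> sf_Sup M (insert (sf_bot M) F0)"
    proof (rule sf_Sup_least[OF sf_Sup_mem[OF sub0]])
      fix a assume "a \<in> F"
      then obtain a0 where "a0 \<in> F0" "a = c z \<inter> a0" using F0(3) by auto
      then show "a \<subseteq> sf_Sup M (insert (sf_bot M) F0)"
        using sf_Sup_upper[OF sub0, of a0] by auto
    qed
    then have y0: "E ?y w \<simeq> (\<lambda>_. 0)"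
      by (rule E_zero_mono[OF B_mem[OF y] sf_Sup_mem[OF sub0] _ w2 w0])
    have eq: "sf_Sup M (insert z F) = J z ?y"
      using fF B_sub by (intro sf_Sup_insert B_mem z) auto
    have Jzy: "J z ?y \<in> B" using z y by (rule B_join)
    have "J z ?y \<inter> c z = J (c z \<inter> z) (c z \<inter> ?y)"
      using B_distrib[OF cz z y] by (simp add: Int_commute)
    also have "\<dots> = J ?y (sf_bot M)"
      using c_Int[OF z] ycz by (simp add: Int_commute sf_join_commute Int_absorb2)
    also have "\<dots> = ?y"
      by (intro sf_join_absorb sf_bot_le B_mem y)
    finally have Jcz: "J z ?y \<inter> c z = ?y" .
    have "h \<in> L2_of (J z ?y)"
      using L2_of_mono[OF B_mem[OF z] B_mem[OF Jzy] sf_join_upper(1)[OF B_mem[OF z] B_mem[OF y]]] h2 h(1)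
      by blast
    then have "E (J z ?y) (\<lambda>\<omega>. h \<omega> * ?\<phi> \<omega>) \<simeq> (\<lambda>\<omega>. h \<omega> * E (J z ?y) ?\<phi> \<omega>)"
      by (intro E_mult B_mem Jzy \<phi>)
    moreover have "E (J z ?y) ?\<phi> \<simeq> E ?y w"
      using E_commute[OF Jzy cz w2] unfolding Jcz .
    ultimately show "E (sf_Sup M (insert z F)) (\<lambda>\<omega>. h \<omega> * ?\<phi> \<omega>) \<simeq> (\<lambda>_. 0)"
      unfolding eq using y0 by eventually_elim simp
  qed
qed

text \<open>
  If moreover every spectral set meets the complement of \<open>x\<close>, that complement counts as one more
  piece.
\<close>

lemma spread_Suc:
  assumes x: "x \<in> B" and f: "f \<in> spread k (c x)" and zero: "E x f \<simeq> (\<lambda>_. 0)"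
  shows "f \<in> spread (Suc k) (sf_bot M)"
proof -
  obtain b where b: "finite b" "b \<subseteq> B" "\<And>a. a \<in> b \<Longrightarrow> a \<subseteq> c (c x)"
      "sf_Sup M (insert (c x) b) = sf_top M"
    and z0: "\<And>F. F \<subseteq> b \<Longrightarrow> card F < k \<Longrightarrow> E (sf_Sup M (insert (c x) F)) f \<simeq> (\<lambda>_. 0)"
    using f by (rule spreadE) blast
  have cx: "c x \<in> B" using x by (rule c_mem)
  have f2: "f \<in> L2_space M" using f by (rule spread_L2)
  have b': "finite (insert (c x) b)" "insert (c x) b \<subseteq> B" using b cx by auto
  have sub: "insert (sf_bot M) (insert (c x) b) \<subseteq> \<Lambda>"
    using b' B_bot by (intro insert_sub_Lam)
  show ?thesis
  proof (rule spreadI[OF f2 b'])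
    show "a \<subseteq> c (sf_bot M)" if "a \<in> insert (c x) b" for a
      using that b' sf_le_top[OF B_mem] unfolding c_bot by blast
    have "sf_Sup M (insert (c x) b) \<subseteq> sf_Sup M (insert (sf_bot M) (insert (c x) b))"
      using sub by (intro sf_Sup_mono) auto
    then show "sf_Sup M (insert (sf_bot M) (insert (c x) b)) = sf_top M"
      using b(4) by (intro top_le_eq sf_Sup_mem sub) simp
    fix F assume F: "F \<subseteq> insert (c x) b" "card F < Suc k"
    have fF: "finite F" using F b' by (auto intro: finite_subset)
    have subF: "insert (sf_bot M) F \<subseteq> \<Lambda>" using F(1) sub by auto
    show "E (sf_Sup M (insert (sf_bot M) F)) f \<simeq> (\<lambda>_. 0)"
    proof (cases "c x \<in> F")
      case True
      let ?F = "F - {c x}"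
      have F': "?F \<subseteq> b" using F(1) by auto
      have "card ?F < k" using card_Suc_Diff1[OF fF True] F(2) by simp
      then have *: "E (sf_Sup M (insert (c x) ?F)) f \<simeq> (\<lambda>_. 0)"
        by (intro z0 F')
      have ins: "insert (c x) ?F = F" using True by auto
      have FL: "F \<subseteq> \<Lambda>" using subF by auto
      have "sf_Sup M (insert (sf_bot M) F) \<subseteq> sf_Sup M F"
        using sf_bot_le[OF sf_Sup_mem[OF FL]] sf_Sup_upper[OF FL]
        by (intro sf_Sup_least[OF sf_Sup_mem[OF FL]]) auto
      then show ?thesis
        by (rule E_zero_mono[OF sf_Sup_mem[OF subF] sf_Sup_mem[OF FL] _ f2 *[unfolded ins]])
    next
      case False
      then have Fb: "F \<subseteq> b" using F(1) by auto
      have "sf_Sup M (insert (sf_bot M) F) \<subseteq> x"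
      proof (rule sf_Sup_least[OF B_mem[OF x]])
        fix a assume "a \<in> insert (sf_bot M) F"
        then show "a \<subseteq> x"
          using b(3) Fb sf_bot_le[OF B_mem[OF x]] c_c[OF x] by auto
      qed
      then show ?thesis
        by (rule E_zero_mono[OF sf_Sup_mem[OF subF] B_mem[OF x] _ f2 zero])
    qed
  qed
qed

lemma spread_0: "spread 0 (sf_bot M) = L2_space M"
proof -
  have "sf_Sup M (insert (sf_bot M) {sf_top M}) = sf_top M"
    using sf_Sup_upper[of "{sf_bot M, sf_top M}" "sf_top M"] sf_bot_mem sf_top_mem
    by (intro top_le_eq sf_Sup_mem) auto
  then have "h \<in> spread 0 (sf_bot M)" if "h \<in> L2_space M" for h
    using that B_top by (intro spreadI[of h "{sf_top M}"]) (auto simp: c_bot)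
  then show ?thesis using spread_L2 by blast
qed

subsection \<open>Orthogonality to spread functions\<close>

text \<open>
  The induction step lowers the number of points by one: a section of \<open>g\<close> over \<open>x\<close> along a centred
  function of the complement of \<open>x\<close> uses up at least one point there.
\<close>

lemma orthogonal_spread_Suc:
  assumes x: "x \<in> B" and g: "g \<in> L2_space M"
    and orth: "\<And>w. w \<in> spread (Suc k) (sf_bot M) \<Longrightarrow> ip g w = 0"
    and C: "C \<in> c x" and w: "w \<in> spread k (sf_bot M)"
  shows "ip (E x (\<lambda>\<omega>. (indicator C \<omega> - prob C) * g \<omega>)) w = 0"
proof -
  have m: "x \<in> \<Lambda>" "c x \<in> \<Lambda>" using x by (auto intro: B_mem c_mem)
  have CM: "C \<in> sets M" using C sigma_field_le_events[OF m(2)] by auto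
  let ?h = "\<lambda>\<omega>. indicator C \<omega> - prob C :: real"
  have w2: "w \<in> L2_space M" using w by (rule spread_L2)
  have hm: "?h \<in> mble (c x)"
    by (intro borel_measurable_diff mble_indicator m C) simp
  have hb: "\<bar>?h \<omega>\<bar> \<le> 1" for \<omega>
    using prob_le_1[of C] measure_nonneg[of M C] by (auto simp: indicator_def)
  have h2: "?h \<in> L2_space M" by (rule L2_bounded[OF mble_borel[OF m(2) hm] hb])
  have hg: "(\<lambda>\<omega>. ?h \<omega> * g \<omega>) \<in> L2_space M"
    by (rule L2_bounded_mult[OF g L2_measurable[OF h2] hb])
  let ?v = "\<lambda>\<omega>. ?h \<omega> * E x w \<omega>"
  have "?v \<in> spread k (c x)"
    using spread_mult[OF c_mem[OF x] hm hb w] by (simp add: c_c[OF x])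
  moreover have "E x ?v \<simeq> (\<lambda>_. 0)"
  proof -
    have "E x (\<lambda>\<omega>. E x w \<omega> * ?h \<omega>) \<simeq> (\<lambda>\<omega>. E x w \<omega> * E x ?h \<omega>)"
      by (intro E_mult m h2 E_L2_of w2)
    then have "E x ?v \<simeq> (\<lambda>\<omega>. E x w \<omega> * E x ?h \<omega>)"
      by (simp only: mult.commute)
    moreover have "E x ?h \<simeq> (\<lambda>_. 0)"
    proof -
      have Jb: "J (sf_bot M) x = x"
        using sf_join_absorb[OF m(1) sf_bot_le[OF m(1)]] by (simp add: sf_join_commute)
      have "E (J (sf_bot M) x) ?h \<simeq> E (sf_bot M) ?h"
        using h2 hm indep_set_commute[OF B_indep[OF x]]
        by (intro E_join_indep[OF m(2) sf_bot_mem sf_bot_le[OF m(2)] m(1)]) auto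
      moreover have "(\<integral>\<omega>. ?h \<omega> \<partial>M) = 0"
        using CM by (subst Bochner_Integration.integral_diff)
          (auto simp: prob_space intro: L2_integrable L2_indicator)
      ultimately show ?thesis
        unfolding Jb using E_bot[OF h2] by (auto elim!: eventually_elim2)
    qed
    ultimately show ?thesis by eventually_elim simp
  qed
  ultimately have v: "?v \<in> spread (Suc k) (sf_bot M)"
    by (rule spread_Suc[OF x])
  have "ip (E x (\<lambda>\<omega>. ?h \<omega> * g \<omega>)) w = ip (\<lambda>\<omega>. ?h \<omega> * g \<omega>) (E x w)"
    by (rule E_self_adjoint[OF m(1) hg w2])
  also have "\<dots> = ip g ?v"
    by (rule ip_mult_shift)
  finally show ?thesis
    using orth[OF v] by simp
qed

text \<open>
  Centring the event \<open>C\<close> amounts to subtracting \<open>E x g\<close> from \<open>g\<close>; thus the hypothesis says that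
  all sections over \<open>x\<close> of that difference are \<open>U\<close>-measurable, and \<open>kernel_mble\<close> applies.
\<close>

lemma residue_mble:
  assumes x: "x \<in> B" and g: "g \<in> L2_space M"
    and U: "\<And>C. C \<in> c x \<Longrightarrow> E x (\<lambda>\<omega>. (indicator C \<omega> - prob C) * g \<omega>) \<in> mble U"
  shows "(\<lambda>\<omega>. g \<omega> - E x g \<omega>) \<in> mble (J (U \<inter> x) (c x))"
proof -
  have m: "x \<in> \<Lambda>" "c x \<in> \<Lambda>" using x by (auto intro: B_mem c_mem)
  have Eg: "E x g \<in> L2_space M" by (rule E_L2[OF m(1) g])
  have d: "(\<lambda>\<omega>. g \<omega> - E x g \<omega>) \<in> L2_space M" by (rule L2_diff[OF g Eg])
  show ?thesis
  proof (rule kernel_mble[OF m(1) sf_Int[OF U_mem m(1)] Int_lower2 m(2) B_indep[OF x] c_join[OF x] d])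
    fix C assume C: "C \<in> c x"
    have CM: "C \<in> sets M" using C sigma_field_le_events[OF m(2)] by auto
    let ?i = "indicator C :: 'a \<Rightarrow> real"
    have i: "?i \<in> L2_of (c x)" using m(2) C by (rule L2_of_indicator)
    have i2: "?i \<in> L2_space M" using i by simp
    have ig: "(\<lambda>\<omega>. ?i \<omega> * g \<omega>) \<in> L2_space M" and iE: "(\<lambda>\<omega>. ?i \<omega> * E x g \<omega>) \<in> L2_space M"
      by (intro L2_indicator_mult CM g Eg)+
    have a1: "E x (\<lambda>\<omega>. ?i \<omega> * g \<omega> - ?i \<omega> * E x g \<omega>) \<simeq>
        (\<lambda>\<omega>. E x (\<lambda>\<omega>. ?i \<omega> * g \<omega>) \<omega> - E x (\<lambda>\<omega>. ?i \<omega> * E x g \<omega>) \<omega>)"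
      by (rule E_diff[OF m(1) ig iE])
    have a2: "E x (\<lambda>\<omega>. ?i \<omega> * g \<omega> - prob C * g \<omega>) \<simeq>
        (\<lambda>\<omega>. E x (\<lambda>\<omega>. ?i \<omega> * g \<omega>) \<omega> - E x (\<lambda>\<omega>. prob C * g \<omega>) \<omega>)"
      by (rule E_diff[OF m(1) ig L2_cmult[OF g]])
    have a3: "E x (\<lambda>\<omega>. prob C * g \<omega>) \<simeq> (\<lambda>\<omega>. prob C * E x g \<omega>)"
      by (rule E_cmult[OF m(1) g])
    have "E x (\<lambda>\<omega>. E x g \<omega> * ?i \<omega>) \<simeq> (\<lambda>\<omega>. E x g \<omega> * E x ?i \<omega>)"
      by (intro E_mult m i2 E_L2_of g)
    then have a4: "E x (\<lambda>\<omega>. ?i \<omega> * E x g \<omega>) \<simeq> (\<lambda>\<omega>. E x g \<omega> * E x ?i \<omega>)"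
      by (simp only: mult.commute)
    have Jb: "J (sf_bot M) x = x"
      using sf_join_absorb[OF m(1) sf_bot_le[OF m(1)]] by (simp add: sf_join_commute)
    have "E (J (sf_bot M) x) ?i \<simeq> E (sf_bot M) ?i"
      using indep_set_commute[OF B_indep[OF x]]
      by (intro E_join_indep[OF m(2) sf_bot_mem sf_bot_le[OF m(2)] m(1)] i)
    moreover have "E (sf_bot M) ?i \<simeq> (\<lambda>_. prob C)"
      using E_bot[OF i2] CM by simp
    ultimately have a5: "E x ?i \<simeq> (\<lambda>_. prob C)"
      unfolding Jb by (auto elim!: eventually_elim2)
    have "E x (\<lambda>\<omega>. ?i \<omega> * g \<omega> - prob C * g \<omega>) \<simeq> E x (\<lambda>\<omega>. ?i \<omega> * g \<omega> - ?i \<omega> * E x g \<omega>)"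
      using a1 a2 a3 a4 a5 by eventually_elim simp
    moreover have "E x (\<lambda>\<omega>. ?i \<omega> * g \<omega> - prob C * g \<omega>) \<in> mble U"
      using U[OF C] by (simp add: left_diff_distrib)
    ultimately have "E x (\<lambda>\<omega>. ?i \<omega> * g \<omega> - ?i \<omega> * E x g \<omega>) \<in> mble U"
      by (intro mble_cong[OF U_mem _ E_borel])
    then have "E x (\<lambda>\<omega>. ?i \<omega> * (g \<omega> - E x g \<omega>)) \<in> mble U"
      by (simp add: right_diff_distrib)
    then show "E x (\<lambda>\<omega>. ?i \<omega> * (g \<omega> - E x g \<omega>)) \<in> mble (U \<inter> x)"
      by (intro mble_Int U_mem m E_mble)
  qed
qed

text \<open>
  Induction on \<open>k\<close>; in the picture, the spectral sets of \<open>g\<close> have fewer than \<open>k\<close> points. For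
  \<open>x \<in> B\<close> consider the part \<open>R\<close> of \<open>g\<close> whose spectral sets have points both in \<open>x\<close> and in its
  complement, up to a constant. On either side at most \<open>k - 2\<close> points remain, so by induction \<open>R\<close>
  sees only \<open>U\<close> inside \<open>x\<close>, and likewise only \<open>U\<close> outside \<open>x\<close>. Therefore \<open>R\<close> is \<open>U\<close>-measurable,
  and removing from \<open>g\<close> its \<open>U\<close>-measurable component leaves a function for which no such part
  exists for any \<open>x\<close>, that is, an element of the first chaos.
\<close>

lemma orthogonal_spread_mble:
  assumes "g \<in> L2_space M" and "\<And>w. w \<in> spread k (sf_bot M) \<Longrightarrow> ip g w = 0"
  shows "g \<in> mble U"
  using assms
proof (induction k arbitrary: g)
  case 0
  then have "(l2 g)\<^sup>2 = 0"
    unfolding l2_ip using spread_0 by simp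
  then have "g \<simeq> (\<lambda>_. 0)"
    using 0 by (simp add: l2_eq_0)
  then have "(\<lambda>_. 0) \<simeq> g" by eventually_elim simp
  then show ?case
    by (rule mble_cong[OF U_mem borel_measurable_const L2_measurable[OF 0(1)]])
next
  case (Suc k)
  note g = Suc.prems(1)
  have half: "(\<lambda>\<omega>. g \<omega> - E x g \<omega>) \<in> mble (J (U \<inter> x) (c x))" if x: "x \<in> B" for x
  proof (rule residue_mble[OF x g])
    fix C assume C: "C \<in> c x"
    have m: "x \<in> \<Lambda>" "c x \<in> \<Lambda>" using x by (auto intro: B_mem c_mem)
    have CM: "C \<in> sets M" using C sigma_field_le_events[OF m(2)] by auto
    have "(\<lambda>\<omega>. indicator C \<omega> * g \<omega> - prob C * g \<omega>) \<in> L2_space M"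
      by (intro L2_diff L2_indicator_mult L2_cmult CM g)
    then have "(\<lambda>\<omega>. (indicator C \<omega> - prob C) * g \<omega>) \<in> L2_space M"
      by (simp add: left_diff_distrib)
    then show "E x (\<lambda>\<omega>. (indicator C \<omega> - prob C) * g \<omega>) \<in> mble U"
      by (intro Suc.IH E_L2 m orthogonal_spread_Suc[OF x g Suc.prems(2) C])
  qed
  define h where "h \<omega> = g \<omega> - E U g \<omega>" for \<omega>
  have EUg: "E U g \<in> L2_space M" by (rule E_L2[OF U_mem g])
  have h2: "h \<in> L2_space M" unfolding h_def by (rule L2_diff[OF g EUg])
  have "h \<in> H1"
  proof (rule H1I[OF h2])
    fix x assume x: "x \<in> B"
    let ?y = "c x"
    have y: "?y \<in> B" using x by (rule c_mem)
    have m: "x \<in> \<Lambda>" "?y \<in> \<Lambda>" using x y by (auto intro: B_mem)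
    have mI: "U \<inter> x \<in> \<Lambda>" "U \<inter> ?y \<in> \<Lambda>" using m by (auto intro: sf_Int U_mem)
    have mJ: "J x (U \<inter> ?y) \<in> \<Lambda>" "J (U \<inter> x) ?y \<in> \<Lambda>" using m mI by (auto intro: sf_join_mem)
    define m0 where "m0 = (\<integral>\<omega>. g \<omega> \<partial>M)"
    define R where "R \<omega> = g \<omega> - E x g \<omega> - E ?y g \<omega>" for \<omega>
    have E2: "E x g \<in> L2_space M" "E ?y g \<in> L2_space M" using m by (auto intro: E_L2 g)
    have R2: "R \<in> L2_space M" unfolding R_def by (intro L2_diff g E2)
    have "E ?y g \<in> mble (J (U \<inter> x) ?y)"
      by (rule mble_mono[OF m(2) mJ(2) sf_join_upper(2)[OF mI(1) m(2)] E_mble])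
    then have R1: "R \<in> mble (J (U \<inter> x) ?y)"
      unfolding R_def using half[OF x] by (intro borel_measurable_diff[where f = "\<lambda>\<omega>. g \<omega> - E x g \<omega>"])
    have half': "(\<lambda>\<omega>. g \<omega> - E ?y g \<omega>) \<in> mble (J x (U \<inter> ?y))"
      using half[OF y] unfolding c_c[OF x] by (simp add: sf_join_commute)
    have "E x g \<in> mble (J x (U \<inter> ?y))"
      by (rule mble_mono[OF m(1) mJ(1) sf_join_upper(1)[OF m(1) mI(2)] E_mble])
    then have "(\<lambda>\<omega>. (g \<omega> - E ?y g \<omega>) - E x g \<omega>) \<in> mble (J x (U \<inter> ?y))"
      using half' by (rule borel_measurable_diff[rotated])
    moreover have "(\<lambda>\<omega>. (g \<omega> - E ?y g \<omega>) - E x g \<omega>) = R"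
      by (auto simp: R_def)
    ultimately have "R \<in> mble (J x (U \<inter> ?y) \<inter> J (U \<inter> x) ?y)"
      using R1 by (intro mble_Int mJ) simp_all
    moreover have "J x (U \<inter> ?y) \<inter> J (U \<inter> x) ?y = J (U \<inter> x) (U \<inter> ?y)"
      by (rule join_Int_join[OF m(1) mI(1) _ m(2) mI(2) _ B_indep[OF x]]) auto
    moreover have "J (U \<inter> x) (U \<inter> ?y) = U"
      using splits_U x unfolding splits_def by blast
    ultimately have "R \<in> mble U"
      by (simp only:)
    then have "R \<in> L2_of U"
      using R2 by (rule IntI[rotated])
    then have "E U R \<simeq> R"
      by (rule E_id[OF U_mem])
    moreover have "E U R \<simeq> (\<lambda>\<omega>. E U (\<lambda>\<omega>. g \<omega> - E x g \<omega>) \<omega> - E U (E ?y g) \<omega>)"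
      unfolding R_def by (intro E_diff U_mem L2_diff g E2)
    moreover have "E U (\<lambda>\<omega>. g \<omega> - E x g \<omega>) \<simeq> (\<lambda>\<omega>. E U g \<omega> - E U (E x g) \<omega>)"
      by (intro E_diff U_mem g E2)
    moreover have "E x h \<simeq> (\<lambda>\<omega>. E x g \<omega> - E x (E U g) \<omega>)" "E ?y h \<simeq> (\<lambda>\<omega>. E ?y g \<omega> - E ?y (E U g) \<omega>)"
      unfolding h_def by (intro E_diff m g EUg)+
    moreover note E_splits_Int[OF splits_U x g] E_splits_Int[OF splits_U y g]
    ultimately show "h \<simeq> (\<lambda>\<omega>. E x h \<omega> + E ?y h \<omega>)"
      by eventually_elim (simp add: h_def R_def)
  qed
  then have "h \<in> L2_of U"
    by (intro IntI h2 gen_mble[OF H1_sub])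
  then have "E U h \<simeq> h"
    by (rule E_id[OF U_mem])
  moreover have "E U h \<simeq> (\<lambda>\<omega>. E U g \<omega> - E U (E U g) \<omega>)"
    unfolding h_def by (intro E_diff U_mem g EUg)
  moreover have "E U (E U g) \<simeq> E U g"
    by (intro E_tower U_mem g) auto
  ultimately have "E U g \<simeq> g"
    by eventually_elim (simp add: h_def)
  then show ?case
    by (rule E_idD[OF U_mem g])
qed

text \<open>
  The relative version follows by applying the previous result to the sections of \<open>g\<close> over the
  complement of \<open>z\<close>.
\<close>

lemma orthogonal_spread_mble_join:
  assumes z: "z \<in> B" and g: "g \<in> L2_space M" and orth: "\<And>w. w \<in> spread k z \<Longrightarrow> ip g w = 0"
  shows "g \<in> mble (J U z)"
proof -
  have m: "z \<in> \<Lambda>" "c z \<in> \<Lambda>" "U \<inter> c z \<in> \<Lambda>" using z by (auto intro: B_mem c_mem sf_Int U_mem)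
  have "g \<in> mble (J (U \<inter> c z) z)"
  proof (rule kernel_mble[OF m(2,3) _ m(1) indep_set_commute[OF B_indep[OF z]] _ g])
    show "J (c z) z = sf_top M" using c_join[OF z] by (simp add: sf_join_commute)
    fix C assume C: "C \<in> z"
    have CM: "C \<in> sets M" using C sigma_field_le_events[OF m(1)] by auto
    have ig: "(\<lambda>\<omega>. indicator C \<omega> * g \<omega>) \<in> L2_space M" by (intro L2_indicator_mult CM g)
    have "E (c z) (\<lambda>\<omega>. indicator C \<omega> * g \<omega>) \<in> mble U"
    proof (rule orthogonal_spread_mble[OF E_L2[OF m(2) ig]])
      fix w assume w: "w \<in> spread k (sf_bot M)"
      have "(\<lambda>\<omega>. indicator C \<omega> * E (c z) w \<omega>) \<in> spread k z"
        by (rule spread_mult[OF z mble_indicator[OF m(1) C] _ w, where K = 1]) (simp add: indicator_def)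
      then have "ip g (\<lambda>\<omega>. indicator C \<omega> * E (c z) w \<omega>) = 0"
        by (rule orth)
      then show "ip (E (c z) (\<lambda>\<omega>. indicator C \<omega> * g \<omega>)) w = 0"
        using E_self_adjoint[OF m(2) ig spread_L2[OF w]] by (simp add: ip_mult_shift)
    qed
    then show "E (c z) (\<lambda>\<omega>. indicator C \<omega> * g \<omega>) \<in> mble (U \<inter> c z)"
      by (intro mble_Int U_mem m E_mble)
  qed auto
  then show ?thesis
    by (rule mble_mono[OF sf_join_mem[OF m(3,1)] sf_join_mem[OF U_mem m(1)]
        sf_join_mono[OF Int_lower1 subset_refl U_mem m(1)]])
qed

lemma spread_approximation:
  assumes z: "z \<in> B" and f: "f \<in> L2_space M" and f0: "E (J U z) f \<simeq> (\<lambda>_. 0)" and e: "0 < e"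
  obtains h where "h \<in> spread k z" "l2 (\<lambda>\<omega>. f \<omega> - h \<omega>) < e"
proof (rule L2_approximation[of "spread k z" f e])
  have m: "J U z \<in> \<Lambda>" using z by (intro sf_join_mem U_mem B_mem)
  show "spread k z \<subseteq> L2_space M" using spread_L2 by auto
  show "(\<lambda>_. 0) \<in> spread k z"
  proof (rule spreadI[of _ "{c z}"])
    show "sf_Sup M (insert z {c z}) = sf_top M"
    proof -
      have "z \<in> \<Lambda>" "{c z} \<subseteq> \<Lambda>" "sf_Sup M {c z} = c z"
        using z sf_Sup_insert[of "c z" "{}"] sf_join_absorb[OF c_mem' sf_bot_le[OF c_mem'], of z]
        by (auto intro: B_mem c_mem simp: sf_Sup_empty c_mem')
      then show ?thesis using sf_Sup_insert[of z "{c z}"] c_join[OF z] by simp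
    qed
    fix F assume "F \<subseteq> {c z}"
    then show "E (sf_Sup M (insert z F)) (\<lambda>_. 0) \<simeq> (\<lambda>_. 0)"
      using z c_mem[OF z] by (intro E_zero sf_Sup_mem insert_sub_Lam) auto
  qed (use z c_mem[OF z] L2_const in auto)
  show "ip g f = 0" if g: "g \<in> L2_space M" and orth: "\<And>w. w \<in> spread k z \<Longrightarrow> ip g w = 0" for g
  proof -
    have "g \<in> L2_of (J U z)"
      by (intro IntI g orthogonal_spread_mble_join[OF z g orth])
    then have "ip g f = ip (E (J U z) f) g"
      using E_self_adjoint_of[OF m f] by (simp add: ip_commute)
    also have "\<dots> = ip (\<lambda>_. 0) g"
      using f0 by (intro ip_cong) (auto simp: E_L2 m f g L2_const)
    finally show ?thesis by (simp add: ip_def)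
  qed
qed (use assms that spread_add spread_cmult in auto)

end

section \<open>Random thinning\<close>

text \<open>
  The mean of \<open>q (y \<inter> \<Inter>I)\<close> over the random subfamily \<open>I\<close> of the list in which every member is
  kept, independently of the others, with probability \<open>1 - \<rho>\<close>.
\<close>

fun thinned :: "real \<Rightarrow> 'b set list \<Rightarrow> ('b set \<Rightarrow> real) \<Rightarrow> 'b set \<Rightarrow> real" where
  "thinned \<rho> [] q y = q y"
| "thinned \<rho> (x # xs) q y = \<rho> * thinned \<rho> xs q y + (1 - \<rho>) * thinned \<rho> xs q (y \<inter> x)"

lemma thinned_add: "thinned \<rho> xs (\<lambda>y. q y + r y) y = thinned \<rho> xs q y + thinned \<rho> xs r y"
  by (induction xs arbitrary: y) (auto simp: algebra_simps)

lemma thinned_Int: "thinned \<rho> xs q (y \<inter> x) = thinned \<rho> xs (\<lambda>y. q (y \<inter> x)) y"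
proof (induction xs arbitrary: y)
  case (Cons a xs)
  have "y \<inter> x \<inter> a = y \<inter> a \<inter> x" by auto
  then show ?case by (simp only: thinned.simps Cons.IH)
qed simp

lemma thinned_cong:
  assumes "\<And>y. y \<in> C \<Longrightarrow> q y = r y" "\<And>x y. x \<in> C \<Longrightarrow> y \<in> C \<Longrightarrow> x \<inter> y \<in> C" "set xs \<subseteq> C" "y \<in> C"
  shows "thinned \<rho> xs q y = thinned \<rho> xs r y"
  using assms(3,4) by (induction xs arbitrary: y) (auto simp: assms(1,2))

text \<open>
  If \<open>I\<close> keeps each member with probability \<open>1 - \<rho>\<close>, its complement does so with probability \<open>\<rho>\<close>;
  the right-hand side is the mean of the left-hand side, so some \<open>I\<close> does not exceed it.
\<close>

lemma thinned_selection:
  assumes \<rho>: "0 \<le> \<rho>" "\<rho> \<le> 1" and "distinct xs"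
  shows "\<exists>I\<subseteq>set xs. q (y \<inter> \<Inter>I) + r (y' \<inter> \<Inter>(set xs - I)) \<le> thinned \<rho> xs q y + thinned (1 - \<rho>) xs r y'"
  using assms(3)
proof (induction xs arbitrary: y y')
  case (Cons x xs)
  have x: "x \<notin> set xs" using Cons.prems by simp
  define t1 where "t1 = thinned \<rho> xs q y + thinned (1 - \<rho>) xs r (y' \<inter> x)"
  define t2 where "t2 = thinned \<rho> xs q (y \<inter> x) + thinned (1 - \<rho>) xs r y'"
  have sum: "thinned \<rho> (x # xs) q y + thinned (1 - \<rho>) (x # xs) r y' = \<rho> * t1 + (1 - \<rho>) * t2"
    by (simp add: t1_def t2_def algebra_simps)
  have "min t1 t2 = \<rho> * min t1 t2 + (1 - \<rho>) * min t1 t2"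
    by (simp add: algebra_simps)
  also have "\<dots> \<le> \<rho> * t1 + (1 - \<rho>) * t2"
    using \<rho> by (intro add_mono mult_left_mono) auto
  finally consider "t1 \<le> \<rho> * t1 + (1 - \<rho>) * t2" | "t2 \<le> \<rho> * t1 + (1 - \<rho>) * t2"
    by linarith
  then show ?case
  proof cases
    case 1
    obtain I where I: "I \<subseteq> set xs" "q (y \<inter> \<Inter>I) + r (y' \<inter> x \<inter> \<Inter>(set xs - I)) \<le> t1"
      using Cons.IH[of y "y' \<inter> x"] Cons.prems unfolding t1_def by auto
    have "set (x # xs) - I = insert x (set xs - I)" using I(1) x by auto
    then have "y' \<inter> x \<inter> \<Inter>(set xs - I) = y' \<inter> \<Inter>(set (x # xs) - I)" by auto
    then show ?thesis
      using I 1 unfolding sum by (intro exI[of _ I]) auto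
  next
    case 2
    obtain I where I: "I \<subseteq> set xs" "q (y \<inter> x \<inter> \<Inter>I) + r (y' \<inter> \<Inter>(set xs - I)) \<le> t2"
      using Cons.IH[of "y \<inter> x" y'] Cons.prems unfolding t2_def by auto
    have "set (x # xs) - insert x I = set xs - I" using x by auto
    moreover have "y \<inter> x \<inter> \<Inter>I = y \<inter> \<Inter>(insert x I)" by auto
    ultimately show ?thesis
      using I 2 unfolding sum by (intro exI[of _ "insert x I"]) auto
  qed
qed (auto intro!: exI[of _ "{}"])

context noise
begin

lemma B_Int_Inter: "finite X \<Longrightarrow> X \<subseteq> B \<Longrightarrow> y \<in> B \<Longrightarrow> y \<inter> \<Inter>X \<in> B"
proof (induction rule: finite_induct)
  case (insert x X)
  have "y \<inter> \<Inter>(insert x X) = (y \<inter> \<Inter>X) \<inter> x" by auto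
  then show ?case using insert by (simp add: B_Int)
qed simp

text \<open>
  Think of the members of the list as complements of disjoint pieces. The component of \<open>h\<close> whose
  spectral sets meet exactly \<open>m\<close> pieces survives the random intersection with probability \<open>\<rho>^m\<close>,
  and the last hypothesis excludes \<open>m < k\<close>. The induction splits \<open>h\<close> into the component that
  avoids the first piece and the component that meets it; the latter needs to meet only \<open>k - 1\<close> of
  the others.
\<close>

lemma thinned_bound:
  assumes u: "splits u" and \<rho>: "0 \<le> \<rho>" "\<rho> \<le> 1" and y: "y \<in> B"
    and "distinct xs" "set xs \<subseteq> B" "h \<in> L2_space M"
    and "\<And>F. F \<subseteq> set xs \<Longrightarrow> card F < k \<Longrightarrow> E (J u (y \<inter> \<Inter>(set xs - F))) h \<simeq> (\<lambda>_. 0)"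
  shows "thinned \<rho> xs (\<lambda>b. (l2 (E (J u b) h))\<^sup>2) y \<le> \<rho>^k * (l2 h)\<^sup>2"
  using assms(5-8)
proof (induction xs arbitrary: h k)
  case Nil
  have m: "J u y \<in> \<Lambda>" by (intro sf_join_mem splits_mem[OF u] B_mem y)
  show ?case
  proof (cases k)
    case 0
    then show ?thesis
      using E_contraction[OF m Nil(3)] by (simp add: power_mono)
  next
    case (Suc k')
    then have "E (J u y) h \<simeq> (\<lambda>_. 0)"
      using Nil(4)[of "{}"] by simp
    then have "l2 (E (J u y) h) = 0"
      using l2_eq_0[OF E_L2[OF m Nil(3)]] by simp
    then show ?thesis using \<rho> by simp
  qed
next
  case (Cons x xs)
  have x: "x \<in> B" "x \<notin> set xs" and xs: "set xs \<subseteq> B" "distinct xs" using Cons.prems by auto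
  note h = Cons.prems(3)
  have m: "J u b \<in> \<Lambda>" if "b \<in> B" for b
    using that by (intro sf_join_mem splits_mem[OF u] B_mem)
  let ?q = "\<lambda>h b. (l2 (E (J u b) h))\<^sup>2"
  define h1 where "h1 = E (J u x) h"
  define h2 where "h2 = (\<lambda>\<omega>. h \<omega> - h1 \<omega>)"
  have h1: "h1 \<in> L2_space M" unfolding h1_def by (intro E_L2 m x h)
  have h2: "h2 \<in> L2_space M" unfolding h2_def by (intro L2_diff h h1)
  have E1: "E (J u b) h1 \<simeq> E (J u (b \<inter> x)) h" if "b \<in> B" for b
    unfolding h1_def by (rule E_splits_commute[OF u that x(1) h])
  have E2: "E (J u b) h2 \<simeq> (\<lambda>\<omega>. E (J u b) h \<omega> - E (J u (b \<inter> x)) h \<omega>)" if b: "b \<in> B" for b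
    using E_diff[OF m[OF b] h h1] E1[OF b] unfolding h2_def by (auto elim!: eventually_elim2)
  have q1: "?q h (b \<inter> x) = ?q h1 b" if b: "b \<in> B" for b
    using l2_cong[OF E1[OF b]] b x h h1 by (simp add: E_L2 m B_Int)
  have q: "?q h b = ?q h1 b + ?q h2 b" if b: "b \<in> B" for b
  proof -
    let ?g = "E (J u b) h"
    have g: "?g \<in> L2_space M" by (intro E_L2 m b h)
    have bx: "b \<inter> x \<in> B" using b x by (intro B_Int)
    have sub: "J u (b \<inter> x) \<subseteq> J u b" using b by (intro sf_join_mono splits_mem[OF u] B_mem) auto
    have t: "E (J u (b \<inter> x)) ?g \<simeq> E (J u (b \<inter> x)) h"
      by (intro E_tower m bx b sub h)
    have "(l2 ?g)\<^sup>2 = (l2 (E (J u (b \<inter> x)) ?g))\<^sup>2 + (l2 (\<lambda>\<omega>. ?g \<omega> - E (J u (b \<inter> x)) ?g \<omega>))\<^sup>2"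
      by (intro Pythagoras m bx g)
    also have "l2 (E (J u (b \<inter> x)) ?g) = l2 (E (J u b) h1)"
      using t E1[OF b] by (intro l2_cong E_L2 m bx b g h1) (auto elim!: eventually_elim2)
    also have "l2 (\<lambda>\<omega>. ?g \<omega> - E (J u (b \<inter> x)) ?g \<omega>) = l2 (E (J u b) h2)"
      using t E2[OF b] by (intro l2_cong L2_diff E_L2 m bx b g h2) (auto elim!: eventually_elim2)
    finally show ?thesis .
  qed
  have "thinned \<rho> xs (?q h) y = thinned \<rho> xs (\<lambda>b. ?q h1 b + ?q h2 b) y"
    using q B_Int xs(1) y by (rule thinned_cong)
  then have s: "thinned \<rho> xs (?q h) y = thinned \<rho> xs (?q h1) y + thinned \<rho> xs (?q h2) y"
    by (simp only: thinned_add)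
  have s1: "thinned \<rho> xs (?q h) (y \<inter> x) = thinned \<rho> xs (?q h1) y"
    unfolding thinned_Int using q1 B_Int xs(1) y by (rule thinned_cong)
  have eq: "thinned \<rho> (x # xs) (?q h) y = thinned \<rho> xs (?q h1) y + \<rho> * thinned \<rho> xs (?q h2) y"
    by (simp add: s s1 algebra_simps)
  have fin: "y \<inter> \<Inter>(set xs - F) \<in> B" for F
    using xs(1) y by (intro B_Int_Inter) auto
  have zero1: "E (J u (y \<inter> \<Inter>(set xs - F) \<inter> x)) h \<simeq> (\<lambda>_. 0)" if F: "F \<subseteq> set xs" "card F < k" for F
  proof -
    have "set (x # xs) - F = insert x (set xs - F)" using F x by auto
    then have "y \<inter> \<Inter>(set (x # xs) - F) = y \<inter> \<Inter>(set xs - F) \<inter> x" by auto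
    then show ?thesis using Cons.prems(4)[of F] F by auto
  qed
  have b1: "thinned \<rho> xs (?q h1) y \<le> \<rho>^k * (l2 h1)\<^sup>2"
  proof (rule Cons.IH[OF xs(2,1) h1])
    fix F assume "F \<subseteq> set xs" "card F < k"
    from E1[OF fin[of F]] zero1[OF this]
    show "E (J u (y \<inter> \<Inter>(set xs - F))) h1 \<simeq> (\<lambda>_. 0)" by (auto elim!: eventually_elim2)
  qed
  have b2: "\<rho> * thinned \<rho> xs (?q h2) y \<le> \<rho>^k * (l2 h2)\<^sup>2"
  proof (cases k)
    case 0
    have "thinned \<rho> xs (?q h2) y \<le> \<rho>^0 * (l2 h2)\<^sup>2"
      by (rule Cons.IH[OF xs(2,1) h2]) simp
    then have "\<rho> * thinned \<rho> xs (?q h2) y \<le> 1 * (l2 h2)\<^sup>2"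
      using \<rho> by (intro order_trans[OF mult_left_mono mult_right_mono]) auto
    then show ?thesis using 0 by simp
  next
    case (Suc k')
    have "thinned \<rho> xs (?q h2) y \<le> \<rho>^k' * (l2 h2)\<^sup>2"
    proof (rule Cons.IH[OF xs(2,1) h2])
      fix F assume F: "F \<subseteq> set xs" "card F < k'"
      then have "finite F" "x \<notin> F" using x(2) by (auto intro: finite_subset)
      then have "card (insert x F) < k" using F(2) Suc by simp
      then have "E (J u (y \<inter> \<Inter>(set (x # xs) - insert x F))) h \<simeq> (\<lambda>_. 0)"
        using F by (intro Cons.prems(4)) auto
      moreover have "set (x # xs) - insert x F = set xs - F" using x by auto
      ultimately have "E (J u (y \<inter> \<Inter>(set xs - F))) h \<simeq> (\<lambda>_. 0)" by (simp only:)
      moreover have "E (J u (y \<inter> \<Inter>(set xs - F) \<inter> x)) h \<simeq> (\<lambda>_. 0)"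
        using F Suc by (intro zero1) auto
      moreover note E2[OF fin[of F]]
      ultimately show "E (J u (y \<inter> \<Inter>(set xs - F))) h2 \<simeq> (\<lambda>_. 0)"
        by eventually_elim simp
    qed
    then show ?thesis using \<rho> Suc by (simp add: mult_left_mono mult.assoc)
  qed
  have "(l2 h)\<^sup>2 = (l2 h1)\<^sup>2 + (l2 h2)\<^sup>2"
    unfolding h1_def h2_def by (intro Pythagoras m x h)
  then show ?case
    unfolding eq using b1 b2 by (simp add: distrib_left)
qed

lemma disjoint_refinement:
  assumes "finite b" "b \<subseteq> B"
  shows "\<exists>D. finite D \<and> D \<subseteq> B \<and> (\<forall>d\<in>D. \<exists>a\<in>b. d \<subseteq> a) \<and>
    (\<forall>d\<in>D. \<forall>d'\<in>D. d \<noteq> d' \<longrightarrow> d \<inter> d' = sf_bot M) \<and> sf_Sup M D = sf_Sup M b"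
  using assms
proof (induction rule: finite_induct)
  case empty
  show ?case by (rule exI[of _ "{}"]) simp
next
  case (insert a b)
  then obtain D where D: "finite D" "D \<subseteq> B" "\<forall>d\<in>D. \<exists>a\<in>b. d \<subseteq> a"
    "\<forall>d\<in>D. \<forall>d'\<in>D. d \<noteq> d' \<longrightarrow> d \<inter> d' = sf_bot M" "sf_Sup M D = sf_Sup M b"
    by auto
  have a: "a \<in> B" and b: "b \<subseteq> \<Lambda>" using insert.prems B_sub by auto
  let ?S = "sf_Sup M D" and ?a = "a \<inter> c (sf_Sup M D)"
  have S: "?S \<in> B" using D by (intro B_finite_Sup)
  have aB: "?a \<in> B" using a S by (intro B_Int c_mem)
  have DL: "D \<subseteq> \<Lambda>" using D B_sub by auto
  have disj: "?a \<inter> d = sf_bot M" if d: "d \<in> D" for d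
  proof -
    have "?a \<inter> d \<subseteq> ?S \<inter> c ?S" using sf_Sup_upper[OF DL d] by auto
    moreover have "sf_bot M \<subseteq> ?a \<inter> d" using sf_bot_le[OF B_mem[OF B_Int[OF aB subsetD[OF D(2) d]]]] .
    ultimately show ?thesis using c_Int[OF S] by auto
  qed
  have "sf_Sup M (insert ?a D) = J ?S ?a"
    using sf_Sup_insert[OF B_mem[OF aB] DL] by (simp add: sf_join_commute)
  also have "\<dots> = J ?S a \<inter> J ?S (c ?S)"
    using S a by (intro B_distrib' c_mem)
  also have "\<dots> = J ?S a"
    using c_join[OF S] sf_le_top[OF B_mem[OF B_join[OF S a]]] by auto
  also have "\<dots> = sf_Sup M (insert a b)"
    using sf_Sup_insert[OF B_mem[OF a] b] D(5) by (simp add: sf_join_commute)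
  finally have eq: "sf_Sup M (insert ?a D) = sf_Sup M (insert a b)" .
  show ?case
  proof (intro exI[of _ "insert ?a D"] conjI)
    show "finite (insert ?a D)" "insert ?a D \<subseteq> B" using D aB by auto
    show "\<forall>d\<in>insert ?a D. \<exists>a\<in>insert a b. d \<subseteq> a" using D(3) by auto
    show "\<forall>d\<in>insert ?a D. \<forall>d'\<in>insert ?a D. d \<noteq> d' \<longrightarrow> d \<inter> d' = sf_bot M"
      using D(4) disj by (auto simp: Int_commute)
    show "sf_Sup M (insert ?a D) = sf_Sup M (insert a b)" by (rule eq)
  qed
qed

lemma join_Inter_top:
  assumes "finite X" "X \<subseteq> B" "y \<in> B" "\<And>x. x \<in> X \<Longrightarrow> J y x = sf_top M"
  shows "J y (sf_top M \<inter> \<Inter>X) = sf_top M"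
  using assms
proof (induction rule: finite_induct)
  case empty
  then show ?case using sf_join_absorb[OF sf_top_mem sf_le_top[OF B_mem]] by (simp add: sf_join_commute)
next
  case (insert x X)
  have "sf_top M \<inter> \<Inter>(insert x X) = x \<inter> (sf_top M \<inter> \<Inter>X)" by auto
  then show ?case
    using insert by (simp add: B_distrib' B_Int_Inter B_top)
qed

text \<open>
  For the thinning the pieces have to be disjoint. It is convenient to pass to their complements
  \<open>X\<close>: intersections of members of \<open>X\<close> then describe what is left when some pieces are removed,
  and disjointness becomes the statement that intersections of complementary subfamilies join to
  everything.
\<close>

lemma spread_coatoms:
  assumes z: "z \<in> B" and h: "h \<in> spread k z"
  obtains X where "finite X" "X \<subseteq> B" "\<And>x. x \<in> X \<Longrightarrow> z \<subseteq> x" "sf_top M \<inter> \<Inter>X \<subseteq> z"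
    "\<And>F. F \<subseteq> X \<Longrightarrow> card F < k \<Longrightarrow> E (sf_top M \<inter> \<Inter>(X - F)) h \<simeq> (\<lambda>_. 0)"
    "\<And>I. I \<subseteq> X \<Longrightarrow> J (sf_top M \<inter> \<Inter>I) (sf_top M \<inter> \<Inter>(X - I)) = sf_top M"
proof -
  obtain b where b: "finite b" "b \<subseteq> B" "\<And>a. a \<in> b \<Longrightarrow> a \<subseteq> c z"
      "sf_Sup M (insert z b) = sf_top M"
    and z0: "\<And>F. F \<subseteq> b \<Longrightarrow> card F < k \<Longrightarrow> E (sf_Sup M (insert z F)) h \<simeq> (\<lambda>_. 0)"
    using h by (rule spreadE) blast
  obtain D where D: "finite D" "D \<subseteq> B" "\<forall>d\<in>D. \<exists>a\<in>b. d \<subseteq> a"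
    "\<forall>d\<in>D. \<forall>d'\<in>D. d \<noteq> d' \<longrightarrow> d \<inter> d' = sf_bot M" "sf_Sup M D = sf_Sup M b"
    using disjoint_refinement[OF b(1,2)] by (elim exE conjE)
  have DL: "D \<subseteq> \<Lambda>" and bL: "b \<subseteq> \<Lambda>" using D(2) b(2) B_sub by auto
  have Dtop: "sf_Sup M (insert z D) = sf_top M"
    using sf_Sup_insert[OF B_mem[OF z] DL] sf_Sup_insert[OF B_mem[OF z] bL] b(4) D(5) by simp
  let ?X = "c ` D"
  have X: "finite ?X" "?X \<subseteq> B" using D c_mem by auto
  have top: "y \<inter> sf_Sup M (insert z D) = y" if "y \<in> B" for y
    unfolding Dtop using sf_le_top[OF B_mem[OF that]] by auto
  have below: "sf_top M \<inter> \<Inter>(?X - F) \<subseteq> sf_Sup M (insert z {d \<in> D. c d \<in> F})" if F: "F \<subseteq> ?X" for F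
  proof -
    let ?y = "sf_top M \<inter> \<Inter>(?X - F)" and ?T = "sf_Sup M (insert z {d \<in> D. c d \<in> F})"
    have y: "?y \<in> B" using X by (intro B_Int_Inter B_top) auto
    have sub: "insert z {d \<in> D. c d \<in> F} \<subseteq> \<Lambda>" using DL B_mem[OF z] by auto
    have T: "?T \<in> \<Lambda>" by (rule sf_Sup_mem[OF sub])
    have "sf_Sup M ((\<inter>) ?y ` insert z D) \<subseteq> ?T"
    proof (rule sf_Sup_least[OF T])
      fix p assume "p \<in> (\<inter>) ?y ` insert z D"
      then consider "p = ?y \<inter> z" | d where "d \<in> D" "p = ?y \<inter> d" by blast
      then show "p \<subseteq> ?T"
      proof cases
        case 1
        then show ?thesis using sf_Sup_upper[OF sub, of z] by auto
      next
        case 2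
        show ?thesis
        proof (cases "c d \<in> F")
          case True
          then show ?thesis using sf_Sup_upper[OF sub, of d] 2 by auto
        next
          case False
          have dB: "d \<in> B" using 2 D(2) by auto
          have "?y \<subseteq> c d" using False 2(1) by blast
          then have "?y \<inter> d = sf_bot M" using le_c_iff[OF y dB] by simp
          then show ?thesis using 2(2) sf_bot_le[OF T] by simp
        qed
      qed
    qed
    moreover have "?y \<inter> sf_Sup M (insert z D) = sf_Sup M ((\<inter>) ?y ` insert z D)"
      using D z y by (intro B_distrib_Sup) auto
    ultimately show ?thesis using top[OF y] by simp
  qed
  show ?thesis
  proof (rule that[OF X])
    show "z \<subseteq> x" if "x \<in> ?X" for x
    proof -
      from that obtain d where d: "d \<in> D" "x = c d" by auto
      with D(3) obtain a where a: "a \<in> b" "d \<subseteq> a" by blast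
      have dB: "d \<in> B" using d D(2) by auto
      have "d \<subseteq> c z" using a b(3) by blast
      then have "c (c z) \<subseteq> c d" using dB c_mem[OF z] by (intro c_antimono)
      then show ?thesis using d c_c[OF z] by simp
    qed
    have "sf_Sup M {z} = z"
      using sf_Sup_insert[OF B_mem[OF z], of "{}"] sf_join_absorb[OF B_mem sf_bot_le[OF B_mem]] z
      by (simp add: sf_Sup_empty)
    then show "sf_top M \<inter> \<Inter>?X \<subseteq> z"
      using below[of "{}"] by simp
    show "E (sf_top M \<inter> \<Inter>(?X - F)) h \<simeq> (\<lambda>_. 0)" if F: "F \<subseteq> ?X" "card F < k" for F
    proof -
      let ?G = "{d \<in> D. c d \<in> F}"
      have fF: "finite F" using F(1) X(1) by (rule finite_subset)
      have "inj_on c ?G"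
        using D(2) by (intro inj_onI) (metis c_c mem_Collect_eq subsetD)
      moreover have "c ` ?G \<subseteq> F" by auto
      ultimately have "card ?G \<le> card F" using fF by (intro card_inj_on_le)
      then have cG: "card ?G < k" using F(2) by simp
      have "\<exists>a. a \<in> b \<and> d \<subseteq> a" if "d \<in> ?G" for d using that D(3) by blast
      then have "\<exists>r. \<forall>d\<in>?G. r d \<in> b \<and> d \<subseteq> r d" by (intro bchoice ballI)
      then obtain r where "\<forall>d\<in>?G. r d \<in> b \<and> d \<subseteq> r d" by (rule exE)
      then have r: "r d \<in> b \<and> d \<subseteq> r d" if "d \<in> ?G" for d using that by (rule bspec)
      have rb: "r ` ?G \<subseteq> b" using r by blast
      have "card (r ` ?G) < k"
        using card_image_le[of ?G r] D(1) cG by (auto intro: le_less_trans)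
      then have *: "E (sf_Sup M (insert z (r ` ?G))) h \<simeq> (\<lambda>_. 0)"
        using rb by (intro z0)
      have sub: "insert z (r ` ?G) \<subseteq> \<Lambda>"
        using rb bL B_mem[OF z] by auto
      have "sf_Sup M (insert z ?G) \<subseteq> sf_Sup M (insert z (r ` ?G))"
      proof (rule sf_Sup_least[OF sf_Sup_mem[OF sub]])
        fix a assume "a \<in> insert z ?G"
        then consider "a = z" | "a \<in> ?G" by auto
        then show "a \<subseteq> sf_Sup M (insert z (r ` ?G))"
        proof cases
          case 1
          then show ?thesis using sf_Sup_upper[OF sub, of z] by simp
        next
          case 2
          then have "r a \<subseteq> sf_Sup M (insert z (r ` ?G))" using sf_Sup_upper[OF sub, of "r a"] by blast
          then show ?thesis using r[OF 2] by blast
        qed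
      qed
      with below[OF F(1)] have le: "sf_top M \<inter> \<Inter>(?X - F) \<subseteq> sf_Sup M (insert z (r ` ?G))"
        by (rule order_trans)
      have "sf_top M \<inter> \<Inter>(?X - F) \<in> \<Lambda>"
        using X by (intro B_mem B_Int_Inter B_top) auto
      then show ?thesis
        by (rule E_zero_mono[OF _ sf_Sup_mem[OF sub] le spread_L2[OF h] *])
    qed
    show "J (sf_top M \<inter> \<Inter>I) (sf_top M \<inter> \<Inter>(?X - I)) = sf_top M" if I: "I \<subseteq> ?X" for I
    proof (rule join_Inter_top)
      have fI: "finite I" "I \<subseteq> B" using I X by (auto intro: finite_subset)
      show "finite (?X - I)" "?X - I \<subseteq> B" using X by auto
      show yB: "sf_top M \<inter> \<Inter>I \<in> B" using fI by (intro B_Int_Inter B_top)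
      fix x assume x: "x \<in> ?X - I"
      then have xB: "x \<in> B" using X by auto
      have "J x (sf_top M \<inter> \<Inter>I) = sf_top M"
      proof (rule join_Inter_top[OF fI xB])
        fix x' assume x': "x' \<in> I"
        obtain d d' where d: "d \<in> D" "x = c d" "d' \<in> D" "x' = c d'" using x x' I by blast
        then have "d \<noteq> d'" using x x' by auto
        then have "d \<inter> d' = sf_bot M" using D(4) d by blast
        moreover have dB: "d \<in> B" "d' \<in> B" using d D(2) by auto
        ultimately have "c (c d) \<subseteq> c d'" by (simp add: le_c_iff c_c)
        then show "J x x' = sf_top M"
          using c_le_iff_join[OF c_mem c_mem] dB d by blast
      qed
      then show "J (sf_top M \<inter> \<Inter>I) x = sf_top M" by (simp add: sf_join_commute)
    qed
  qed
qed

lemma J_bot: "x \<in> \<Lambda> \<Longrightarrow> J (sf_bot M) x = x"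
  using sf_join_absorb[OF _ sf_bot_le] by (simp add: sf_join_commute)

text \<open>
  One round of random removal. With \<open>y\<close> the removed part, \<open>r\<close> is \<open>z\<close> together with \<open>y\<close>, and \<open>p\<close> is
  the complement of \<open>y\<close>; it contains \<open>z\<close> because only pieces of the complement of \<open>z\<close> are removed.
  The same choice makes both components of \<open>f\<close> small: on \<open>p\<close> because \<open>f\<close> is spread over many
  pieces, and on \<open>U \<squnion> r\<close> because \<open>f\<close> has no component on \<open>U \<squnion> z\<close>, so that at least one piece would
  have to be removed.
\<close>

lemma thinning_step:
  assumes z: "z \<in> B" and f: "f \<in> L2_space M" and f0: "E (J U z) f \<simeq> (\<lambda>_. 0)" and e: "0 < e"
  obtains r p where "r \<in> B" "p \<in> B" "z \<subseteq> r" "z \<subseteq> p" "J r p = sf_top M"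
    "l2 (E (J U r) f) \<le> e" "l2 (E p f) \<le> e"
proof -
  \<comment> \<open>\<open>N\<close> bounds the squared norms of \<open>f\<close> and of its approximation \<open>h\<close>, which can be chosen only
      after \<open>k\<close>; each of the two means below is at most \<open>e\<^sup>2 / 8\<close>.\<close>
  define N where "N = (l2 f + 1)\<^sup>2"
  have N: "1 \<le> N" unfolding N_def by (simp add: power2_eq_square algebra_simps)
  define \<epsilon> where "\<epsilon> = min (1/2) (e\<^sup>2 / (8 * N))"
  have \<epsilon>: "0 < \<epsilon>" "\<epsilon> < 1" "\<epsilon> * N \<le> e\<^sup>2 / 8"
  proof -
    show "0 < \<epsilon>" "\<epsilon> < 1" using N e by (auto simp: \<epsilon>_def)
    have "\<epsilon> * N \<le> (e\<^sup>2 / (8 * N)) * N" using N by (intro mult_right_mono) (auto simp: \<epsilon>_def)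
    then show "\<epsilon> * N \<le> e\<^sup>2 / 8" using N by simp
  qed
  obtain k where k: "(1 - \<epsilon>)^k < e\<^sup>2 / (8 * N)"
    using real_arch_pow_inv[of "e\<^sup>2 / (8 * N)" "1 - \<epsilon>"] \<epsilon> N e by auto
  obtain h where h: "h \<in> spread k z" "l2 (\<lambda>\<omega>. f \<omega> - h \<omega>) < min 1 (e / 2)"
    using spread_approximation[OF z f f0, of "min 1 (e/2)"] e by auto
  have h2: "h \<in> L2_space M" using h(1) by (rule spread_L2)
  have "l2 h \<le> l2 f + 1"
    using l2_triangle_sub[OF h2 f] h(2) l2_minus_commute[of h f] by simp
  then have hN: "(l2 h)\<^sup>2 \<le> N" unfolding N_def by (intro power_mono) auto
  have fN: "(l2 f)\<^sup>2 \<le> N" unfolding N_def by (intro power_mono) auto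
  obtain X where X: "finite X" "X \<subseteq> B" "\<And>x. x \<in> X \<Longrightarrow> z \<subseteq> x" "sf_top M \<inter> \<Inter>X \<subseteq> z"
    and X0: "\<And>F. F \<subseteq> X \<Longrightarrow> card F < k \<Longrightarrow> E (sf_top M \<inter> \<Inter>(X - F)) h \<simeq> (\<lambda>_. 0)"
    and XJ: "\<And>I. I \<subseteq> X \<Longrightarrow> J (sf_top M \<inter> \<Inter>I) (sf_top M \<inter> \<Inter>(X - I)) = sf_top M"
    using spread_coatoms[OF z h(1)] by blast
  obtain xs where xs: "set xs = X" "distinct xs"
    using finite_distinct_list[OF X(1)] by blast
  have Xm: "sf_top M \<inter> \<Inter>(X - F) \<in> B" for F
    using X by (intro B_Int_Inter B_top) auto
  let ?q = "\<lambda>b. (l2 (E (J (sf_bot M) b) h))\<^sup>2" and ?r = "\<lambda>b. (l2 (E (J U b) f))\<^sup>2"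
  have "thinned (1 - \<epsilon>) xs ?q (sf_top M) \<le> (1 - \<epsilon>)^k * (l2 h)\<^sup>2"
  proof (rule thinned_bound[OF splits_bot _ _ B_top xs(2) _ h2])
    fix F assume "F \<subseteq> set xs" "card F < k"
    then show "E (J (sf_bot M) (sf_top M \<inter> \<Inter>(set xs - F))) h \<simeq> (\<lambda>_. 0)"
      using X0[of F] J_bot[OF B_mem[OF Xm[of F]]] xs(1) by simp
  qed (use \<epsilon> xs X in auto)
  also have "\<dots> \<le> (1 - \<epsilon>)^k * N"
    using hN \<epsilon> by (intro mult_left_mono) auto
  also have "\<dots> \<le> (e\<^sup>2 / (8 * N)) * N"
    using k N by (intro mult_right_mono) auto
  also have "\<dots> = e\<^sup>2 / 8" using N by simp
  finally have qb: "thinned (1 - \<epsilon>) xs ?q (sf_top M) \<le> e\<^sup>2 / 8" .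
  have "thinned \<epsilon> xs ?r (sf_top M) \<le> \<epsilon>^1 * (l2 f)\<^sup>2"
  proof (rule thinned_bound[OF splits_U _ _ B_top xs(2) _ f])
    fix F assume "F \<subseteq> set xs" "card F < 1"
    then have "F = {}" using finite_subset[of F "set xs"] by (simp add: card_eq_0_iff)
    have m: "J U (sf_top M \<inter> \<Inter>(set xs - F)) \<in> \<Lambda>" "J U z \<in> \<Lambda>"
      using Xm[of F] z xs(1) by (auto intro: sf_join_mem U_mem B_mem)
    have "J U (sf_top M \<inter> \<Inter>(set xs - F)) \<subseteq> J U z"
      using X(4) \<open>F = {}\<close> xs(1) z by (intro sf_join_mono U_mem B_mem) auto
    then show "E (J U (sf_top M \<inter> \<Inter>(set xs - F))) f \<simeq> (\<lambda>_. 0)"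
      by (rule E_zero_mono[OF m _ f f0])
  qed (use \<epsilon> xs X in auto)
  also have "\<dots> \<le> \<epsilon> * N" using fN \<epsilon> by (simp add: mult_left_mono)
  also have "\<dots> \<le> e\<^sup>2 / 8" by (rule \<epsilon>)
  finally have rb: "thinned (1 - (1 - \<epsilon>)) xs ?r (sf_top M) \<le> e\<^sup>2 / 8" by simp
  obtain I where I: "I \<subseteq> X"
    "?q (sf_top M \<inter> \<Inter>I) + ?r (sf_top M \<inter> \<Inter>(X - I))
      \<le> thinned (1 - \<epsilon>) xs ?q (sf_top M) + thinned (1 - (1 - \<epsilon>)) xs ?r (sf_top M)"
    using thinned_selection[OF _ _ xs(2), of "1 - \<epsilon>" ?q "sf_top M" ?r "sf_top M"] \<epsilon>
    unfolding xs(1) by auto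
  let ?p = "sf_top M \<inter> \<Inter>I" and ?r' = "sf_top M \<inter> \<Inter>(X - I)"
  have p: "?p \<in> B" using I X by (intro B_Int_Inter B_top) (auto intro: finite_subset)
  have le: "?q ?p + ?r ?r' \<le> (e/2)\<^sup>2"
    using I(2) qb rb by (simp add: power_divide)
  have "?q ?p \<le> (e/2)\<^sup>2" "?r ?r' \<le> (e/2)\<^sup>2"
    using le zero_le_power2[of "l2 (E (J (sf_bot M) ?p) h)"] zero_le_power2[of "l2 (E (J U ?r') f)"]
    by linarith+
  then have qp: "l2 (E ?p h) \<le> e/2" and rr: "l2 (E (J U ?r') f) \<le> e/2"
    using e J_bot[OF B_mem[OF p]] by (auto intro: power2_le_imp_le)
  have "l2 (E ?p f) \<le> l2 (E ?p h) + l2 (\<lambda>\<omega>. E ?p f \<omega> - E ?p h \<omega>)"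
    by (intro l2_triangle_sub E_L2 B_mem p f h2)
  also have "l2 (\<lambda>\<omega>. E ?p f \<omega> - E ?p h \<omega>) = l2 (E ?p (\<lambda>\<omega>. f \<omega> - h \<omega>))"
    using E_diff[OF B_mem[OF p] f h2]
    by (intro l2_cong L2_diff E_L2 B_mem p f h2) (auto elim!: eventually_mono)
  also have "\<dots> \<le> l2 (\<lambda>\<omega>. f \<omega> - h \<omega>)"
    by (intro E_contraction B_mem p L2_diff f h2)
  finally have pf: "l2 (E ?p f) \<le> e" using qp h(2) by simp
  show ?thesis
  proof (rule that[of ?r' ?p])
    show "z \<subseteq> ?r'" "z \<subseteq> ?p"
      using X(3) I(1) sf_le_top[OF B_mem[OF z]] by auto
    show "J ?r' ?p = sf_top M"
      using XJ[OF I(1)] by (simp add: sf_join_commute)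
    show "l2 (E (J U ?r') f) \<le> e" using rr e by simp
  qed (use Xm p pf in auto)
qed

lemma E_join_thinning_bound:
  assumes "z \<in> B" "r \<in> B" "z \<subseteq> r" "f \<in> L2_space M"
  shows "l2 (E (J U r) f) \<le> l2 (E (J U z) f) + l2 (E (J U r) (\<lambda>\<omega>. f \<omega> - E (J U z) f \<omega>))"
proof -
  have m: "J U z \<in> \<Lambda>" "J U r \<in> \<Lambda>" using assms by (auto intro: sf_join_mem U_mem B_mem)
  have sub: "J U z \<subseteq> J U r" using assms by (intro sf_join_mono U_mem B_mem) auto
  note f = assms(4)
  have Ez: "E (J U z) f \<in> L2_space M" by (rule E_L2[OF m(1) f])
  have "l2 (E (J U r) f) \<le> l2 (E (J U z) f) + l2 (\<lambda>\<omega>. E (J U r) f \<omega> - E (J U z) f \<omega>)"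
    by (intro l2_triangle_sub E_L2 m f)
  also have "l2 (\<lambda>\<omega>. E (J U r) f \<omega> - E (J U z) f \<omega>) = l2 (E (J U r) (\<lambda>\<omega>. f \<omega> - E (J U z) f \<omega>))"
    using E_diff[OF m(2) f Ez] E_tower'[OF m sub f]
    by (intro l2_cong L2_diff E_L2 m f) (auto elim!: eventually_elim2)
  finally show ?thesis .
qed

text \<open>
  Let \<open>f\<close> be orthogonal to the \<open>U\<close>-measurable functions. In round \<open>n\<close> the step is applied to the
  component of \<open>f\<close> orthogonal to \<open>U \<squnion> z n\<close>, with tolerance \<open>\<eta> / 2^n\<close>, so that the discarded
  components of \<open>f\<close> have norm at most \<open>2 \<eta>\<close> altogether. The \<open>\<sigma>\<close>-field \<open>P n\<close> contains \<open>z n\<close> and the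
  complement of \<open>z (Suc n)\<close>, hence also the infimum \<open>v\<close> of all these complements; thus the
  component of \<open>f\<close> on \<open>z n \<squnion> v\<close> has norm at most \<open>3 \<eta>\<close> for every \<open>n\<close>. If these \<open>\<sigma>\<close>-fields
  exhausted everything, \<open>f\<close> would have norm less than \<open>4 \<eta>\<close>.
\<close>

lemma classical_if_sup_inf:
  assumes sup_inf: "\<And>x :: nat \<Rightarrow> 'a set set. range x \<subseteq> B \<Longrightarrow> incseq x \<Longrightarrow>
    J (sf_Sup M (range x)) (sf_Inf M (range (\<lambda>n. c (x n)))) = sf_top M"
  shows "classical M B"
proof (rule ccontr)
  assume "\<not> classical M B"
  then have "U \<noteq> sf_top M" by (simp add: classical_iff)
  then obtain A where A: "A \<in> sets M" "A \<notin> U"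
    using sf_le_top[OF U_mem] by (auto simp: sf_top_def)
  let ?i = "indicator A :: 'a \<Rightarrow> real"
  have i: "?i \<in> L2_space M" by (rule L2_indicator[OF A(1)])
  define f where "f = (\<lambda>\<omega>. ?i \<omega> - E U ?i \<omega>)"
  have f: "f \<in> L2_space M" unfolding f_def by (intro L2_diff E_L2 U_mem i)
  have "l2 f \<noteq> 0"
  proof
    assume "l2 f = 0"
    then have "f \<simeq> (\<lambda>_. 0)" using l2_eq_0[OF f] by simp
    then have "E U ?i \<simeq> ?i" unfolding f_def by eventually_elim simp
    then have "?i \<in> mble U" by (rule E_idD[OF U_mem i])
    then show False using mble_indicatorD[OF U_mem A(1)] A(2) by blast
  qed
  define \<eta> where "\<eta> = l2 f / 4"
  have \<eta>: "0 < \<eta>" using \<open>l2 f \<noteq> 0\<close> l2_nonneg[of f] unfolding \<eta>_def by linarith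
  have EUf: "E U f \<simeq> (\<lambda>_. 0)"
  proof -
    have "E U f \<simeq> (\<lambda>\<omega>. E U ?i \<omega> - E U (E U ?i) \<omega>)"
      unfolding f_def by (intro E_diff U_mem i E_L2)
    moreover have "E U (E U ?i) \<simeq> E U ?i" by (intro E_tower U_mem i) auto
    ultimately show ?thesis by eventually_elim simp
  qed
  have Jm: "J U z \<in> \<Lambda>" if "z \<in> B" for z using that by (intro sf_join_mem U_mem B_mem)
  let ?f = "\<lambda>z \<omega>. f \<omega> - E (J U z) f \<omega>"
  have f2: "?f z \<in> L2_space M" if "z \<in> B" for z using that by (intro L2_diff E_L2 Jm f)
  define Q where "Q z n r p \<longleftrightarrow> r \<in> B \<and> p \<in> B \<and> z \<subseteq> r \<and> z \<subseteq> p \<and> J r p = sf_top M \<and>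
      l2 (E (J U r) (?f z)) \<le> \<eta> * (1/2)^n \<and> l2 (E p (?f z)) \<le> \<eta> * (1/2)^n" for z r p and n :: nat
  have ex: "\<exists>r p. Q z n r p" if z: "z \<in> B" for z n
  proof -
    have "E (J U z) (?f z) \<simeq> (\<lambda>\<omega>. E (J U z) f \<omega> - E (J U z) (E (J U z) f) \<omega>)"
      by (intro E_diff Jm z f E_L2)
    moreover have "E (J U z) (E (J U z) f) \<simeq> E (J U z) f" by (intro E_tower Jm z f) auto
    ultimately have zero: "E (J U z) (?f z) \<simeq> (\<lambda>_. 0)" by eventually_elim simp
    have pos: "0 < \<eta> * (1/2)^n" using \<eta> by simp
    obtain r p where "r \<in> B" "p \<in> B" "z \<subseteq> r" "z \<subseteq> p" "J r p = sf_top M"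
      "l2 (E (J U r) (?f z)) \<le> \<eta> * (1/2)^n" "l2 (E p (?f z)) \<le> \<eta> * (1/2)^n"
      by (rule thinning_step[OF z f2[OF z] zero pos])
    then show ?thesis unfolding Q_def by (intro exI conjI)
  qed
  define r where "r z n = (SOME r. \<exists>p. Q z n r p)" for z n
  define p where "p z n = (SOME p. Q z n (r z n) p)" for z n
  have exp: "\<exists>p. Q z n (r z n) p" if "z \<in> B" for z n
    unfolding r_def by (rule someI_ex[OF ex[OF that]])
  have rp: "Q z n (r z n) (p z n)" if "z \<in> B" for z n
    unfolding p_def by (rule someI_ex[OF exp[OF that]])
  define z where "z = rec_nat (sf_bot M) (\<lambda>n z. r z n)"
  have z_0: "z 0 = sf_bot M" and z_Suc: "z (Suc n) = r (z n) n" for n by (simp_all add: z_def)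
  have zB: "z n \<in> B" for n
  proof (induction n)
    case 0
    show ?case unfolding z_0 by (rule B_bot)
  next
    case (Suc n)
    show ?case unfolding z_Suc using rp[OF Suc.IH, of n] unfolding Q_def by (elim conjE)
  qed
  define P where "P n = p (z n) n" for n
  have P: "P n \<in> B" "z n \<subseteq> P n" "J (z (Suc n)) (P n) = sf_top M" "l2 (E (P n) (?f (z n))) \<le> \<eta> * (1/2)^n"
    and zS: "z n \<subseteq> z (Suc n)" "l2 (E (J U (z (Suc n))) (?f (z n))) \<le> \<eta> * (1/2)^n" for n
    using rp[OF zB[of n], of n] unfolding Q_def P_def z_Suc by simp_all
  have g: "l2 (E (J U (z n)) f) \<le> 2 * \<eta> - 2 * \<eta> * (1/2)^n" for n
  proof (induction n)
    case 0
    have "J U (z 0) = U" unfolding z_0 by (intro sf_join_absorb U_mem sf_bot_le)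
    then show ?case
      using EUf l2_eq_0[OF E_L2[OF U_mem f]] by simp
  next
    case (Suc n)
    then show ?case
      using E_join_thinning_bound[OF zB zB zS(1) f, of n] zS(2)[of n] by simp
  qed
  have Pf: "l2 (E (P n) f) \<le> 3 * \<eta>" for n
  proof -
    note m = B_mem[OF P(1)[of n]]
    have Ez: "E (J U (z n)) f \<in> L2_space M" by (intro E_L2 Jm zB f)
    have "l2 (E (P n) f) \<le> l2 (E (P n) (E (J U (z n)) f)) + l2 (\<lambda>\<omega>. E (P n) f \<omega> - E (P n) (E (J U (z n)) f) \<omega>)"
      by (intro l2_triangle_sub E_L2 m f Ez)
    also have "l2 (\<lambda>\<omega>. E (P n) f \<omega> - E (P n) (E (J U (z n)) f) \<omega>) = l2 (E (P n) (?f (z n)))"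
      using E_diff[OF m f Ez] by (intro l2_cong L2_diff E_L2 m f Ez) (auto elim!: eventually_mono)
    also have "l2 (E (P n) (E (J U (z n)) f)) \<le> l2 (E (J U (z n)) f)"
      by (intro E_contraction m Ez)
    finally have "l2 (E (P n) f) \<le> (2 * \<eta> - 2 * \<eta> * (1/2)^n) + \<eta> * (1/2)^n"
      using g[of n] P(4)[of n] by linarith
    then have "l2 (E (P n) f) \<le> 2 * \<eta> - \<eta> * (1/2)^n" by simp
    moreover have "0 \<le> \<eta> * (1/2)^n" using \<eta> by simp
    ultimately show ?thesis using \<eta> by linarith
  qed
  have inc: "incseq z" using zS(1) by (intro incseq_SucI)
  define v where "v = sf_Inf M (range (\<lambda>n. c (z n)))"
  have range_sub: "range z \<subseteq> \<Lambda>" "range (\<lambda>n. c (z n)) \<subseteq> \<Lambda>"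
    using zB B_mem c_mem by auto
  have v: "v \<in> \<Lambda>" unfolding v_def by (rule sf_Inf_mem[OF range_sub(2)])
  have zL: "z n \<in> \<Lambda>" for n using zB by (rule B_mem)
  have top: "J (sf_Sup M (range z)) v = sf_top M"
    unfolding v_def using zB inc by (intro sup_inf) auto
  define Y where "Y n = J (z n) v" for n
  have Y: "Y n \<in> \<Lambda>" for n unfolding Y_def using zL v by (intro sf_join_mem)
  have YY: "range Y \<subseteq> \<Lambda>" using Y by auto
  have "z n \<subseteq> sf_Sup M (range Y)" for n
    using sf_join_upper(1)[OF zL v, of n] sf_Sup_upper[OF YY, of "Y n"] unfolding Y_def by blast
  then have "sf_Sup M (range z) \<subseteq> sf_Sup M (range Y)"
    by (intro sf_Sup_least sf_Sup_mem[OF YY]) auto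
  moreover have "v \<subseteq> sf_Sup M (range Y)"
    using sf_join_upper(2)[OF zL v, of 0] sf_Sup_upper[OF YY, of "Y 0"] unfolding Y_def by blast
  ultimately have "sf_top M \<subseteq> sf_Sup M (range Y)"
    unfolding top[symmetric] by (intro sf_join_least sf_Sup_mem[OF YY])
  then have Ytop: "sf_Sup M (range Y) = sf_top M"
    by (intro top_le_eq sf_Sup_mem[OF YY])
  have "f \<in> mble (sf_top M)"
    using L2_measurable[OF f] sigma_field_sets[OF sf_top_mem] by (simp add: measurable_def sf_top_def)
  then have ftop: "f \<in> L2_of (sf_Sup M (range Y))"
    unfolding Ytop using f by (rule IntI[rotated])
  have dir: "\<exists>w\<in>range Y. x \<subseteq> w \<and> y \<subseteq> w" if "x \<in> range Y" "y \<in> range Y" for x y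
  proof -
    from that obtain m n where mn: "x = Y m" "y = Y n" by auto
    have "Y i \<subseteq> Y (max m n)" if "i \<le> max m n" for i
      unfolding Y_def using incseqD[OF inc that] by (intro sf_join_mono zL v) auto
    then show ?thesis using mn by (intro bexI[of _ "Y (max m n)"]) auto
  qed
  obtain n where n: "l2 (\<lambda>\<omega>. f \<omega> - E (Y n) f \<omega>) < \<eta>"
  proof -
    obtain y where "y \<in> range Y" "l2 (\<lambda>\<omega>. f \<omega> - E y f \<omega>) < \<eta>"
      using directed_Sup_approximation[OF YY _ dir ftop \<eta>] by blast
    then show ?thesis using that by auto
  qed
  have "v \<subseteq> c (z (Suc n))" unfolding v_def sf_Inf_def by auto
  also have "\<dots> \<subseteq> P n" using c_le_iff_join[OF zB P(1)] P(3) by blast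
  finally have "Y n \<subseteq> P n"
    unfolding Y_def by (rule sf_join_least[OF B_mem[OF P(1)] P(2)])
  then have "l2 (E (Y n) f) = l2 (E (Y n) (E (P n) f))"
    using E_tower[OF Y B_mem[OF P(1)] _ f, of n n]
    by (intro l2_cong E_L2 Y B_mem P f) (auto elim!: eventually_mono)
  also have "\<dots> \<le> l2 (E (P n) f)"
    by (intro E_contraction E_L2 Y B_mem P f)
  finally have "l2 f < 3 * \<eta> + \<eta>"
    using n Pf[of n] l2_triangle_sub[OF f E_L2[OF Y f], of n] by linarith
  then show False by (simp add: \<eta>_def)
qed

end

section \<open>The completion of a classical algebra\<close>

context prob_space
begin

lemma E_indep:
  assumes "x \<in> \<Lambda>" "y \<in> \<Lambda>" "indep_set x y" "f \<in> L2_of x"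
  shows "E y f \<simeq> (\<lambda>_. \<integral>\<omega>. f \<omega> \<partial>M)"
proof -
  have Jb: "sf_join M (sf_bot M) y = y"
    using sf_join_absorb[OF assms(2) sf_bot_le[OF assms(2)]] by (simp add: sf_join_commute)
  have f2: "f \<in> L2_space M" using assms(4) by (rule IntD1)
  show ?thesis
    using E_join_indep[OF assms(1) sf_bot_mem sf_bot_le[OF assms(1)] assms(2-4)] E_bot[OF f2]
    unfolding Jb by eventually_elim simp
qed

lemma l2_triangle_minus:
  assumes "f \<in> L2_space M" "g \<in> L2_space M"
  shows "l2 (\<lambda>\<omega>. f \<omega> - g \<omega>) \<le> l2 f + l2 g"
  using l2_triangle[OF assms(1) L2_cmult[OF assms(2), of "-1"]] l2_cmult[of "-1" g] by simp

lemma l2_small_zero: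
  assumes "f \<in> L2_space M" "\<And>e. 0 < e \<Longrightarrow> l2 f \<le> e"
  shows "f \<simeq> (\<lambda>_. 0)"
proof -
  have "l2 f \<le> 0" by (rule field_le_epsilon) (simp add: assms(2))
  then have "l2 f = 0" using l2_nonneg[of f] by linarith
  then show ?thesis using l2_eq_0[OF assms(1)] by simp
qed

lemma prob_symdiff:
  assumes "A \<in> sets M" "C \<in> sets M"
  shows "\<bar>prob A - prob C\<bar> \<le> prob (sym_diff A C)"
proof -
  have S: "sym_diff A C \<in> sets M" using assms by auto
  have "prob A \<le> prob (C \<union> sym_diff A C)" "prob C \<le> prob (A \<union> sym_diff A C)"
    using assms S by (auto intro!: finite_measure_mono)
  moreover have "prob (C \<union> sym_diff A C) \<le> prob C + prob (sym_diff A C)"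
    "prob (A \<union> sym_diff A C) \<le> prob A + prob (sym_diff A C)"
    using assms S by (auto intro!: measure_Un_le)
  ultimately show ?thesis by linarith
qed

lemma prob_large_le:
  assumes f: "f \<in> L2_space M" and d: "0 < d"
  shows "prob {\<omega> \<in> space M. d \<le> \<bar>f \<omega>\<bar>} \<le> (l2 f)\<^sup>2 / d\<^sup>2"
proof -
  have [measurable]: "f \<in> borel_measurable M" using f by (rule L2_measurable)
  have "{\<omega> \<in> space M. d \<le> \<bar>f \<omega>\<bar>} = {\<omega> \<in> space M. d\<^sup>2 \<le> (f \<omega>)\<^sup>2}"
    using d abs_le_square_iff[of d] by auto
  also have "prob \<dots> \<le> (\<integral>\<omega>. (f \<omega>)\<^sup>2 \<partial>M) / d\<^sup>2"
    using d L2_integrable_square[OF f]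
    by (intro integral_Markov_inequality_measure[where A = "{}"]) auto
  finally show ?thesis by (simp add: l2_sq)
qed

end

context noise
begin

text \<open>
  The basic neighbourhoods of \<open>x\<close>, within \<open>B\<close>, for the strong operator topology on the first
  chaos.
\<close>

definition near :: "'a set set \<Rightarrow> ('a \<Rightarrow> real) set \<Rightarrow> real \<Rightarrow> 'a set set set" where
  "near x F \<epsilon> = {b \<in> B. \<forall>f\<in>F. l2 (\<lambda>\<omega>. E x f \<omega> - E b f \<omega>) < \<epsilon>}"

definition approximable :: "'a set set \<Rightarrow> bool" where
  "approximable x \<longleftrightarrow> (\<forall>F \<epsilon>. finite F \<longrightarrow> F \<subseteq> H1 \<longrightarrow> 0 < \<epsilon> \<longrightarrow> near x F \<epsilon> \<noteq> {})"

lemma approximableE: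
  assumes "approximable x" "finite F" "F \<subseteq> H1" "0 < \<epsilon>"
  obtains b where "b \<in> B" "\<And>f. f \<in> F \<Longrightarrow> l2 (\<lambda>\<omega>. E x f \<omega> - E b f \<omega>) < \<epsilon>"
proof -
  obtain b where "b \<in> near x F \<epsilon>" using assms unfolding approximable_def by blast
  then show ?thesis using that[of b] unfolding near_def by simp
qed

lemma approximableI:
  assumes "\<And>F \<epsilon>. finite F \<Longrightarrow> F \<subseteq> H1 \<Longrightarrow> 0 < \<epsilon> \<Longrightarrow> \<exists>b\<in>B. \<forall>f\<in>F. l2 (\<lambda>\<omega>. E x f \<omega> - E b f \<omega>) < \<epsilon>"
  shows "approximable x"
  unfolding approximable_def
proof (intro allI impI)
  fix F and \<epsilon> :: real assume "finite F" "F \<subseteq> H1" "0 < \<epsilon>"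
  from assms[OF this] obtain b where "b \<in> B" "\<forall>f\<in>F. l2 (\<lambda>\<omega>. E x f \<omega> - E b f \<omega>) < \<epsilon>" by (rule bexE)
  then have "b \<in> near x F \<epsilon>" unfolding near_def by simp
  then show "near x F \<epsilon> \<noteq> {}" by blast
qed

lemma H1_closed:
  assumes f: "f \<in> L2_space M" and approx: "\<And>e. 0 < e \<Longrightarrow> \<exists>h\<in>H1. l2 (\<lambda>\<omega>. f \<omega> - h \<omega>) < e"
  shows "f \<in> H1"
proof (rule H1I[OF f])
  fix x assume x: "x \<in> B"
  have m: "x \<in> \<Lambda>" "c x \<in> \<Lambda>" using x by (auto intro: B_mem c_mem)
  let ?R = "\<lambda>f \<omega>. f \<omega> - (E x f \<omega> + E (c x) f \<omega>)"
  have R2: "?R g \<in> L2_space M" if "g \<in> L2_space M" for g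
    using that by (intro L2_diff L2_add E_L2 m)
  have "?R f \<simeq> (\<lambda>_. 0)"
  proof (rule l2_small_zero[OF R2[OF f]])
    fix e :: real assume "0 < e"
    then obtain h where h: "h \<in> H1" "l2 (\<lambda>\<omega>. f \<omega> - h \<omega>) < e / 3"
      using approx[of "e/3"] by auto
    have h2: "h \<in> L2_space M" using h(1) by (rule H1_L2)
    let ?d = "\<lambda>\<omega>. f \<omega> - h \<omega>"
    have d: "?d \<in> L2_space M" by (intro L2_diff f h2)
    have "l2 (?R f) = l2 (?R ?d)"
      using E_diff[OF m(1) f h2] E_diff[OF m(2) f h2] H1_split[OF h(1) x]
      by (intro l2_cong R2 f d, eventually_elim) simp
    also have "\<dots> \<le> l2 ?d + l2 (\<lambda>\<omega>. E x ?d \<omega> + E (c x) ?d \<omega>)"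
      by (intro l2_triangle_minus d L2_add E_L2 m)
    also have "l2 (\<lambda>\<omega>. E x ?d \<omega> + E (c x) ?d \<omega>) \<le> l2 (E x ?d) + l2 (E (c x) ?d)"
      by (intro l2_triangle E_L2 m d)
    finally show "l2 (?R f) \<le> e"
      using E_contraction[OF m(1) d] E_contraction[OF m(2) d] h(2) by linarith
  qed
  then show "f \<simeq> (\<lambda>\<omega>. E x f \<omega> + E (c x) f \<omega>)" by eventually_elim simp
qed

lemma approximable_H1:
  assumes x: "x \<in> \<Lambda>" "approximable x" and f: "f \<in> H1"
  shows "E x f \<in> H1"
proof (rule H1_closed[OF E_L2[OF x(1) H1_L2[OF f]]])
  fix e :: real assume "0 < e"
  then obtain b where "b \<in> B" "l2 (\<lambda>\<omega>. E x f \<omega> - E b f \<omega>) < e"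
    using approximableE[OF x(2), of "{f}" e] f by auto
  then show "\<exists>h\<in>H1. l2 (\<lambda>\<omega>. E x f \<omega> - h \<omega>) < e"
    using H1_E[OF f] by blast
qed

lemma E_difference_small:
  assumes a: "a \<in> \<Lambda>" and f: "f \<in> L2_space M" and g: "g \<in> L2_space M"
  shows "l2 (\<lambda>\<omega>. E a f \<omega> - E a g \<omega>) \<le> l2 (\<lambda>\<omega>. f \<omega> - g \<omega>)"
proof -
  have "l2 (\<lambda>\<omega>. E a f \<omega> - E a g \<omega>) = l2 (E a (\<lambda>\<omega>. f \<omega> - g \<omega>))"
    using E_diff[OF a f g] by (intro l2_cong L2_diff E_L2 a f g) (auto elim!: eventually_mono)
  also have "\<dots> \<le> l2 (\<lambda>\<omega>. f \<omega> - g \<omega>)"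
    by (intro E_contraction a L2_diff f g)
  finally show ?thesis .
qed

text \<open>
  Products of approximations approximate products, because conditional expectations are
  contractions.
\<close>

lemma composition_approx:
  assumes x: "x \<in> \<Lambda>" and y: "y \<in> \<Lambda>" and a: "a \<in> B" and b: "b \<in> B" and f: "f \<in> L2_space M"
    and 1: "l2 (\<lambda>\<omega>. E x (E y f) \<omega> - E a (E y f) \<omega>) < e" and 2: "l2 (\<lambda>\<omega>. E y f \<omega> - E b f \<omega>) < e"
  shows "l2 (\<lambda>\<omega>. E x (E y f) \<omega> - E (a \<inter> b) f \<omega>) < 2 * e"
proof -
  note m = B_mem[OF a] B_mem[OF b] B_mem[OF B_Int[OF a b]]
  have "l2 (\<lambda>\<omega>. E x (E y f) \<omega> - E (a \<inter> b) f \<omega>) = l2 (\<lambda>\<omega>. E x (E y f) \<omega> - E a (E b f) \<omega>)"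
    using E_commute[OF a b f] by (intro l2_cong L2_diff E_L2 x y m f) (auto elim!: eventually_mono)
  also have "\<dots> \<le> l2 (\<lambda>\<omega>. E x (E y f) \<omega> - E a (E y f) \<omega>) + l2 (\<lambda>\<omega>. E a (E y f) \<omega> - E a (E b f) \<omega>)"
    by (intro l2_triangle_diff E_L2 x y m f)
  also have "l2 (\<lambda>\<omega>. E a (E y f) \<omega> - E a (E b f) \<omega>) \<le> l2 (\<lambda>\<omega>. E y f \<omega> - E b f \<omega>)"
    by (intro E_difference_small E_L2 y m f)
  finally show ?thesis using 1 2 by linarith
qed

lemma approximable_commute:
  assumes x: "x \<in> \<Lambda>" "approximable x" and y: "y \<in> \<Lambda>" "approximable y" and f: "f \<in> H1"
  shows "E x (E y f) \<simeq> E y (E x f)"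
proof -
  have f2: "f \<in> L2_space M" using f by (rule H1_L2)
  have Ex: "E x f \<in> H1" and Ey: "E y f \<in> H1" using approximable_H1 x y f by auto
  have L: "E x (E y f) \<in> L2_space M" "E y (E x f) \<in> L2_space M" by (intro E_L2 x y f2)+
  have "(\<lambda>\<omega>. E x (E y f) \<omega> - E y (E x f) \<omega>) \<simeq> (\<lambda>_. 0)"
  proof (rule l2_small_zero[OF L2_diff[OF L]])
    fix e :: real assume "0 < e"
    then have e: "0 < e / 4" by simp
    obtain a where a: "a \<in> B" "\<And>g. g \<in> {f, E y f} \<Longrightarrow> l2 (\<lambda>\<omega>. E x g \<omega> - E a g \<omega>) < e / 4"
      using approximableE[OF x(2) _ _ e, of "{f, E y f}"] f Ey by blast
    obtain b where b: "b \<in> B" "\<And>g. g \<in> {f, E x f} \<Longrightarrow> l2 (\<lambda>\<omega>. E y g \<omega> - E b g \<omega>) < e / 4"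
      using approximableE[OF y(2) _ _ e, of "{f, E x f}"] f Ex by blast
    have "l2 (\<lambda>\<omega>. E x (E y f) \<omega> - E (a \<inter> b) f \<omega>) < 2 * (e / 4)"
      by (rule composition_approx[OF x(1) y(1) a(1) b(1) f2 a(2) b(2)]) auto
    moreover have "l2 (\<lambda>\<omega>. E y (E x f) \<omega> - E (b \<inter> a) f \<omega>) < 2 * (e / 4)"
      by (rule composition_approx[OF y(1) x(1) b(1) a(1) f2 b(2) a(2)]) auto
    moreover have "l2 (\<lambda>\<omega>. E x (E y f) \<omega> - E y (E x f) \<omega>)
        \<le> l2 (\<lambda>\<omega>. E x (E y f) \<omega> - E (a \<inter> b) f \<omega>) + l2 (\<lambda>\<omega>. E (a \<inter> b) f \<omega> - E y (E x f) \<omega>)"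
      by (intro l2_triangle_diff L E_L2 B_mem B_Int a b f2)
    ultimately show "l2 (\<lambda>\<omega>. E x (E y f) \<omega> - E y (E x f) \<omega>) \<le> e"
      using l2_minus_commute[of "E (a \<inter> b) f" "E y (E x f)"] by (simp add: Int_commute)
  qed
  then show ?thesis by eventually_elim simp
qed

subsection \<open>Independence in the limit\<close>

text \<open>
  The events that are limits of events of \<open>g b\<close> when \<open>b \<in> B\<close> tends to \<open>x\<close>. They form a \<open>\<sigma>\<close>-field;
  for \<open>g b = b\<close> and \<open>g b = c b\<close> the two \<open>\<sigma>\<close>-fields inherit the independence of \<open>b\<close> and \<open>c b\<close>,
  provided that \<open>x\<close> can be approximated at all.
\<close>

definition limit_events :: "'a set set \<Rightarrow> ('a set set \<Rightarrow> 'a set set) \<Rightarrow> 'a set set" where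
  "limit_events x g = {A \<in> sets M. \<forall>\<eta>>0. \<exists>F \<epsilon>. finite F \<and> F \<subseteq> H1 \<and> 0 < \<epsilon> \<and>
     (\<forall>b\<in>near x F \<epsilon>. \<exists>A'\<in>g b. prob (sym_diff A A') < \<eta>)}"

lemma limit_eventsI:
  assumes "A \<in> sets M"
    "\<And>\<eta>. 0 < \<eta> \<Longrightarrow> \<exists>F \<epsilon>. finite F \<and> F \<subseteq> H1 \<and> 0 < \<epsilon> \<and> (\<forall>b\<in>near x F \<epsilon>. \<exists>A'\<in>g b. prob (sym_diff A A') < \<eta>)"
  shows "A \<in> limit_events x g"
  using assms by (simp add: limit_events_def)

lemma limit_eventsE:
  assumes "A \<in> limit_events x g" "0 < \<eta>"
  obtains F \<epsilon> where "finite F" "F \<subseteq> H1" "0 < \<epsilon>" "\<And>b. b \<in> near x F \<epsilon> \<Longrightarrow> \<exists>A'\<in>g b. prob (sym_diff A A') < \<eta>"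
proof -
  have "\<exists>F \<epsilon>. finite F \<and> F \<subseteq> H1 \<and> 0 < \<epsilon> \<and> (\<forall>b\<in>near x F \<epsilon>. \<exists>A'\<in>g b. prob (sym_diff A A') < \<eta>)"
    using assms by (simp add: limit_events_def)
  then show ?thesis by (elim exE conjE) (rule that; (assumption | erule (1) bspec))
qed

lemma limit_events_ev: "A \<in> limit_events x g \<Longrightarrow> A \<in> sets M"
  by (simp add: limit_events_def)

lemma near_mono: "F \<subseteq> F' \<Longrightarrow> \<epsilon>' \<le> \<epsilon> \<Longrightarrow> near x F' \<epsilon>' \<subseteq> near x F \<epsilon>"
  unfolding near_def by fastforce

lemma limit_events_Un:
  assumes g: "\<And>b. b \<in> B \<Longrightarrow> g b \<in> \<Lambda>"
    and A: "A \<in> limit_events x g" and C: "C \<in> limit_events x g"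
  shows "A \<union> C \<in> limit_events x g"
proof (rule limit_eventsI)
  show "A \<union> C \<in> sets M" using limit_events_ev[OF A] limit_events_ev[OF C] by (rule sets.Un)
  fix \<eta> :: real assume "0 < \<eta>"
  then have \<eta>: "0 < \<eta> / 2" by simp
  obtain F \<epsilon> where F: "finite F" "F \<subseteq> H1" "0 < \<epsilon>"
      "\<And>b. b \<in> near x F \<epsilon> \<Longrightarrow> \<exists>A'\<in>g b. prob (sym_diff A A') < \<eta> / 2"
    by (rule limit_eventsE[OF A \<eta>]) blast
  obtain F' \<epsilon>' where F': "finite F'" "F' \<subseteq> H1" "0 < \<epsilon>'"
      "\<And>b. b \<in> near x F' \<epsilon>' \<Longrightarrow> \<exists>C'\<in>g b. prob (sym_diff C C') < \<eta> / 2"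
    by (rule limit_eventsE[OF C \<eta>]) blast
  show "\<exists>F \<epsilon>. finite F \<and> F \<subseteq> H1 \<and> 0 < \<epsilon> \<and> (\<forall>b\<in>near x F \<epsilon>. \<exists>D\<in>g b. prob (sym_diff (A \<union> C) D) < \<eta>)"
  proof (intro exI conjI ballI)
    show "finite (F \<union> F')" "F \<union> F' \<subseteq> H1" "0 < min \<epsilon> \<epsilon>'" using F F' by auto
    fix b assume b: "b \<in> near x (F \<union> F') (min \<epsilon> \<epsilon>')"
    then have bB: "b \<in> B" by (simp add: near_def)
    have "b \<in> near x F \<epsilon>" "b \<in> near x F' \<epsilon>'"
      using b near_mono[of F "F \<union> F'" "min \<epsilon> \<epsilon>'" \<epsilon>] near_mono[of F' "F \<union> F'" "min \<epsilon> \<epsilon>'" \<epsilon>'] by auto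
    then obtain A' C' where A': "A' \<in> g b" "prob (sym_diff A A') < \<eta> / 2"
      and C': "C' \<in> g b" "prob (sym_diff C C') < \<eta> / 2"
      using F(4) F'(4) by blast
    interpret s: sigma_algebra "space M" "g b" using g[OF bB] by (simp add: sub_sigma_fields_def)
    have ev: "A \<in> sets M" "C \<in> sets M" "A' \<in> sets M" "C' \<in> sets M"
      using limit_events_ev A C A' C' sigma_field_le_events[OF g[OF bB]] by auto
    have "prob (sym_diff (A \<union> C) (A' \<union> C')) \<le> prob (sym_diff A A' \<union> sym_diff C C')"
      using ev by (intro finite_measure_mono) auto
    also have "\<dots> \<le> prob (sym_diff A A') + prob (sym_diff C C')"
      using ev by (intro measure_Un_le) auto
    finally have "prob (sym_diff (A \<union> C) (A' \<union> C')) < \<eta>" using A' C' by simp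
    moreover have "A' \<union> C' \<in> g b" using A'(1) C'(1) by (rule s.Un)
    ultimately show "\<exists>D\<in>g b. prob (sym_diff (A \<union> C) D) < \<eta>" by (rule bexI)
  qed
qed

lemma limit_events_mem:
  assumes g: "\<And>b. b \<in> B \<Longrightarrow> g b \<in> \<Lambda>"
  shows "limit_events x g \<in> \<Lambda>"
proof -
  have nearB: "b \<in> B" if "b \<in> near x F \<epsilon>" for b F \<epsilon> using that by (simp add: near_def)
  have alg: "sigma_algebra (space M) (g b)" if "b \<in> B" for b
    using g[OF that] by (simp add: sub_sigma_fields_def)
  have null: "A \<in> limit_events x g" if A: "A \<in> null_sets M" for A
  proof (rule limit_eventsI)
    show "A \<in> sets M" using A by auto
    fix \<eta> :: real assume \<eta>: "0 < \<eta>"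
    have "prob A < \<eta>" using A \<eta> by (simp add: measure_eq_0_null_sets)
    moreover have "{} \<in> g b" if "b \<in> near x {} 1" for b
      using alg[OF nearB[OF that]] by (simp add: sigma_algebra_iff2)
    ultimately show "\<exists>F \<epsilon>. finite F \<and> F \<subseteq> H1 \<and> 0 < \<epsilon> \<and> (\<forall>b\<in>near x F \<epsilon>. \<exists>A'\<in>g b. prob (sym_diff A A') < \<eta>)"
      by (intro exI[of _ "{}"] exI[of _ "1::real"] conjI ballI bexI[of _ "{}"]) auto
  qed
  have compl: "space M - A \<in> limit_events x g" if A: "A \<in> limit_events x g" for A
  proof (rule limit_eventsI)
    show "space M - A \<in> sets M" using limit_events_ev[OF A] by (rule sets.compl_sets)
    fix \<eta> :: real assume \<eta>: "0 < \<eta>"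
    obtain F \<epsilon> where F: "finite F" "F \<subseteq> H1" "0 < \<epsilon>"
      "\<And>b. b \<in> near x F \<epsilon> \<Longrightarrow> \<exists>A'\<in>g b. prob (sym_diff A A') < \<eta>"
      by (rule limit_eventsE[OF A \<eta>]) blast
    show "\<exists>F \<epsilon>. finite F \<and> F \<subseteq> H1 \<and> 0 < \<epsilon> \<and> (\<forall>b\<in>near x F \<epsilon>. \<exists>A'\<in>g b. prob (sym_diff (space M - A) A') < \<eta>)"
    proof (intro exI conjI ballI)
      fix b assume b: "b \<in> near x F \<epsilon>"
      then obtain A' where A': "A' \<in> g b" "prob (sym_diff A A') < \<eta>" using F(4) by blast
      interpret s: sigma_algebra "space M" "g b" by (rule alg[OF nearB[OF b]])
      have "sym_diff (space M - A) (space M - A') = sym_diff A A'"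
        using s.sets_into_space[OF A'(1)] sets.sets_into_space[OF limit_events_ev[OF A]] by auto
      then show "\<exists>A'\<in>g b. prob (sym_diff (space M - A) A') < \<eta>"
        using A' by (intro bexI[of _ "space M - A'"] s.compl_sets) auto
    qed (use F in auto)
  qed
  have union: "(\<Union>i. A i) \<in> limit_events x g" if A: "range A \<subseteq> limit_events x g" for A :: "nat \<Rightarrow> 'a set"
  proof (rule limit_eventsI)
    have AM: "A i \<in> sets M" for i using A limit_events_ev[of "A i"] by auto
    show UM: "(\<Union>i. A i) \<in> sets M" using AM by auto
    have fin: "(\<Union>i<n. A i) \<in> limit_events x g" for n
    proof (induction n)
      case 0
      show ?case using null[of "{}"] by simp
    next
      case (Suc n)
      have "A n \<in> limit_events x g" using A by auto
      then show ?case
        using limit_events_Un[OF g _ Suc.IH, of "A n"] by (simp add: lessThan_Suc)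
    qed
    fix \<eta> :: real assume "0 < \<eta>"
    then have \<eta>: "0 < \<eta> / 2" by simp
    have "incseq (\<lambda>n. \<Union>i<n. A i)"
      by (intro incseq_SucI UN_mono) auto
    then have "(\<lambda>n. prob (\<Union>i<n. A i)) \<longlonglongrightarrow> prob (\<Union>n. \<Union>i<n. A i)"
      using AM by (intro finite_Lim_measure_incseq) auto
    moreover have "(\<Union>n. \<Union>i<n. A i) = (\<Union>i. A i)" by auto
    ultimately have "(\<lambda>n. prob (\<Union>i<n. A i)) \<longlonglongrightarrow> prob (\<Union>i. A i)" by simp
    then have "\<forall>\<^sub>F n in sequentially. prob (\<Union>i. A i) - \<eta> / 2 < prob (\<Union>i<n. A i)"
      using \<eta> by (intro order_tendstoD) auto
    then obtain n where n: "prob (\<Union>i. A i) - \<eta> / 2 < prob (\<Union>i<n. A i)"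
      by (auto simp: eventually_sequentially)
    let ?A = "\<Union>i<n. A i"
    have An: "?A \<in> sets M" using AM by auto
    have small: "prob ((\<Union>i. A i) - ?A) < \<eta> / 2"
    proof -
      have "?A \<subseteq> (\<Union>i. A i)" by blast
      then show ?thesis using n finite_measure_Diff[OF UM An] by linarith
    qed
    obtain F \<epsilon> where F: "finite F" "F \<subseteq> H1" "0 < \<epsilon>"
      "\<And>b. b \<in> near x F \<epsilon> \<Longrightarrow> \<exists>A'\<in>g b. prob (sym_diff ?A A') < \<eta> / 2"
      by (rule limit_eventsE[OF fin[of n] \<eta>]) blast
    show "\<exists>F \<epsilon>. finite F \<and> F \<subseteq> H1 \<and> 0 < \<epsilon> \<and> (\<forall>b\<in>near x F \<epsilon>. \<exists>A'\<in>g b. prob (sym_diff (\<Union>i. A i) A') < \<eta>)"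
    proof (intro exI conjI ballI)
      fix b assume b: "b \<in> near x F \<epsilon>"
      then obtain A' where A': "A' \<in> g b" "prob (sym_diff ?A A') < \<eta> / 2" using F(4) by blast
      have A'M: "A' \<in> sets M" using A'(1) sigma_field_le_events[OF g[OF nearB[OF b]]] by auto
      have "prob (sym_diff (\<Union>i. A i) A') \<le> prob (((\<Union>i. A i) - ?A) \<union> sym_diff ?A A')"
        using UM An A'M by (intro finite_measure_mono) auto
      also have "\<dots> \<le> prob ((\<Union>i. A i) - ?A) + prob (sym_diff ?A A')"
        using UM An A'M by (intro measure_Un_le) auto
      finally have "prob (sym_diff (\<Union>i. A i) A') < \<eta>" using small A'(2) by simp
      then show "\<exists>A'\<in>g b. prob (sym_diff (\<Union>i. A i) A') < \<eta>" using A'(1) by (rule bexI)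
    qed (use F in auto)
  qed
  have "sigma_algebra (space M) (limit_events x g)"
    unfolding sigma_algebra_iff2
  proof (intro conjI ballI allI impI)
    show "limit_events x g \<subseteq> Pow (space M)"
      using limit_events_ev sets.sets_into_space by blast
    show "{} \<in> limit_events x g" by (rule null) simp
  qed (simp_all add: compl union)
  then show ?thesis
    using null limit_events_ev by (auto simp: sub_sigma_fields_def)
qed

text \<open>
  If \<open>X\<close> is the limit of \<open>g b\<close>-measurable functions \<open>Y b\<close>, then the events \<open>X > t\<close> are limit
  events. Convergence in probability might fail for the events \<open>Y b > t\<close> when \<open>X\<close> takes the value
  \<open>t\<close> with positive probability, so the threshold is raised by \<open>d / 2\<close>, where \<open>d\<close> is so small that
  \<open>X\<close> is unlikely to lie in \<open>(t, t + d]\<close>.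
\<close>

lemma limit_events_greater:
  assumes g: "\<And>b. b \<in> B \<Longrightarrow> g b \<in> \<Lambda>" and h: "h \<in> H1" and X: "X \<in> L2_space M"
    and Y: "\<And>b. b \<in> B \<Longrightarrow> Y b \<in> L2_of (g b)"
    and close: "\<And>b. b \<in> B \<Longrightarrow> l2 (\<lambda>\<omega>. X \<omega> - Y b \<omega>) \<le> l2 (\<lambda>\<omega>. E x h \<omega> - E b h \<omega>)"
  shows "{\<omega> \<in> space M. t < X \<omega>} \<in> limit_events x g"
proof (rule limit_eventsI)
  have [measurable]: "X \<in> borel_measurable M" using X by (rule L2_measurable)
  let ?A = "{\<omega> \<in> space M. t < X \<omega>}"
  show AM: "?A \<in> sets M" by measurable
  fix \<eta> :: real assume "0 < \<eta>"
  then have \<eta>: "0 < \<eta> / 2" by simp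
  let ?S = "\<lambda>n::nat. {\<omega> \<in> space M. t < X \<omega> \<and> X \<omega> \<le> t + 1 / real (Suc n)}"
  have "(\<lambda>n. prob (?S n)) \<longlonglongrightarrow> prob (\<Inter>n. ?S n)"
  proof (rule finite_Lim_measure_decseq)
    show "range ?S \<subseteq> sets M" by auto
    show "decseq ?S"
    proof (intro decseq_SucI subsetI)
      fix n \<omega> assume "\<omega> \<in> ?S (Suc n)"
      moreover have "1 / real (Suc (Suc n)) \<le> 1 / real (Suc n)" by (intro divide_left_mono) auto
      ultimately show "\<omega> \<in> ?S n" by auto
    qed
  qed
  moreover have "(\<Inter>n. ?S n) = {}"
  proof (rule equals0I)
    fix \<omega> assume \<omega>: "\<omega> \<in> (\<Inter>n. ?S n)"
    then have "0 < X \<omega> - t" by auto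
    then obtain n where "1 / real (Suc n) < X \<omega> - t"
      using nat_approx_posE by blast
    moreover have "X \<omega> \<le> t + 1 / real (Suc n)" using \<omega> by auto
    ultimately show False by simp
  qed
  ultimately have "(\<lambda>n. prob (?S n)) \<longlonglongrightarrow> 0" by simp
  then have "\<forall>\<^sub>F n in sequentially. prob (?S n) < \<eta> / 2"
    using \<eta> by (rule order_tendstoD)
  then obtain n where n: "prob (?S n) < \<eta> / 2" by (auto simp: eventually_sequentially)
  define d where "d = 1 / real (Suc n)"
  have d: "0 < d" by (simp add: d_def)
  define \<epsilon> where "\<epsilon> = sqrt (\<eta> / 2) * (d / 2)"
  have \<epsilon>: "0 < \<epsilon>" using \<eta> d by (simp add: \<epsilon>_def)
  show "\<exists>F \<epsilon>. finite F \<and> F \<subseteq> H1 \<and> 0 < \<epsilon> \<and> (\<forall>b\<in>near x F \<epsilon>. \<exists>A'\<in>g b. prob (sym_diff ?A A') < \<eta>)"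
  proof (intro exI conjI ballI)
    show "finite {h}" "{h} \<subseteq> H1" "0 < \<epsilon>" using h \<epsilon> by auto
    fix b assume b: "b \<in> near x {h} \<epsilon>"
    then have bB: "b \<in> B" and hb: "l2 (\<lambda>\<omega>. E x h \<omega> - E b h \<omega>) < \<epsilon>" by (simp_all add: near_def)
    have Yb: "Y b \<in> L2_space M" "Y b \<in> mble (g b)" using Y[OF bB] by (rule IntD1, rule IntD2)
    have [measurable]: "Y b \<in> borel_measurable M" using Yb(1) by (rule L2_measurable)
    let ?Z = "\<lambda>\<omega>. X \<omega> - Y b \<omega>"
    have Z: "?Z \<in> L2_space M" using X Yb(1) by (rule L2_diff)
    let ?D = "{\<omega> \<in> space M. d / 2 \<le> \<bar>?Z \<omega>\<bar>}"
    have "l2 ?Z < \<epsilon>" using close[OF bB] hb by simp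
    then have "(l2 ?Z)\<^sup>2 < \<epsilon>\<^sup>2" by (intro power_strict_mono) auto
    then have "(l2 ?Z)\<^sup>2 / (d/2)\<^sup>2 < \<epsilon>\<^sup>2 / (d/2)\<^sup>2"
      using d by (intro divide_strict_right_mono) auto
    also have "\<epsilon>\<^sup>2 = (\<eta> / 2) * (d/2)\<^sup>2"
      unfolding \<epsilon>_def power_mult_distrib using \<eta> by simp
    also have "(\<eta> / 2) * (d/2)\<^sup>2 / (d/2)\<^sup>2 = \<eta> / 2"
      using d by simp
    finally have D: "prob ?D < \<eta> / 2"
      using prob_large_le[OF Z, of "d/2"] d by linarith
    let ?A' = "{\<omega> \<in> space M. t + d / 2 < Y b \<omega>}"
    have A': "?A' \<in> g b" by (rule mble_greater[OF g[OF bB] Yb(2)])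
    have A'M: "?A' \<in> sets M" by measurable
    have DM: "?D \<in> sets M" "?S n \<in> sets M" by measurable
    have sub: "sym_diff ?A ?A' \<subseteq> ?S n \<union> ?D"
    proof
      fix \<omega> assume "\<omega> \<in> sym_diff ?A ?A'"
      then have \<omega>: "\<omega> \<in> space M" "(t < X \<omega> \<and> Y b \<omega> \<le> t + d / 2) \<or> (X \<omega> \<le> t \<and> t + d / 2 < Y b \<omega>)"
        by auto
      then show "\<omega> \<in> ?S n \<union> ?D"
        using d unfolding d_def[symmetric] by (cases "X \<omega> \<le> t + d") auto
    qed
    have "prob (sym_diff ?A ?A') \<le> prob (?S n \<union> ?D)"
      using sub DM by (intro finite_measure_mono) auto
    also have "\<dots> \<le> prob (?S n) + prob ?D"
      using DM by (intro measure_Un_le)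
    finally have "prob (sym_diff ?A ?A') < \<eta>" using n D by linarith
    then show "\<exists>A'\<in>g b. prob (sym_diff ?A A') < \<eta>" using A' by (rule bexI)
  qed
qed

lemma limit_events_indep:
  assumes x: "approximable x" and A: "A \<in> limit_events x (\<lambda>b. b)" and C: "C \<in> limit_events x c"
  shows "prob (A \<inter> C) = prob A * prob C"
proof -
  have AM: "A \<in> sets M" "C \<in> sets M" using A C by (auto dest: limit_events_ev)
  have bound: "\<bar>prob (A \<inter> C) - prob A * prob C\<bar> \<le> e" if "0 < e" for e
  proof -
    have \<eta>: "0 < e / 4" using that by simp
    obtain F \<epsilon> where F: "finite F" "F \<subseteq> H1" "0 < \<epsilon>"
        "\<And>b. b \<in> near x F \<epsilon> \<Longrightarrow> \<exists>A'\<in>b. prob (sym_diff A A') < e / 4"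
      by (rule limit_eventsE[OF A \<eta>]) blast
    obtain F' \<epsilon>' where F': "finite F'" "F' \<subseteq> H1" "0 < \<epsilon>'"
        "\<And>b. b \<in> near x F' \<epsilon>' \<Longrightarrow> \<exists>C'\<in>c b. prob (sym_diff C C') < e / 4"
      by (rule limit_eventsE[OF C \<eta>]) blast
    have "near x (F \<union> F') (min \<epsilon> \<epsilon>') \<noteq> {}"
      using x F F' unfolding approximable_def by simp
    then obtain b where b: "b \<in> near x (F \<union> F') (min \<epsilon> \<epsilon>')" by blast
    then have bB: "b \<in> B" by (simp add: near_def)
    have "b \<in> near x F \<epsilon>" "b \<in> near x F' \<epsilon>'"
      using b near_mono[of F "F \<union> F'" "min \<epsilon> \<epsilon>'" \<epsilon>] near_mono[of F' "F \<union> F'" "min \<epsilon> \<epsilon>'" \<epsilon>'] by auto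
    then obtain A' C' where A': "A' \<in> b" "prob (sym_diff A A') < e / 4"
      and C': "C' \<in> c b" "prob (sym_diff C C') < e / 4"
      using F(4) F'(4) by blast
    have M': "A' \<in> sets M" "C' \<in> sets M"
      using A'(1) C'(1) sigma_field_le_events[OF B_mem[OF bB]] sigma_field_le_events[OF c_mem'[OF bB]] by auto
    have ind: "prob (A' \<inter> C') = prob A' * prob C'"
      by (rule indep_setD[OF B_indep[OF bB] A'(1) C'(1)])
    have "\<bar>prob (A \<inter> C) - prob (A' \<inter> C')\<bar> \<le> prob (sym_diff (A \<inter> C) (A' \<inter> C'))"
      using AM M' by (intro prob_symdiff) auto
    also have "\<dots> \<le> prob (sym_diff A A' \<union> sym_diff C C')"
      using AM M' by (intro finite_measure_mono) auto
    also have "\<dots> \<le> prob (sym_diff A A') + prob (sym_diff C C')"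
      using AM M' by (intro measure_Un_le) auto
    finally have 1: "\<bar>prob (A \<inter> C) - prob A' * prob C'\<bar> \<le> e / 2"
      using A'(2) C'(2) ind by simp
    have dA: "\<bar>prob A' - prob A\<bar> \<le> e / 4" and dC: "\<bar>prob C' - prob C\<bar> \<le> e / 4"
      using prob_symdiff[OF AM(1) M'(1)] prob_symdiff[OF AM(2) M'(2)] A'(2) C'(2) by linarith+
    have "prob A' * prob C' - prob A * prob C = (prob A' - prob A) * prob C' + prob A * (prob C' - prob C)"
      by (simp add: algebra_simps)
    then have "\<bar>prob A' * prob C' - prob A * prob C\<bar> \<le> \<bar>prob A' - prob A\<bar> * prob C' + prob A * \<bar>prob C' - prob C\<bar>"
      by (metis abs_mult abs_of_nonneg abs_triangle_ineq measure_nonneg)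
    also have "\<dots> \<le> (e / 4) * 1 + 1 * (e / 4)"
      using dA dC \<eta> by (intro add_mono mult_mono prob_le_1) auto
    finally show ?thesis using 1 by linarith
  qed
  have "\<bar>prob (A \<inter> C) - prob A * prob C\<bar> \<le> 0"
    by (rule field_le_epsilon, unfold add_0, rule bound)
  then show ?thesis by simp
qed

end

context noise
begin

text \<open>
  The second condition, that the image of the first chaos generates \<open>x\<close>, makes \<open>x\<close> determined by
  its action on the first chaos.
\<close>

definition completion :: "'a set set set" where
  "completion = {x \<in> \<Lambda>. approximable x \<and> x \<subseteq> gen (E x ` H1)}"

text \<open>
  The complement of \<open>x\<close> in the completion, generated by what the conditional expectation on \<open>x\<close>
  annihilates in the first chaos.
\<close>

definition star :: "'a set set \<Rightarrow> 'a set set" where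
  "star x = gen ((\<lambda>f \<omega>. f \<omega> - E x f \<omega>) ` H1)"

lemma completion_mem: "x \<in> completion \<Longrightarrow> x \<in> \<Lambda>"
  and completion_approx: "x \<in> completion \<Longrightarrow> approximable x"
  and completion_gen: "x \<in> completion \<Longrightarrow> x \<subseteq> gen (E x ` H1)"
  by (simp_all add: completion_def)

lemma E_image_L2: "x \<in> \<Lambda> \<Longrightarrow> E x ` H1 \<subseteq> L2_space M"
  using E_L2 H1_L2 by blast

lemma residue_image_L2: "x \<in> \<Lambda> \<Longrightarrow> (\<lambda>f \<omega>. f \<omega> - E x f \<omega>) ` H1 \<subseteq> L2_space M"
  using L2_diff[OF H1_L2 E_L2[OF _ H1_L2]] by blast

lemma star_mem: "x \<in> \<Lambda> \<Longrightarrow> star x \<in> \<Lambda>"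
  unfolding star_def by (rule gen_mem[OF residue_image_L2])

lemma star_mble: "x \<in> \<Lambda> \<Longrightarrow> f \<in> H1 \<Longrightarrow> (\<lambda>\<omega>. f \<omega> - E x f \<omega>) \<in> mble (star x)"
  unfolding star_def by (rule gen_mble[OF residue_image_L2]) (assumption, rule imageI)

lemma star_least:
  assumes "x \<in> \<Lambda>" "z \<in> \<Lambda>" "\<And>f. f \<in> H1 \<Longrightarrow> (\<lambda>\<omega>. f \<omega> - E x f \<omega>) \<in> mble z"
  shows "star x \<subseteq> z"
  unfolding star_def by (rule gen_least[OF residue_image_L2[OF assms(1)] assms(2)]) (use assms(3) in blast)

lemma le_of_mble:
  assumes x: "x \<in> completion" and z: "z \<in> \<Lambda>" and f: "\<And>f. f \<in> H1 \<Longrightarrow> E x f \<in> mble z"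
  shows "x \<subseteq> z"
proof -
  have "gen (E x ` H1) \<subseteq> z"
    by (rule gen_least[OF E_image_L2[OF completion_mem[OF x]] z]) (use f in blast)
  then show ?thesis using completion_gen[OF x] by (rule order_trans[rotated])
qed

lemma completionI:
  assumes "x \<in> \<Lambda>" "approximable x" "\<And>z. z \<in> \<Lambda> \<Longrightarrow> (\<And>f. f \<in> H1 \<Longrightarrow> E x f \<in> mble z) \<Longrightarrow> x \<subseteq> z"
  shows "x \<in> completion"
proof -
  note sub = E_image_L2[OF assms(1)]
  have "x \<subseteq> gen (E x ` H1)"
    by (rule assms(3)[OF gen_mem[OF sub]]) (rule gen_mble[OF sub imageI])
  then show ?thesis using assms unfolding completion_def by simp
qed

lemma completion_H1: "x \<in> completion \<Longrightarrow> f \<in> H1 \<Longrightarrow> E x f \<in> H1"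
  by (rule approximable_H1[OF completion_mem completion_approx])

lemma H1_diff:
  assumes "f \<in> H1" "g \<in> H1"
  shows "(\<lambda>\<omega>. f \<omega> - g \<omega>) \<in> H1"
proof (rule H1I[OF L2_diff[OF H1_L2[OF assms(1)] H1_L2[OF assms(2)]]])
  fix x assume x: "x \<in> B"
  note m = B_mem[OF x] c_mem'[OF x]
  note L = H1_L2[OF assms(1)] H1_L2[OF assms(2)]
  show "(\<lambda>\<omega>. f \<omega> - g \<omega>) \<simeq> (\<lambda>\<omega>. E x (\<lambda>\<omega>. f \<omega> - g \<omega>) \<omega> + E (c x) (\<lambda>\<omega>. f \<omega> - g \<omega>) \<omega>)"
    using E_diff[OF m(1) L] E_diff[OF m(2) L] H1_split[OF assms(1) x] H1_split[OF assms(2) x]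
    by eventually_elim simp
qed

lemma H1_mean:
  assumes f: "f \<in> H1"
  shows "(\<integral>\<omega>. f \<omega> \<partial>M) = 0"
proof -
  have f2: "f \<in> L2_space M" using f by (rule H1_L2)
  have "E (sf_top M) f \<simeq> f"
    using L2_measurable[OF f2] sigma_field_sets[OF sf_top_mem] f2
    by (intro E_id sf_top_mem) (simp add: measurable_def sf_top_def)
  then have "(\<lambda>_. \<integral>\<omega>. f \<omega> \<partial>M) \<simeq> (\<lambda>_. 0)"
    using H1_split[OF f B_top] E_bot[OF f2] unfolding c_top by eventually_elim simp
  then show ?thesis by (simp add: AE_const prob_space)
qed

lemma B_residue:
  assumes b: "b \<in> B" and f: "f \<in> H1"
  shows "E (c b) f \<simeq> (\<lambda>\<omega>. f \<omega> - E b f \<omega>)"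
  using H1_split[OF f b] by eventually_elim simp

lemma star_indep:
  assumes x: "x \<in> completion"
  shows "indep_set x (star x)"
proof (rule indep_setI)
  note xm = completion_mem[OF x]
  show "x \<subseteq> events" "star x \<subseteq> events"
    by (intro sigma_field_le_events xm star_mem)+
  have LE: "limit_events x (\<lambda>b. b) \<in> \<Lambda>" "limit_events x c \<in> \<Lambda>"
    by (intro limit_events_mem B_mem c_mem'; assumption)+
  have "x \<subseteq> limit_events x (\<lambda>b. b)"
  proof (rule le_of_mble[OF x LE(1)], rule mbleI[OF LE(1)])
    fix f t assume f: "f \<in> H1"
    show "{\<omega> \<in> space M. t < E x f \<omega>} \<in> limit_events x (\<lambda>b. b)"
      by (rule limit_events_greater[OF B_mem f E_L2[OF xm H1_L2[OF f]], where Y = "\<lambda>b. E b f"])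
        (assumption, rule E_L2_of[OF B_mem H1_L2[OF f]], assumption, rule order_refl)
  qed
  moreover have "star x \<subseteq> limit_events x c"
  proof (rule star_least[OF xm LE(2)], rule mbleI[OF LE(2)])
    fix f t assume f: "f \<in> H1"
    note f2 = H1_L2[OF f]
    show "{\<omega> \<in> space M. t < f \<omega> - E x f \<omega>} \<in> limit_events x c"
    proof (rule limit_events_greater[OF c_mem' f, where Y = "\<lambda>b. E (c b) f"])
      show R: "(\<lambda>\<omega>. f \<omega> - E x f \<omega>) \<in> L2_space M" by (intro L2_diff E_L2 xm f2)
      fix b assume b: "b \<in> B"
      note m = B_mem[OF b] c_mem'[OF b]
      show "E (c b) f \<in> L2_of (c b)" by (rule E_L2_of[OF m(2) f2])
      have "l2 (\<lambda>\<omega>. f \<omega> - E x f \<omega> - E (c b) f \<omega>) = l2 (\<lambda>\<omega>. E b f \<omega> - E x f \<omega>)"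
        using B_residue[OF b f]
        by (intro l2_cong L2_diff E_L2 xm m f2) (auto elim!: eventually_mono)
      then show "l2 (\<lambda>\<omega>. f \<omega> - E x f \<omega> - E (c b) f \<omega>) \<le> l2 (\<lambda>\<omega>. E x f \<omega> - E b f \<omega>)"
        using l2_minus_commute[of "E x f" "E b f"] by simp
    qed
  qed
  ultimately show "prob (A \<inter> C) = prob A * prob C" if "A \<in> x" "C \<in> star x" for A C
    using limit_events_indep[OF completion_approx[OF x]] that by blast
qed

lemma E_star:
  assumes x: "x \<in> completion" and f: "f \<in> H1"
  shows "E (star x) f \<simeq> (\<lambda>\<omega>. f \<omega> - E x f \<omega>)"
proof -
  note xm = completion_mem[OF x] and f2 = H1_L2[OF f]
  note sm = star_mem[OF xm]
  have Ex: "E x f \<in> L2_space M" by (rule E_L2[OF xm f2])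
  have "E (star x) (\<lambda>\<omega>. f \<omega> - E x f \<omega>) \<simeq> (\<lambda>\<omega>. f \<omega> - E x f \<omega>)"
    by (intro E_id sm IntI L2_diff f2 Ex star_mble xm f)
  moreover have "E (star x) (\<lambda>\<omega>. f \<omega> - E x f \<omega>) \<simeq> (\<lambda>\<omega>. E (star x) f \<omega> - E (star x) (E x f) \<omega>)"
    by (rule E_diff[OF sm f2 Ex])
  moreover have "E (star x) (E x f) \<simeq> (\<lambda>_. \<integral>\<omega>. E x f \<omega> \<partial>M)"
    by (rule E_indep[OF xm sm star_indep[OF x] E_L2_of[OF xm f2]])
  ultimately show ?thesis
    unfolding H1_mean[OF completion_H1[OF x f]] by eventually_elim simp
qed

lemma star_completion:
  assumes x: "x \<in> completion"
  shows "star x \<in> completion"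
proof (rule completionI)
  note xm = completion_mem[OF x]
  show sm: "star x \<in> \<Lambda>" by (rule star_mem[OF xm])
  show "approximable (star x)"
  proof (rule approximableI)
    fix F and \<epsilon> :: real assume F: "finite F" "F \<subseteq> H1" "0 < \<epsilon>"
    obtain b where b: "b \<in> B" "\<And>f. f \<in> F \<Longrightarrow> l2 (\<lambda>\<omega>. E x f \<omega> - E b f \<omega>) < \<epsilon>"
      using approximableE[OF completion_approx[OF x] F] by blast
    note m = B_mem[OF b(1)] c_mem'[OF b(1)]
    show "\<exists>b\<in>B. \<forall>f\<in>F. l2 (\<lambda>\<omega>. E (star x) f \<omega> - E b f \<omega>) < \<epsilon>"
    proof (intro bexI[of _ "c b"] ballI c_mem b(1))
      fix f assume fF: "f \<in> F"
      then have f: "f \<in> H1" using F(2) by blast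
      note f2 = H1_L2[OF f]
      have "l2 (\<lambda>\<omega>. E (star x) f \<omega> - E (c b) f \<omega>) = l2 (\<lambda>\<omega>. E b f \<omega> - E x f \<omega>)"
        using E_star[OF x f] B_residue[OF b(1) f]
        by (intro l2_cong L2_diff E_L2 sm xm m f2) (auto elim!: eventually_elim2)
      then show "l2 (\<lambda>\<omega>. E (star x) f \<omega> - E (c b) f \<omega>) < \<epsilon>"
        using b(2)[OF fF] l2_minus_commute[of "E x f" "E b f"] by simp
    qed
  qed
  fix z assume z: "z \<in> \<Lambda>" and Ez: "\<And>f. f \<in> H1 \<Longrightarrow> E (star x) f \<in> mble z"
  show "star x \<subseteq> z"
  proof (rule star_least[OF xm z])
    fix f assume f: "f \<in> H1"
    show "(\<lambda>\<omega>. f \<omega> - E x f \<omega>) \<in> mble z"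
      by (rule mble_cong[OF z Ez[OF f] _ E_star[OF x f]])
        (intro borel_measurable_diff L2_measurable H1_L2 f E_borel)
  qed
qed

lemma star_star:
  assumes x: "x \<in> completion"
  shows "star (star x) = x"
proof
  note xm = completion_mem[OF x] and sm = star_mem[OF completion_mem[OF x]]
  have eq: "E x f \<simeq> (\<lambda>\<omega>. f \<omega> - E (star x) f \<omega>)" if "f \<in> H1" for f
    using E_star[OF x that] by eventually_elim simp
  show "star (star x) \<subseteq> x"
  proof (rule star_least[OF sm xm])
    fix f assume f: "f \<in> H1"
    show "(\<lambda>\<omega>. f \<omega> - E (star x) f \<omega>) \<in> mble x"
      by (rule mble_cong[OF xm E_mble _ eq[OF f]])
        (intro borel_measurable_diff L2_measurable H1_L2 f E_borel)
  qed
  show "x \<subseteq> star (star x)"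
  proof (rule le_of_mble[OF x star_mem[OF sm]])
    fix f assume f: "f \<in> H1"
    have "(\<lambda>\<omega>. f \<omega> - E (star x) f \<omega>) \<simeq> E x f"
      using eq[OF f] by eventually_elim simp
    then show "E x f \<in> mble (star (star x))"
      by (rule mble_cong[OF star_mem[OF sm] star_mble[OF sm f] E_borel])
  qed
qed

lemma star_antimono:
  assumes m: "m \<in> completion" and v: "v \<in> completion" and le: "m \<subseteq> v"
  shows "star v \<subseteq> star m"
proof (rule star_least[OF completion_mem[OF v] star_mem[OF completion_mem[OF m]]])
  note mm = completion_mem[OF m] and vm = completion_mem[OF v]
  fix f assume f: "f \<in> H1"
  note f2 = H1_L2[OF f]
  let ?g = "\<lambda>\<omega>. f \<omega> - E v f \<omega>"
  have g: "?g \<in> H1" by (intro H1_diff f completion_H1 v)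
  have "E m ?g \<simeq> (\<lambda>\<omega>. E m f \<omega> - E m (E v f) \<omega>)"
    by (intro E_diff mm f2 E_L2 vm)
  moreover have "E m (E v f) \<simeq> E m f" by (rule E_tower[OF mm vm le f2])
  ultimately have "(\<lambda>\<omega>. ?g \<omega> - E m ?g \<omega>) \<simeq> ?g" by eventually_elim simp
  then show "?g \<in> mble (star m)"
    by (rule mble_cong[OF star_mem[OF mm] star_mble[OF mm g] L2_measurable[OF H1_L2[OF g]]])
qed

lemma completion_commute:
  "x \<in> completion \<Longrightarrow> y \<in> completion \<Longrightarrow> f \<in> H1 \<Longrightarrow> E x (E y f) \<simeq> E y (E x f)"
  by (intro approximable_commute completion_mem completion_approx)

text \<open>
  On the first chaos the product of commuting projections is again a conditional expectation: by
  commutation its values are measurable for both \<open>x\<close> and \<open>y\<close>.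
\<close>

lemma E_Int:
  assumes x: "x \<in> completion" and y: "y \<in> completion" and f: "f \<in> H1"
  shows "E x (E y f) \<simeq> E (x \<inter> y) f"
proof -
  note m = completion_mem[OF x] completion_mem[OF y] and f2 = H1_L2[OF f]
  have z: "x \<inter> y \<in> \<Lambda>" by (rule sf_Int[OF m])
  have L: "E y f \<in> L2_space M" "E x (E y f) \<in> L2_space M" by (intro E_L2 m f2)+
  have "E y (E x f) \<simeq> E x (E y f)" using completion_commute[OF y x f] .
  then have "E x (E y f) \<in> mble y"
    by (rule mble_cong[OF m(2) E_mble E_borel])
  then have "E (x \<inter> y) (E x (E y f)) \<simeq> E x (E y f)"
    by (intro E_id z IntI L mble_Int m E_mble)
  moreover have "E (x \<inter> y) (E x (E y f)) \<simeq> E (x \<inter> y) (E y f)"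
    by (intro E_tower z m L) auto
  moreover have "E (x \<inter> y) (E y f) \<simeq> E (x \<inter> y) f"
    by (intro E_tower z m f2) auto
  ultimately show ?thesis by eventually_elim simp
qed

text \<open>
  The point is that \<open>x \<inter> y\<close> is generated by the image of the first chaos. Up to an element
  measurable for \<open>star x\<close>, the generators \<open>E y f\<close> of \<open>y\<close> are measurable for \<open>z1 = z \<inter> x\<close> whenever
  that image is measurable for \<open>z\<close>, and the independence of \<open>x\<close> and \<open>star x\<close> removes that element
  on intersecting with \<open>x\<close>.
\<close>

lemma completion_Int:
  assumes x: "x \<in> completion" and y: "y \<in> completion"
  shows "x \<inter> y \<in> completion"
proof (rule completionI)
  note m = completion_mem[OF x] completion_mem[OF y]
  show z: "x \<inter> y \<in> \<Lambda>" by (rule sf_Int[OF m])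
  show "approximable (x \<inter> y)"
  proof (rule approximableI)
    fix F and \<epsilon> :: real assume F: "finite F" "F \<subseteq> H1" "0 < \<epsilon>"
    then have \<epsilon>: "0 < \<epsilon> / 2" by simp
    obtain b where b: "b \<in> B" "\<And>f. f \<in> F \<Longrightarrow> l2 (\<lambda>\<omega>. E y f \<omega> - E b f \<omega>) < \<epsilon> / 2"
      using approximableE[OF completion_approx[OF y] F(1,2) \<epsilon>] by blast
    have "finite (E y ` F)" "E y ` F \<subseteq> H1" using F completion_H1[OF y] by auto
    then obtain a where a: "a \<in> B" "\<And>g. g \<in> E y ` F \<Longrightarrow> l2 (\<lambda>\<omega>. E x g \<omega> - E a g \<omega>) < \<epsilon> / 2"
      using approximableE[OF completion_approx[OF x] _ _ \<epsilon>] by blast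
    show "\<exists>b\<in>B. \<forall>f\<in>F. l2 (\<lambda>\<omega>. E (x \<inter> y) f \<omega> - E b f \<omega>) < \<epsilon>"
    proof (intro bexI[of _ "a \<inter> b"] ballI B_Int a(1) b(1))
      fix f assume fF: "f \<in> F"
      then have f: "f \<in> H1" using F(2) by blast
      note f2 = H1_L2[OF f]
      have "l2 (\<lambda>\<omega>. E x (E y f) \<omega> - E (a \<inter> b) f \<omega>) < 2 * (\<epsilon> / 2)"
        by (rule composition_approx[OF m a(1) b(1) f2 a(2)[OF imageI[OF fF]] b(2)[OF fF]])
      moreover have "l2 (\<lambda>\<omega>. E (x \<inter> y) f \<omega> - E (a \<inter> b) f \<omega>) = l2 (\<lambda>\<omega>. E x (E y f) \<omega> - E (a \<inter> b) f \<omega>)"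
        using E_Int[OF x y f]
        by (intro l2_cong L2_diff E_L2 z m B_mem B_Int a(1) b(1) f2) (auto elim!: eventually_mono)
      ultimately show "l2 (\<lambda>\<omega>. E (x \<inter> y) f \<omega> - E (a \<inter> b) f \<omega>) < \<epsilon>" by simp
    qed
  qed
  fix z assume z': "z \<in> \<Lambda>" and Ez: "\<And>f. f \<in> H1 \<Longrightarrow> E (x \<inter> y) f \<in> mble z"
  define z1 where "z1 = z \<inter> x"
  have z1: "z1 \<in> \<Lambda>" "z1 \<subseteq> x" "z1 \<subseteq> z" unfolding z1_def by (auto intro: sf_Int z' m)
  note sm = star_mem[OF m(1)]
  have up: "z1 \<subseteq> J z1 (star x)" "star x \<subseteq> J z1 (star x)" by (rule sf_join_upper[OF z1(1) sm])+
  have Jm: "J z1 (star x) \<in> \<Lambda>" by (rule sf_join_mem[OF z1(1) sm])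
  have "y \<subseteq> J z1 (star x)"
  proof (rule le_of_mble[OF y Jm])
    fix f assume f: "f \<in> H1"
    have g: "E y f \<in> H1" by (rule completion_H1[OF y f])
    have "E (x \<inter> y) f \<in> mble x"
      by (rule mble_mono[OF z m(1) Int_lower1 E_mble])
    then have "E (x \<inter> y) f \<in> mble z1"
      unfolding z1_def by (intro mble_Int z' m Ez f)
    then have 1: "E (x \<inter> y) f \<in> mble (J z1 (star x))"
      by (rule mble_mono[OF z1(1) Jm up(1)])
    have 2: "(\<lambda>\<omega>. E y f \<omega> - E x (E y f) \<omega>) \<in> mble (J z1 (star x))"
      by (rule mble_mono[OF sm Jm up(2) star_mble[OF m(1) g]])
    have "(\<lambda>\<omega>. E (x \<inter> y) f \<omega> + (E y f \<omega> - E x (E y f) \<omega>)) \<simeq> E y f"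
      using E_Int[OF x y f] by eventually_elim simp
    then show "E y f \<in> mble (J z1 (star x))"
      by (rule mble_cong[OF Jm borel_measurable_add[OF 1 2] E_borel])
  qed
  then have "x \<inter> y \<subseteq> J x (sf_bot M) \<inter> J z1 (star x)"
    using sf_join_absorb[OF m(1) sf_bot_le[OF m(1)]] by auto
  also have "\<dots> = J z1 (sf_bot M)"
    by (rule join_Int_join[OF m(1) z1(1,2) sm sf_bot_mem sf_bot_le[OF sm] star_indep[OF x]])
  also have "\<dots> = z1"
    by (rule sf_join_absorb[OF z1(1) sf_bot_le[OF z1(1)]])
  finally show "x \<inter> y \<subseteq> z" using z1(3) by (rule order_trans)
qed

lemma star_Int_star:
  assumes x: "x \<in> completion" and y: "y \<in> completion"
  shows "star (star x \<inter> star y) = J x y"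
proof
  note m = completion_mem[OF x] completion_mem[OF y]
  let ?w = "star x \<inter> star y"
  have sx: "star x \<in> completion" and sy: "star y \<in> completion" by (intro star_completion x y)+
  have w: "?w \<in> completion" by (rule completion_Int[OF sx sy])
  note wm = completion_mem[OF w]
  have Jm: "J x y \<in> \<Lambda>" by (rule sf_join_mem[OF m])
  note up = sf_join_upper[OF m]
  show "star ?w \<subseteq> J x y"
  proof (rule star_least[OF wm Jm])
    fix f assume f: "f \<in> H1"
    note f2 = H1_L2[OF f]
    have g: "E (star y) f \<in> H1" by (rule completion_H1[OF sy f])
    have "E ?w f \<simeq> E (star x) (E (star y) f)"
      using E_Int[OF sx sy f] by eventually_elim simp
    moreover have "E (star x) (E (star y) f) \<simeq> (\<lambda>\<omega>. E (star y) f \<omega> - E x (E (star y) f) \<omega>)"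
      by (rule E_star[OF x g])
    moreover have "E (star y) f \<simeq> (\<lambda>\<omega>. f \<omega> - E y f \<omega>)"
      by (rule E_star[OF y f])
    ultimately have eq: "(\<lambda>\<omega>. E y f \<omega> + E x (E (star y) f) \<omega>) \<simeq> (\<lambda>\<omega>. f \<omega> - E ?w f \<omega>)"
      by eventually_elim simp
    have "E y f \<in> mble (J x y)" "E x (E (star y) f) \<in> mble (J x y)"
      by (rule mble_mono[OF m(2) Jm up(2) E_mble], rule mble_mono[OF m(1) Jm up(1) E_mble])
    then have "(\<lambda>\<omega>. E y f \<omega> + E x (E (star y) f) \<omega>) \<in> mble (J x y)"
      by (rule borel_measurable_add)
    then show "(\<lambda>\<omega>. f \<omega> - E ?w f \<omega>) \<in> mble (J x y)"
      by (rule mble_cong[OF Jm _ _ eq]) (intro borel_measurable_diff L2_measurable f2 E_borel)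
  qed
  have "star (star x) \<subseteq> star ?w" "star (star y) \<subseteq> star ?w"
    by (intro star_antimono w sx sy Int_lower1 Int_lower2)+
  then show "J x y \<subseteq> star ?w"
    unfolding star_star[OF x] star_star[OF y] by (intro sf_join_least star_mem wm)
qed

lemma completion_join: "x \<in> completion \<Longrightarrow> y \<in> completion \<Longrightarrow> J x y \<in> completion"
  using star_Int_star star_completion completion_Int by metis

lemma star_join:
  assumes "x \<in> completion" "y \<in> completion"
  shows "star (J x y) = star x \<inter> star y"
  using star_star[OF completion_Int[OF star_completion[OF assms(1)] star_completion[OF assms(2)]]]
  unfolding star_Int_star[OF assms] .

lemma E_join:
  assumes x: "x \<in> completion" and y: "y \<in> completion" and f: "f \<in> H1"
  shows "E (J x y) f \<simeq> (\<lambda>\<omega>. E x f \<omega> + E y f \<omega> - E x (E y f) \<omega>)"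
proof -
  have sx: "star x \<in> completion" and sy: "star y \<in> completion" by (intro star_completion x y)+
  have w: "star x \<inter> star y \<in> completion" by (rule completion_Int[OF sx sy])
  have g: "E (star y) f \<in> H1" by (rule completion_H1[OF sy f])
  note f2 = H1_L2[OF f] and m = completion_mem[OF x] completion_mem[OF y]
  have Ey: "E y f \<in> L2_space M" by (rule E_L2[OF m(2) f2])
  have "E (J x y) f \<simeq> (\<lambda>\<omega>. f \<omega> - E (star x \<inter> star y) f \<omega>)"
    using E_star[OF w f] unfolding star_Int_star[OF x y] .
  moreover note E_Int[OF sx sy f] E_star[OF x g] E_star[OF y f]
  moreover have "E x (E (star y) f) \<simeq> E x (\<lambda>\<omega>. f \<omega> - E y f \<omega>)"
    by (intro E_cong m E_star y f E_L2 completion_mem sy f2 L2_diff Ey)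
  moreover have "E x (\<lambda>\<omega>. f \<omega> - E y f \<omega>) \<simeq> (\<lambda>\<omega>. E x f \<omega> - E x (E y f) \<omega>)"
    by (rule E_diff[OF m(1) f2 Ey])
  ultimately show ?thesis by eventually_elim simp
qed

text \<open>
  On the first chaos the join acts as a polynomial in the commuting projections of \<open>y\<close> and \<open>z\<close>.
  Its product with the projection of \<open>x\<close> has values measurable for the right-hand side, and these
  values generate the left-hand side.
\<close>

lemma completion_distrib:
  assumes x: "x \<in> completion" and y: "y \<in> completion" and z: "z \<in> completion"
  shows "x \<inter> J y z = J (x \<inter> y) (x \<inter> z)"
proof
  note m = completion_mem[OF x] completion_mem[OF y] completion_mem[OF z]
  have xy: "x \<inter> y \<in> completion" and xz: "x \<inter> z \<in> completion" by (intro completion_Int x y z)+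
  note mm = completion_mem[OF xy] completion_mem[OF xz]
  have yz: "J y z \<in> completion" by (rule completion_join[OF y z])
  have v: "x \<inter> J y z \<in> completion" by (rule completion_Int[OF x yz])
  let ?R = "J (x \<inter> y) (x \<inter> z)"
  have R: "?R \<in> \<Lambda>" by (rule sf_join_mem[OF mm])
  note up = sf_join_upper[OF mm]
  show "?R \<subseteq> x \<inter> J y z"
    using sf_join_upper[OF m(2,3)] by (intro sf_join_least completion_mem v) auto
  show "x \<inter> J y z \<subseteq> ?R"
  proof (rule le_of_mble[OF v R])
    fix f assume f: "f \<in> H1"
    note f2 = H1_L2[OF f]
    have zf: "E z f \<in> H1" by (rule completion_H1[OF z f])
    have L: "E y f \<in> L2_space M" "E z f \<in> L2_space M" "E y (E z f) \<in> L2_space M"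
      by (intro E_L2 m f2)+
    have "E (x \<inter> J y z) f \<simeq> E x (E (J y z) f)"
      using E_Int[OF x yz f] by eventually_elim simp
    moreover have "E x (E (J y z) f) \<simeq> E x (\<lambda>\<omega>. E y f \<omega> + E z f \<omega> - E y (E z f) \<omega>)"
      by (intro E_cong m E_join y z f E_L2 completion_mem yz f2 L2_diff L2_add L)
    moreover have "E x (\<lambda>\<omega>. E y f \<omega> + E z f \<omega> - E y (E z f) \<omega>) \<simeq>
        (\<lambda>\<omega>. E x (\<lambda>\<omega>. E y f \<omega> + E z f \<omega>) \<omega> - E x (E y (E z f)) \<omega>)"
      by (intro E_diff m L2_add L)
    moreover have "E x (\<lambda>\<omega>. E y f \<omega> + E z f \<omega>) \<simeq> (\<lambda>\<omega>. E x (E y f) \<omega> + E x (E z f) \<omega>)"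
      by (intro E_add m L)
    moreover note E_Int[OF x y f] E_Int[OF x z f] E_Int[OF x y zf]
    ultimately have eq: "(\<lambda>\<omega>. E (x \<inter> y) f \<omega> + E (x \<inter> z) f \<omega> - E (x \<inter> y) (E z f) \<omega>) \<simeq> E (x \<inter> J y z) f"
      by eventually_elim simp
    have "E (x \<inter> y) g \<in> mble ?R" "E (x \<inter> z) g \<in> mble ?R" for g
      by (rule mble_mono[OF mm(1) R up(1) E_mble], rule mble_mono[OF mm(2) R up(2) E_mble])
    then have "(\<lambda>\<omega>. E (x \<inter> y) f \<omega> + E (x \<inter> z) f \<omega> - E (x \<inter> y) (E z f) \<omega>) \<in> mble ?R"
      by (intro borel_measurable_diff borel_measurable_add)
    then show "E (x \<inter> J y z) f \<in> mble ?R"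
      by (rule mble_cong[OF R _ E_borel eq])
  qed
qed

lemma star_disjoint:
  assumes x: "x \<in> completion"
  shows "x \<inter> star x = sf_bot M"
proof
  note m = completion_mem[OF x] star_mem[OF completion_mem[OF x]]
  show "sf_bot M \<subseteq> x \<inter> star x"
    using sf_bot_le[OF m(1)] sf_bot_le[OF m(2)] by blast
  show "x \<inter> star x \<subseteq> sf_bot M"
  proof
    fix A assume A: "A \<in> x \<inter> star x"
    then have "prob (A \<inter> A) = prob A * prob A"
      using indep_setD[OF star_indep[OF x], of A A] by blast
    then have "prob A * (prob A - 1) = 0" by (simp add: algebra_simps)
    then have "prob A = 0 \<or> prob A = 1" by simp
    then show "A \<in> sf_bot M"
      using A sigma_field_le_events[OF m(1)] by (intro sf_botI) auto
  qed
qed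

end

locale classical_noise = noise +
  assumes classical: "U = sf_top M"
begin

lemma join_star:
  assumes x: "x \<in> completion"
  shows "J x (star x) = sf_top M"
proof (rule top_le_eq)
  note m = completion_mem[OF x] star_mem[OF completion_mem[OF x]]
  show Jm: "J x (star x) \<in> \<Lambda>" by (rule sf_join_mem[OF m])
  show "sf_top M \<subseteq> J x (star x)"
    unfolding classical[symmetric]
  proof (rule gen_least[OF H1_sub Jm])
    fix f assume f: "f \<in> H1"
    have "E x f \<in> mble (J x (star x))" "(\<lambda>\<omega>. f \<omega> - E x f \<omega>) \<in> mble (J x (star x))"
      by (rule mble_mono[OF m(1) Jm sf_join_upper(1)[OF m] E_mble],
          rule mble_mono[OF m(2) Jm sf_join_upper(2)[OF m] star_mble[OF m(1) f]])
    then have "(\<lambda>\<omega>. E x f \<omega> + (f \<omega> - E x f \<omega>)) \<in> mble (J x (star x))"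
      by (rule borel_measurable_add)
    then show "f \<in> mble (J x (star x))" by simp
  qed
qed

text \<open>
  That the first chaos generates everything implies the same inside each \<open>b\<close>: the images under
  \<open>E b\<close> and \<open>E (c b)\<close> together generate everything, and the second image is independent of \<open>b\<close>.
\<close>

lemma B_completion:
  assumes b: "b \<in> B"
  shows "b \<in> completion"
proof (rule completionI[OF B_mem[OF b]])
  note m = B_mem[OF b] c_mem'[OF b]
  show "approximable b"
  proof (rule approximableI)
    fix F and \<epsilon> :: real assume "0 < \<epsilon>"
    then show "\<exists>b'\<in>B. \<forall>f\<in>F. l2 (\<lambda>\<omega>. E b f \<omega> - E b' f \<omega>) < \<epsilon>"
      using b by (intro bexI[of _ b]) (auto simp: l2_def)
  qed
  fix z assume z: "z \<in> \<Lambda>" and Ez: "\<And>f. f \<in> H1 \<Longrightarrow> E b f \<in> mble z"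
  let ?z = "z \<inter> b"
  have zb: "?z \<in> \<Lambda>" by (rule sf_Int[OF z m(1)])
  have Jm: "J ?z (c b) \<in> \<Lambda>" by (rule sf_join_mem[OF zb m(2)])
  have "U \<subseteq> J ?z (c b)"
  proof (rule gen_least[OF H1_sub Jm])
    fix f assume f: "f \<in> H1"
    have "E b f \<in> mble ?z" by (intro mble_Int z m Ez f E_mble)
    then have 1: "E b f \<in> mble (J ?z (c b))"
      by (rule mble_mono[OF zb Jm sf_join_upper(1)[OF zb m(2)]])
    have 2: "E (c b) f \<in> mble (J ?z (c b))"
      by (rule mble_mono[OF m(2) Jm sf_join_upper(2)[OF zb m(2)] E_mble])
    have "(\<lambda>\<omega>. E b f \<omega> + E (c b) f \<omega>) \<simeq> f"
      using H1_split[OF f b] by eventually_elim simp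
    then show "f \<in> mble (J ?z (c b))"
      by (rule mble_cong[OF Jm borel_measurable_add[OF 1 2] L2_measurable[OF H1_L2[OF f]]])
  qed
  then have "b \<subseteq> J b (sf_bot M) \<inter> J ?z (c b)"
    using sf_le_top[OF m(1)] sf_join_absorb[OF m(1) sf_bot_le[OF m(1)]] unfolding classical by auto
  also have "\<dots> = J ?z (sf_bot M)"
    by (rule join_Int_join[OF m(1) zb Int_lower2 m(2) sf_bot_mem sf_bot_le[OF m(2)] B_indep[OF b]])
  also have "\<dots> = ?z"
    by (rule sf_join_absorb[OF zb sf_bot_le[OF zb]])
  finally show "b \<subseteq> z" by blast
qed

lemma star_unique:
  assumes x: "x \<in> completion" and y: "y \<in> completion" and comp: "sf_complements M x y"
  shows "y = star x"
proof -
  have s: "star x \<in> completion" by (rule star_completion[OF x])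
  have bot: "J (sf_bot M) v = v" if "v \<in> completion" for v
    using that by (intro J_bot completion_mem)
  have "y = y \<inter> J x (star x)"
    unfolding join_star[OF x] using sf_le_top[OF completion_mem[OF y]] by blast
  also have "\<dots> = J (y \<inter> x) (y \<inter> star x)"
    by (rule completion_distrib[OF y x s])
  also have "\<dots> = y \<inter> star x"
    using comp bot[OF completion_Int[OF y s]] by (simp add: sf_complements_def Int_commute)
  finally have 1: "y = y \<inter> star x" .
  have "star x = star x \<inter> J x y"
    using comp sf_le_top[OF completion_mem[OF s]] by (auto simp: sf_complements_def)
  also have "\<dots> = J (star x \<inter> x) (star x \<inter> y)"
    by (rule completion_distrib[OF s x y])
  also have "\<dots> = star x \<inter> y"
    using star_disjoint[OF x] bot[OF completion_Int[OF s y]] by (simp add: Int_commute)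
  finally show ?thesis using 1 by blast
qed

lemma star_complements: "x \<in> completion \<Longrightarrow> sf_complements M x (star x)"
  by (simp add: sf_complements_def star_disjoint join_star)

lemma completion_compl: 
  assumes x: "x \<in> completion"
  shows "sf_compl M completion x = star x"
  unfolding sf_compl_def
proof (rule the_equality)
  show "star x \<in> completion \<and> sf_complements M x (star x)"
    by (intro conjI star_completion star_complements x)
  show "y = star x" if "y \<in> completion \<and> sf_complements M x y" for y
    using that by (elim conjE) (rule star_unique[OF x])
qed

lemma completion_noise_type: "noise_type_boolean_algebra M completion"
  unfolding noise_type_boolean_algebra_def
proof (intro conjI ballI)
  show "completion \<subseteq> \<Lambda>" using completion_mem by blast
  show "sf_bot M \<in> completion" "sf_top M \<in> completion"
    by (intro B_completion B_bot B_top)+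
  show "\<exists>y\<in>completion. sf_complements M x y" if "x \<in> completion" for x
    using that by (intro bexI[of _ "star x"] star_complements star_completion)
  show "indep_set x (sf_compl M completion x)" if "x \<in> completion" for x
    unfolding completion_compl[OF that] by (rule star_indep[OF that])
qed (auto simp: completion_Int completion_join completion_distrib)

lemma finite_Sup_completion: "finite Y \<Longrightarrow> Y \<subseteq> completion \<Longrightarrow> sf_Sup M Y \<in> completion"
proof (induction rule: finite_induct)
  case empty
  show ?case unfolding sf_Sup_empty by (rule B_completion[OF B_bot])
next
  case (insert a Y)
  have "a \<in> \<Lambda>" "Y \<subseteq> \<Lambda>" using insert.prems completion_mem by auto
  then show ?case
    using insert by (simp add: sf_Sup_insert completion_join)
qed

text \<open>
  The martingale approximation, along the finite subfamilies of \<open>X\<close>, with a \<open>\<sigma>\<close>-field \<open>v\<close>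
  adjoined.
\<close>

lemma Sup_approximation:
  assumes X: "X \<subseteq> \<Lambda>" and v: "v \<in> \<Lambda>" and f: "f \<in> L2_of (J v (sf_Sup M X))" and e: "0 < e"
  obtains Y where "finite Y" "Y \<subseteq> X" "l2 (\<lambda>\<omega>. f \<omega> - E (J v (sf_Sup M Y)) f \<omega>) < e"
proof -
  define K where "K = {J v (sf_Sup M Y) | Y. finite Y \<and> Y \<subseteq> X}"
  have SL: "sf_Sup M Y \<in> \<Lambda>" if "Y \<subseteq> X" for Y using that X by (intro sf_Sup_mem) auto
  have K: "K \<subseteq> \<Lambda>" unfolding K_def using SL by (auto intro: sf_join_mem v)
  have KY: "J v (sf_Sup M Y) \<subseteq> sf_Sup M K" if "finite Y" "Y \<subseteq> X" for Y
    by (rule sf_Sup_upper[OF K]) (use that in \<open>auto simp: K_def\<close>)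
  note KL = sf_Sup_mem[OF K]
  have "J v (sf_Sup M X) \<subseteq> sf_Sup M K"
  proof (rule sf_join_least[OF KL])
    show "v \<subseteq> sf_Sup M K"
      using KY[of "{}"] sf_join_upper(1)[OF v SL[of "{}"]] by auto
    show "sf_Sup M X \<subseteq> sf_Sup M K"
    proof (rule sf_Sup_least[OF KL])
      fix x assume x: "x \<in> X"
      then have "x \<subseteq> sf_Sup M {x}" using X by (intro sf_Sup_upper) auto
      also have "\<dots> \<subseteq> J v (sf_Sup M {x})" using x by (intro sf_join_upper v SL) auto
      also have "\<dots> \<subseteq> sf_Sup M K" using x by (intro KY) auto
      finally show "x \<subseteq> sf_Sup M K" .
    qed
  qed
  moreover have Jm: "J v (sf_Sup M X) \<in> \<Lambda>" by (intro sf_join_mem v SL) simp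
  ultimately have fK: "f \<in> L2_of (sf_Sup M K)"
    using L2_of_mono[OF Jm KL _ f] by simp
  have ne: "K \<noteq> {}" unfolding K_def by blast
  have dir: "\<exists>z\<in>K. p \<subseteq> z \<and> q \<subseteq> z" if pq: "p \<in> K" "q \<in> K" for p q
  proof -
    from pq obtain Y Z where Y: "finite Y" "Y \<subseteq> X" "p = J v (sf_Sup M Y)"
      and Z: "finite Z" "Z \<subseteq> X" "q = J v (sf_Sup M Z)" unfolding K_def by blast
    have YZ: "Y \<union> Z \<subseteq> X" "finite (Y \<union> Z)" using Y Z by auto
    have le: "sf_Sup M Y \<subseteq> sf_Sup M (Y \<union> Z)" "sf_Sup M Z \<subseteq> sf_Sup M (Y \<union> Z)"
      using YZ X by (intro sf_Sup_mono; auto)+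
    note mono = sf_join_mono[OF subset_refl _ v SL[OF YZ(1)]]
    have "p \<subseteq> J v (sf_Sup M (Y \<union> Z))" "q \<subseteq> J v (sf_Sup M (Y \<union> Z))"
      unfolding Y(3) Z(3) by (rule mono[OF le(1)], rule mono[OF le(2)])
    moreover have "J v (sf_Sup M (Y \<union> Z)) \<in> K" unfolding K_def using YZ by blast
    ultimately show ?thesis by (intro bexI[of _ "J v (sf_Sup M (Y \<union> Z))"] conjI)
  qed
  obtain k where k: "k \<in> K" "l2 (\<lambda>\<omega>. f \<omega> - E k f \<omega>) < e"
    using directed_Sup_approximation[OF K ne dir fK e] by blast
  then obtain Y where "finite Y" "Y \<subseteq> X" "k = J v (sf_Sup M Y)" unfolding K_def by blast
  then show ?thesis using that k(2) by simp
qed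

text \<open>
  Conditional expectations on the supremum are approximated by those on finite joins of members of
  \<open>X\<close>; the finite joins belong to the completion and are approximated in turn by members of \<open>B\<close>.
\<close>

lemma completion_Sup:
  assumes X: "X \<subseteq> completion"
  shows "sf_Sup M X \<in> completion"
proof (rule completionI)
  have XL: "X \<subseteq> \<Lambda>" using X completion_mem by blast
  let ?s = "sf_Sup M X"
  show s: "?s \<in> \<Lambda>" by (rule sf_Sup_mem[OF XL])
  have SL: "sf_Sup M Y \<in> \<Lambda>" if "Y \<subseteq> X" for Y using that XL by (intro sf_Sup_mem) auto
  show "approximable ?s"
  proof (rule approximableI)
    fix F and \<epsilon> :: real assume F: "finite F" "F \<subseteq> H1" "0 < \<epsilon>"
    then have \<epsilon>: "0 < \<epsilon> / 2" by simp
    have "\<exists>Y. finite Y \<and> Y \<subseteq> X \<and> l2 (\<lambda>\<omega>. E ?s f \<omega> - E (sf_Sup M Y) f \<omega>) < \<epsilon> / 2" if "f \<in> F" for f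
    proof -
      have f2: "f \<in> L2_space M" using that F(2) H1_L2 by blast
      have "E ?s f \<in> L2_of (J (sf_bot M) ?s)"
        unfolding J_bot[OF s] by (rule E_L2_of[OF s f2])
      then obtain Y where Y: "finite Y" "Y \<subseteq> X"
          "l2 (\<lambda>\<omega>. E ?s f \<omega> - E (J (sf_bot M) (sf_Sup M Y)) (E ?s f) \<omega>) < \<epsilon> / 2"
        using Sup_approximation[OF XL sf_bot_mem _ \<epsilon>] by blast
      have "E (sf_Sup M Y) (E ?s f) \<simeq> E (sf_Sup M Y) f"
        by (intro E_tower SL Y(2) s sf_Sup_mono XL f2)
      then have "l2 (\<lambda>\<omega>. E ?s f \<omega> - E (sf_Sup M Y) (E ?s f) \<omega>) = l2 (\<lambda>\<omega>. E ?s f \<omega> - E (sf_Sup M Y) f \<omega>)"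
        by (intro l2_cong L2_diff E_L2 SL Y(2) s f2) (auto elim!: eventually_mono)
      then show ?thesis using Y unfolding J_bot[OF SL[OF Y(2)]] by (intro exI[of _ Y]) simp
    qed
    then have "\<exists>Y. \<forall>f\<in>F. finite (Y f) \<and> Y f \<subseteq> X \<and> l2 (\<lambda>\<omega>. E ?s f \<omega> - E (sf_Sup M (Y f)) f \<omega>) < \<epsilon> / 2"
      by (intro bchoice ballI)
    then obtain Y where Y: "\<forall>f\<in>F. finite (Y f) \<and> Y f \<subseteq> X \<and>
        l2 (\<lambda>\<omega>. E ?s f \<omega> - E (sf_Sup M (Y f)) f \<omega>) < \<epsilon> / 2" by (rule exE)
    let ?Y = "\<Union>f\<in>F. Y f"
    have fY: "finite ?Y" "?Y \<subseteq> X" using Y F(1) by auto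
    have t: "sf_Sup M ?Y \<in> completion" using fY X by (intro finite_Sup_completion) auto
    note tm = completion_mem[OF t]
    obtain b where b: "b \<in> B" "\<And>f. f \<in> F \<Longrightarrow> l2 (\<lambda>\<omega>. E (sf_Sup M ?Y) f \<omega> - E b f \<omega>) < \<epsilon> / 2"
      using approximableE[OF completion_approx[OF t] F(1,2) \<epsilon>] by blast
    show "\<exists>b\<in>B. \<forall>f\<in>F. l2 (\<lambda>\<omega>. E ?s f \<omega> - E b f \<omega>) < \<epsilon>"
    proof (intro bexI[of _ b] ballI b(1))
      fix f assume fF: "f \<in> F"
      have f2: "f \<in> L2_space M" using fF F(2) H1_L2 by blast
      have Yf: "Y f \<subseteq> X" "l2 (\<lambda>\<omega>. E ?s f \<omega> - E (sf_Sup M (Y f)) f \<omega>) < \<epsilon> / 2"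
        using Y fF by auto
      have le: "sf_Sup M (Y f) \<subseteq> sf_Sup M ?Y"
        using fF fY(2) XL by (intro sf_Sup_mono) auto
      have Es: "E ?s f \<in> L2_space M" by (rule E_L2[OF s f2])
      have "E (sf_Sup M ?Y) (E ?s f) \<simeq> E (sf_Sup M ?Y) f"
        by (intro E_tower tm s sf_Sup_mono fY(2) XL f2)
      then have "l2 (\<lambda>\<omega>. E ?s f \<omega> - E (sf_Sup M ?Y) f \<omega>) = l2 (\<lambda>\<omega>. E ?s f \<omega> - E (sf_Sup M ?Y) (E ?s f) \<omega>)"
        by (intro l2_cong L2_diff E_L2 tm s f2) (auto elim!: eventually_mono)
      also have "\<dots> \<le> l2 (\<lambda>\<omega>. E ?s f \<omega> - E (sf_Sup M (Y f)) f \<omega>)"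
        by (rule E_best_approximation[OF tm Es L2_of_mono[OF SL[OF Yf(1)] tm le E_L2_of[OF SL[OF Yf(1)] f2]]])
      finally have "l2 (\<lambda>\<omega>. E ?s f \<omega> - E (sf_Sup M ?Y) f \<omega>) < \<epsilon> / 2" using Yf(2) by linarith
      moreover have "l2 (\<lambda>\<omega>. E ?s f \<omega> - E b f \<omega>) \<le>
          l2 (\<lambda>\<omega>. E ?s f \<omega> - E (sf_Sup M ?Y) f \<omega>) + l2 (\<lambda>\<omega>. E (sf_Sup M ?Y) f \<omega> - E b f \<omega>)"
        by (intro l2_triangle_diff E_L2 s tm B_mem b(1) f2)
      ultimately show "l2 (\<lambda>\<omega>. E ?s f \<omega> - E b f \<omega>) < \<epsilon>" using b(2)[OF fF] by linarith
    qed
  qed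
  fix z assume z: "z \<in> \<Lambda>" and Ez: "\<And>f. f \<in> H1 \<Longrightarrow> E ?s f \<in> mble z"
  show "?s \<subseteq> z"
  proof (rule sf_Sup_least[OF z])
    fix x assume x: "x \<in> X"
    then have xc: "x \<in> completion" using X by blast
    note xm = completion_mem[OF xc]
    show "x \<subseteq> z"
    proof (rule le_of_mble[OF xc z])
      fix f assume f: "f \<in> H1"
      have "E ?s (E x f) \<simeq> E x f"
        by (rule E_tower'[OF xm s sf_Sup_upper[OF XL x] H1_L2[OF f]])
      then show "E x f \<in> mble z"
        by (rule mble_cong[OF z Ez[OF completion_H1[OF xc f]] E_borel])
    qed
  qed
qed

text \<open>
  The infimum is \<open>star w\<close>, where \<open>w\<close> is the supremum of the complements. An event \<open>A\<close> of the
  infimum lies, for each finite join \<open>q\<close> of complements, in \<open>star q\<close> and hence is independent of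
  \<open>q\<close>; therefore its conditional expectation on \<open>star w \<squnion> q\<close> equals that on \<open>star w\<close>. As \<open>q\<close>
  increases to \<open>w\<close>, the former tends to the indicator of \<open>A\<close>.
\<close>

lemma completion_Inf:
  assumes X: "X \<subseteq> completion"
  shows "sf_Inf M X \<in> completion"
proof -
  have XL: "X \<subseteq> \<Lambda>" using X completion_mem by blast
  have sX: "star ` X \<subseteq> completion" using X star_completion by blast
  then have sL: "star ` X \<subseteq> \<Lambda>" using completion_mem by blast
  define w where "w = sf_Sup M (star ` X)"
  have w: "w \<in> completion" unfolding w_def by (rule completion_Sup[OF sX])
  have s: "star w \<in> completion" by (rule star_completion[OF w])
  note wm = completion_mem[OF w] and sm = completion_mem[OF s]
  have "sf_Inf M X = star w"
  proof
    show "star w \<subseteq> sf_Inf M X"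
    proof -
      have "star w \<subseteq> x" if x: "x \<in> X" for x
      proof -
        have xc: "x \<in> completion" using x X by blast
        have "star x \<subseteq> w" unfolding w_def using x by (intro sf_Sup_upper[OF sL]) auto
        then have "star w \<subseteq> star (star x)"
          by (intro star_antimono star_completion xc w)
        then show ?thesis unfolding star_star[OF xc] .
      qed
      then show ?thesis unfolding sf_Inf_def using sf_le_top[OF sm] by blast
    qed
    show "sf_Inf M X \<subseteq> star w"
    proof
      fix A assume A: "A \<in> sf_Inf M X"
      have AM: "A \<in> sets M" using A by (simp add: sf_Inf_def sf_top_def)
      let ?a = "indicator A :: 'a \<Rightarrow> real"
      have a: "?a \<in> L2_space M" by (rule L2_indicator[OF AM])
      have top: "J (star w) w = sf_top M"
        using join_star[OF w] by (simp add: sf_join_commute)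
      have bot: "star (sf_bot M) = sf_top M"
        using join_star[OF B_completion[OF B_bot]] J_bot[OF star_mem[OF sf_bot_mem]] by simp
      have inY: "A \<in> star (sf_Sup M (star ` Y))" if "finite Y" "Y \<subseteq> X" for Y
        using that
      proof (induction rule: finite_induct)
        case empty
        then show ?case using A by (simp add: sf_Sup_empty bot sf_Inf_def)
      next
        case (insert x Y)
        have xc: "x \<in> completion" "star ` Y \<subseteq> completion" using insert.prems X sX by auto
        have "star ` Y \<subseteq> \<Lambda>" using xc(2) completion_mem by blast
        then have "sf_Sup M (star ` insert x Y) = J (star x) (sf_Sup M (star ` Y))"
          using sf_Sup_insert[OF star_mem[OF completion_mem[OF xc(1)]]] by simp
        then have "star (sf_Sup M (star ` insert x Y)) = star (star x) \<inter> star (sf_Sup M (star ` Y))"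
          using star_join[OF star_completion[OF xc(1)] completion_Sup[OF xc(2)]] by simp
        moreover have "A \<in> x" using A insert.prems by (simp add: sf_Inf_def)
        ultimately show ?case
          using insert unfolding star_star[OF xc(1)] by simp
      qed
      have "?a \<in> L2_of (sf_top M)"
        using A by (intro L2_of_indicator sf_top_mem) (simp add: sf_Inf_def)
      then have at: "?a \<in> L2_of (J (star w) (sf_Sup M (star ` X)))"
        using top unfolding w_def by simp
      have "(\<lambda>\<omega>. ?a \<omega> - E (star w) ?a \<omega>) \<simeq> (\<lambda>_. 0)"
      proof (rule l2_small_zero[OF L2_diff[OF a E_L2[OF sm a]]])
        fix e :: real assume e: "0 < e"
        obtain Z where Z: "finite Z" "Z \<subseteq> star ` X" "l2 (\<lambda>\<omega>. ?a \<omega> - E (J (star w) (sf_Sup M Z)) ?a \<omega>) < e"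
          using Sup_approximation[OF sL sm at e] by blast
        obtain Y where Y: "finite Y" "Y \<subseteq> X" "Z = star ` Y"
          using finite_subset_image[OF Z(1,2)] by blast
        let ?q = "sf_Sup M Z"
        have q: "?q \<in> completion" using Z(2) sX by (intro completion_Sup) auto
        note qm = completion_mem[OF q] and qsm = star_mem[OF completion_mem[OF q]]
        have "?q \<subseteq> w" unfolding w_def by (rule sf_Sup_mono[OF Z(2) sL])
        then have sub: "star w \<subseteq> star ?q" by (rule star_antimono[OF q w])
        have "?a \<in> L2_of (star ?q)"
          unfolding Y(3) by (rule L2_of_indicator[OF qsm[unfolded Y(3)] inY[OF Y(1,2)]])
        then have "E (J (star w) ?q) ?a \<simeq> E (star w) ?a"
          by (rule E_join_indep[OF qsm sm sub qm indep_set_commute[OF star_indep[OF q]]])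
        then have "l2 (\<lambda>\<omega>. ?a \<omega> - E (star w) ?a \<omega>) = l2 (\<lambda>\<omega>. ?a \<omega> - E (J (star w) ?q) ?a \<omega>)"
          by (intro l2_cong L2_diff a E_L2 sm sf_join_mem qm) (auto elim!: eventually_mono)
        then show "l2 (\<lambda>\<omega>. ?a \<omega> - E (star w) ?a \<omega>) \<le> e" using Z(3) by simp
      qed
      then have "E (star w) ?a \<simeq> ?a" by eventually_elim simp
      then have "?a \<in> mble (star w)" by (rule E_idD[OF sm a])
      then show "A \<in> star w" by (rule mble_indicatorD[OF sm AM])
    qed
  qed
  then show ?thesis using s by simp
qed

lemma completion_complete: "complete_noise_type_boolean_algebra M completion"
  unfolding complete_noise_type_boolean_algebra_def
  using completion_noise_type completion_Inf completion_Sup by blast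

end

section \<open>The equivalence\<close>

context noise
begin

lemma sup_inf_if_complete:
  assumes "complete_noise_type_boolean_algebra M B'" and sub: "B \<subseteq> B'" and x: "range x \<subseteq> B"
  shows "J (sf_Sup M (range x)) (sf_Inf M (range (\<lambda>n. c (x n)))) = sf_top M"
proof -
  have nt: "noise_type_boolean_algebra M B'"
    and complete: "\<And>X. X \<subseteq> B' \<Longrightarrow> sf_Inf M X \<in> B' \<and> sf_Sup M X \<in> B'"
    using assms(1) unfolding complete_noise_type_boolean_algebra_def by auto
  interpret N: noise M B' by unfold_locales (rule nt)
  have xB: "x n \<in> B" for n using x by auto
  have c: "c (x n) = sf_compl M B' (x n)" for n
  proof (rule N.c_unique)
    show "x n \<in> B'" "c (x n) \<in> B'" using xB c_mem sub by auto
  qed (simp_all add: c_Int c_join xB)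
  let ?s = "sf_Sup M (range x)" and ?i = "sf_Inf M (range (\<lambda>n. c (x n)))"
  have s: "?s \<in> B'" using complete[of "range x"] x sub by auto
  have "range (\<lambda>n. c (x n)) \<subseteq> B'" using xB c_mem sub by auto
  then have i: "?i \<in> B'" using complete by blast
  have "sf_compl M B' ?s \<subseteq> c (x n)" for n
    unfolding c using xB sub B_sub x by (intro N.c_antimono s sf_Sup_upper) auto
  then have "sf_compl M B' ?s \<subseteq> ?i"
    unfolding sf_Inf_def using sf_le_top[OF N.c_mem'[OF s]] by auto
  then show ?thesis using N.c_le_iff_join[OF s i] by simp
qed

end

theorem theorem1p5:
  fixes M :: "'a measure" and B :: "'a set set set"
  assumes "prob_space M"
    and "L2_separable M"
    and "noise_type_boolean_algebra M B"
  shows "(classical M B \<longleftrightarrow>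
            (\<exists>B'. complete_noise_type_boolean_algebra M B' \<and> B \<subseteq> B'))
       \<and> (classical M B \<longleftrightarrow>
            (\<forall>x :: nat \<Rightarrow> 'a set set. range x \<subseteq> B \<and> incseq x \<longrightarrow>
               sf_join M (sf_Sup M (range x)) (sf_Inf M (range (\<lambda>n. sf_compl M B (x n))))
                 = sf_top M))"
    (is "(?a \<longleftrightarrow> ?b) \<and> (?a \<longleftrightarrow> ?c)")
proof -
  interpret prob_space M by fact
  interpret noise M B by unfold_locales fact
  have "?b" if ?a
  proof -
    interpret classical_noise M B
      using that by unfold_locales (simp add: classical_iff)
    show ?b using completion_complete B_completion by blast
  qed
  moreover have "?c" if ?b
    using that sup_inf_if_complete by blast
  moreover have "?a" if ?c
    using that by (intro classical_if_sup_inf) blast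
  ultimately show ?thesis by blast
qed

end
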